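(* Let $\mathfrak{M}(\eta,\Delta)$ be an absorbing control model satisfying Condition (S). Given a measure $\mu\in\mathcal{C}_\eta$, we have $\mu\in\mathcal{O}_\eta$ if and only if $\mu^{\mathbf{X}}\ll\eta^\beta$. Equivalently, $\mathcal{O}_\eta$ is the set of all $\mu\in\mathcal{M}^+(\mathbf{X}\times\mathbf{A})$ such that $\mu(\mathbf{K}^c)=0$, $\mu^{\mathbf{X}}(B)=\eta(B\cap\Delta^c)+\int_{\mathbf{X}\times\mathbf{A}}Q(B\cap\Delta^c|x,a)\mu(dx,da)$ for all $B\in\mathfrak{X}$, and $\mu^{\mathbf{X}}\ll\eta^\beta$.
   Context: For a measurable space $\mathbf{\Omega}$, $\mathcal{M}^+(\mathbf{\Omega})$ is the set of finite nonnegative measures and $\mathcal{P}(\mathbf{\Omega})$ the set of probability measures on it. For $\mu\in\mathcal{M}^+(\mathbf{X}\times\mathbf{A})$, $\mu^{\mathbf{X}}=\mu(\cdot\times\mathbf{A})$ is its $\mathbf{X}$-marginal. Control model. $(\mathbf{X},\mathfrak{X})$ is a measurable space (state space); $\mathbf{A}$ is a Borel space (action space) with Borel $\sigma$-algebra $\mathfrak{B}(\mathbf{A})$; for each $x\in\mathbf{X}$, $\mathbf{A}(x)\subseteq\mathbf{A}$ is a nonempty measurable set of available actions; $\mathbf{K}=\{(x,a):a\in\mathbf{A}(x)\}$ is assumed to be in $\mathfrak{X}\otimes\mathfrak{B}(\mathbf{A})$ and to contain the graph of a measurable function $f:\mathbf{X}\to\mathbf{A}$ with $f(x)\in\mathbf{A}(x)$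 for all $x$; $Q$ is a stochastic kernel on $\mathbf{X}$ given $\mathbf{X}\times\mathbf{A}$; $\eta\in\mathcal{P}(\mathbf{X})$ is an initial distribution; $\Delta\in\mathfrak{X}$ is a given set. This model is denoted $\mathfrak{M}(\eta,\Delta)$. Policies. Let $\mathbf{H}_0=\mathbf{X}$, $\mathbf{H}_n=\mathbf{H}_{n-1}\times\mathbf{A}\times\mathbf{X}$. A policy $\pi=\{\pi_n\}_{n\ge0}\in\mathbf{\Pi}$ is a sequence of stochastic kernels $\pi_n$ on $\mathbf{A}$ given $\mathbf{H}_n$ with $\pi_n(\mathbf{A}(x_n)|h_n)=1$ for all $h_n=(x_0,a_0,\ldots,x_n)\in\mathbf{H}_n$. $\mathbf{M}$ is the set of stochastic kernels $\sigma$ on $\mathbf{A}$ given $\mathbf{X}$ with $\sigma(\mathbf{A}(x)|x)=1$ for all $x$; each $\sigma\in\mathbf{M}$ is identified with the stationary randomized policy $\pi_n(\cdot|h_n)=\sigma(\cdot|x_n)$. For an initial distribution $\lambda\in\mathcal{P}(\mathbf{X})$ and $\pi\in\mathbf{\Pi}$, $\mathbb{P}_{\lambda,\pi}$ (expectation $\mathbb{E}_{\lambda,\pi}$) is the unique probability measure on $(\mathbf{X}\times\mathbf{A})^\infty$ under which the coordinate processes satisfy $X_0\sim\lambda$, $\mathbb{P}_{\lambda,\pi}(A_n\in\cdot\mid X_0,A_0,\ldots,X_n)=\pi_n(\cdot\mid X_0,A_0,\ldots,X_n)$ and $\mathbb{P}_{\lambda,\pi}(X_{n+1}\in\cdot\mid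 X_0,A_0,\ldots,X_n,A_n)=Q(\cdot\mid X_n,A_n)$ almost surely. For $\sigma\in\mathbf{M}$, $Q_\sigma(D|x)=\int_{\mathbf{A}}Q(D|x,a)\sigma(da|x)$, and $Q_\sigma^k$ is its $k$-fold composition, with $Q^0_\sigma(\cdot|x)=\delta_x$. Let $T_\Delta=\min\{n\ge0:X_n\in\Delta\}$ ($=\infty$ if there is no such $n$). The model $\mathfrak{M}(\lambda,\Delta)$ is absorbing if (a) $Q(\Delta|x,a)=1$ for all $(x,a)\in\Delta\times\mathbf{A}$, and (b) $\mathbb{E}_{\lambda,\pi}[T_\Delta]<\infty$ for every $\pi\in\mathbf{\Pi}$. Occupation measures. $\mu_{\lambda,\pi}(\Gamma)=\mathbb{E}_{\lambda,\pi}\big[\sum_{t=0}^\infty \mathbf{1}_{\{T_\Delta>t\}}\mathbf{1}_{\{(X_t,A_t)\in\Gamma\}}\big]$ for $\Gamma\in\mathfrak{X}\otimes\mathfrak{B}(\mathbf{A})$; $\mathcal{O}_\lambda=\{\mu_{\lambda,\pi}:\pi\in\mathbf{\Pi}\}$. Characteristic equations. $\mathcal{C}_\eta$ is the set of $\mu\in\mathcal{M}^+(\mathbf{X}\times\mathbf{A})$ such that $\mu(\mathbf{K}^c)=0$ and $\mu^{\mathbf{X}}(B)=\eta(B\cap\Delta^c)+\int_{\mathbf{X}\times\mathbf{A}}Q(B\cap\Delta^c|x,a)\mu(dx,da)$ for all $B\in\mathfrak{X}$. Condition (S): (S1) $\mathbf{A}$ is compact and the correspondence $x\mapsto\mathbf{A}(x)$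 is weakly measurable (i.e. $\{x:\mathbf{A}(x)\cap G\ne\emptyset\}\in\mathfrak{X}$ for every open $G\subseteq\mathbf{A}$) with nonempty compact values; (S2) for every $x\in\mathbf{X}$ and $\Gamma\in\mathfrak{X}$, the mapping $a\mapsto Q(\Gamma|x,a)$ is continuous on $\mathbf{A}(x)$. Reference measure. Under Condition (S) there exists $\xi^*\in\mathbf{M}$ such that $Q(\cdot|x,a)\ll Q_{\xi^*}(\cdot|x)$ for every $(x,a)\in\mathbf{K}$. Fix such a $\xi^*$ and a parameter $0<\beta<1$, and let $\eta^\beta=(1-\beta)\sum_{k=0}^\infty\beta^k\,\eta Q_{\xi^*}^k\in\mathcal{P}(\mathbf{X})$. *)

theory Defs
  imports "HOL-Probability.Probability"
begin

text \<open>
  A control model is given by a measurable space \<open>X\<close> of states (only \<open>space X\<close> and \<open>sets X\<close> matter),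
  a Borel subset \<open>A\<close> of a Polish space (the Borel space of actions), the sets \<open>Ad x\<close> of actions
  available at \<open>x\<close>, a transition kernel \<open>Q\<close>, an initial distribution and a set \<open>\<Delta>\<close> of states.
  Stochastic kernels are the measurable maps into \<^const>\<open>prob_algebra\<close>.
\<close>

abbreviation action_space :: "'a::polish_space set \<Rightarrow> 'a measure" where
  "action_space A \<equiv> restrict_space borel A"

abbreviation state_action :: "'x measure \<Rightarrow> 'a::polish_space set \<Rightarrow> ('x \<times> 'a) measure" where
  "state_action X A \<equiv> X \<Otimes>\<^sub>M action_space A"

definition finite_measures :: "'b measure \<Rightarrow> 'b measure set" where
  "finite_measures N = {\<mu>. sets \<mu> = sets N \<and> finite_measure \<mu>}"

definition prob_measures :: "'b measure \<Rightarrow> 'b measure set" where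
  "prob_measures N = {\<mu>. sets \<mu> = sets N \<and> prob_space \<mu>}"

definition state_marginal :: "'x measure \<Rightarrow> ('x \<times> 'a) measure \<Rightarrow> 'x measure" where
  "state_marginal X \<mu> = distr \<mu> X fst"

definition feasible_pairs :: "'x measure \<Rightarrow> ('x \<Rightarrow> 'a set) \<Rightarrow> ('x \<times> 'a) set" where
  "feasible_pairs X Ad = {(x, a). x \<in> space X \<and> a \<in> Ad x}"

locale control_model =
  fixes X :: "'x measure"
    and A :: "'a::polish_space set"
    and Ad :: "'x \<Rightarrow> 'a set"
    and Q :: "'x \<times> 'a \<Rightarrow> 'x measure"
    and \<eta> :: "'x measure"
    and \<Delta> :: "'x set"
  assumes actions_borel: "A \<in> sets borel"
    and available_subset: "\<And>x. x \<in> space X \<Longrightarrow> Ad x \<subseteq> A"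
    and available_nonempty: "\<And>x. x \<in> space X \<Longrightarrow> Ad x \<noteq> {}"
    and available_measurable: "\<And>x. x \<in> space X \<Longrightarrow> Ad x \<in> sets (action_space A)"
    and feasible_measurable: "feasible_pairs X Ad \<in> sets (state_action X A)"
    and selector: "\<exists>f \<in> X \<rightarrow>\<^sub>M action_space A. \<forall>x\<in>space X. f x \<in> Ad x"
    and transition_kernel: "Q \<in> state_action X A \<rightarrow>\<^sub>M prob_algebra X"
    and initial_distribution: "\<eta> \<in> prob_measures X"
    and target_measurable: "\<Delta> \<in> sets X"

text \<open>
  A history \<open>(x\<^sub>0, a\<^sub>0, \<dots>, x\<^sub>n)\<close> is encoded as the pair of the finite sequence of the
  state-action pairs \<open>(x\<^sub>i, a\<^sub>i)\<close>, \<open>i < n\<close>, and the current state \<open>x\<^sub>n\<close>.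
\<close>

definition histories ::
  "'x measure \<Rightarrow> 'a::polish_space set \<Rightarrow> nat \<Rightarrow> ((nat \<Rightarrow> 'x \<times> 'a) \<times> 'x) measure" where
  "histories X A n = (\<Pi>\<^sub>M i\<in>{..<n}. state_action X A) \<Otimes>\<^sub>M X"

definition policies ::
  "'x measure \<Rightarrow> 'a::polish_space set \<Rightarrow> ('x \<Rightarrow> 'a set)
    \<Rightarrow> (nat \<Rightarrow> (nat \<Rightarrow> 'x \<times> 'a) \<times> 'x \<Rightarrow> 'a measure) set" where
  "policies X A Ad = {\<pi>. \<forall>n. \<pi> n \<in> histories X A n \<rightarrow>\<^sub>M prob_algebra (action_space A) \<and>
     (\<forall>h x. (h, x) \<in> space (histories X A n) \<longrightarrow> measure (\<pi> n (h, x)) (Ad x) = 1)}"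

definition markov_kernels ::
  "'x measure \<Rightarrow> 'a::polish_space set \<Rightarrow> ('x \<Rightarrow> 'a set) \<Rightarrow> ('x \<Rightarrow> 'a measure) set" where
  "markov_kernels X A Ad = {\<sigma> \<in> X \<rightarrow>\<^sub>M prob_algebra (action_space A).
     \<forall>x\<in>space X. measure (\<sigma> x) (Ad x) = 1}"

text \<open>The canonical space; the coordinate processes are \<open>X\<^sub>n \<omega> = fst (\<omega> n)\<close> and \<open>A\<^sub>n \<omega> = snd (\<omega> n)\<close>.\<close>

definition trajectories ::
  "'x measure \<Rightarrow> 'a::polish_space set \<Rightarrow> (nat \<Rightarrow> 'x \<times> 'a) measure" where
  "trajectories X A = (\<Pi>\<^sub>M i\<in>UNIV. state_action X A)"

definition history :: "nat \<Rightarrow> (nat \<Rightarrow> 'x \<times> 'a) \<Rightarrow> (nat \<Rightarrow> 'x \<times> 'a) \<times> 'x" where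
  "history n \<omega> = (restrict \<omega> {..<n}, fst (\<omega> n))"

definition is_policy_law ::
  "'x measure \<Rightarrow> 'a::polish_space set \<Rightarrow> ('x \<times> 'a \<Rightarrow> 'x measure) \<Rightarrow> 'x measure
    \<Rightarrow> (nat \<Rightarrow> (nat \<Rightarrow> 'x \<times> 'a) \<times> 'x \<Rightarrow> 'a measure) \<Rightarrow> (nat \<Rightarrow> 'x \<times> 'a) measure \<Rightarrow> bool" where
  "is_policy_law X A Q \<nu> \<pi> P \<longleftrightarrow>
     P \<in> prob_measures (trajectories X A) \<and>
     distr P X (\<lambda>\<omega>. fst (\<omega> 0)) = \<nu> \<and>
     (\<forall>n. \<forall>C\<in>sets (action_space A). AE \<omega> in P.
        real_cond_exp P (vimage_algebra (space P) (history n) (histories X A n))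
          (\<lambda>\<omega>. indicator C (snd (\<omega> n))) \<omega>
        = measure (\<pi> n (history n \<omega>)) C) \<and>
     (\<forall>n. \<forall>B\<in>sets X. AE \<omega> in P.
        real_cond_exp P
          (vimage_algebra (space P) (\<lambda>\<omega>. (history n \<omega>, snd (\<omega> n)))
             (histories X A n \<Otimes>\<^sub>M action_space A))
          (\<lambda>\<omega>. indicator B (fst (\<omega> (Suc n)))) \<omega>
        = measure (Q (\<omega> n)) B)"

text \<open>Such a law exists and is unique by the Ionescu-Tulcea theorem.\<close>

definition policy_law ::
  "'x measure \<Rightarrow> 'a::polish_space set \<Rightarrow> ('x \<times> 'a \<Rightarrow> 'x measure) \<Rightarrow> 'x measure
    \<Rightarrow> (nat \<Rightarrow> (nat \<Rightarrow> 'x \<times> 'a) \<times> 'x \<Rightarrow> 'a measure) \<Rightarrow> (nat \<Rightarrow> 'x \<times> 'a) measure" where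
  "policy_law X A Q \<nu> \<pi> = (THE P. is_policy_law X A Q \<nu> \<pi> P)"

text \<open>The infimum of the empty set is \<open>\<infinity>\<close>.\<close>

definition hitting_time :: "'x set \<Rightarrow> (nat \<Rightarrow> 'x \<times> 'a) \<Rightarrow> enat" where
  "hitting_time \<Delta> \<omega> = Inf (enat ` {n. fst (\<omega> n) \<in> \<Delta>})"

definition absorbing ::
  "'x measure \<Rightarrow> 'a::polish_space set \<Rightarrow> ('x \<Rightarrow> 'a set) \<Rightarrow> ('x \<times> 'a \<Rightarrow> 'x measure)
    \<Rightarrow> 'x measure \<Rightarrow> 'x set \<Rightarrow> bool" where
  "absorbing X A Ad Q \<nu> \<Delta> \<longleftrightarrow>
     (\<forall>x\<in>\<Delta>. \<forall>a\<in>A. measure (Q (x, a)) \<Delta> = 1) \<and>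
     (\<forall>\<pi>\<in>policies X A Ad.
        (\<integral>\<^sup>+ \<omega>. ennreal_of_enat (hitting_time \<Delta> \<omega>) \<partial>policy_law X A Q \<nu> \<pi>) < \<infinity>)"

definition occupation_measure ::
  "'x measure \<Rightarrow> 'a::polish_space set \<Rightarrow> ('x \<times> 'a \<Rightarrow> 'x measure) \<Rightarrow> 'x measure \<Rightarrow> 'x set
    \<Rightarrow> (nat \<Rightarrow> (nat \<Rightarrow> 'x \<times> 'a) \<times> 'x \<Rightarrow> 'a measure) \<Rightarrow> ('x \<times> 'a) measure" where
  "occupation_measure X A Q \<nu> \<Delta> \<pi> =
     measure_of (space (state_action X A)) (sets (state_action X A))
       (\<lambda>\<Gamma>. \<integral>\<^sup>+ \<omega>. (\<Sum>t. indicator {\<omega>. hitting_time \<Delta> \<omega> > enat t} \<omega> * indicator \<Gamma> (\<omega> t))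
              \<partial>policy_law X A Q \<nu> \<pi>)"

definition occupation_measures ::
  "'x measure \<Rightarrow> 'a::polish_space set \<Rightarrow> ('x \<Rightarrow> 'a set) \<Rightarrow> ('x \<times> 'a \<Rightarrow> 'x measure)
    \<Rightarrow> 'x measure \<Rightarrow> 'x set \<Rightarrow> ('x \<times> 'a) measure set" where
  "occupation_measures X A Ad Q \<nu> \<Delta> = occupation_measure X A Q \<nu> \<Delta> ` policies X A Ad"

definition characteristic_measures ::
  "'x measure \<Rightarrow> 'a::polish_space set \<Rightarrow> ('x \<Rightarrow> 'a set) \<Rightarrow> ('x \<times> 'a \<Rightarrow> 'x measure)
    \<Rightarrow> 'x measure \<Rightarrow> 'x set \<Rightarrow> ('x \<times> 'a) measure set" where
  "characteristic_measures X A Ad Q \<eta> \<Delta> =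
     {\<mu> \<in> finite_measures (state_action X A).
        emeasure \<mu> (space (state_action X A) - feasible_pairs X Ad) = 0 \<and>
        (\<forall>B\<in>sets X. emeasure (state_marginal X \<mu>) B =
           emeasure \<eta> (B \<inter> (space X - \<Delta>)) + (\<integral>\<^sup>+ z. emeasure (Q z) (B \<inter> (space X - \<Delta>)) \<partial>\<mu>))}"

definition weakly_measurable ::
  "'x measure \<Rightarrow> 'a::topological_space set \<Rightarrow> ('x \<Rightarrow> 'a set) \<Rightarrow> bool" where
  "weakly_measurable X A Ad \<longleftrightarrow>
     (\<forall>G. openin (top_of_set A) G \<longrightarrow> {x \<in> space X. Ad x \<inter> G \<noteq> {}} \<in> sets X)"

definition condition_S ::
  "'x measure \<Rightarrow> 'a::polish_space set \<Rightarrow> ('x \<Rightarrow> 'a set) \<Rightarrow> ('x \<times> 'a \<Rightarrow> 'x measure) \<Rightarrow> bool" where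
  "condition_S X A Ad Q \<longleftrightarrow>
     compact A \<and> weakly_measurable X A Ad \<and> (\<forall>x\<in>space X. Ad x \<noteq> {} \<and> compact (Ad x)) \<and>
     (\<forall>x\<in>space X. \<forall>\<Gamma>\<in>sets X. continuous_on (Ad x) (\<lambda>a. measure (Q (x, a)) \<Gamma>))"

definition controlled_kernel ::
  "('x \<times> 'a \<Rightarrow> 'x measure) \<Rightarrow> ('x \<Rightarrow> 'a measure) \<Rightarrow> 'x \<Rightarrow> 'x measure" where
  "controlled_kernel Q \<sigma> x = \<sigma> x \<bind> (\<lambda>a. Q (x, a))"

primrec controlled_kernel_pow ::
  "'x measure \<Rightarrow> ('x \<times> 'a \<Rightarrow> 'x measure) \<Rightarrow> ('x \<Rightarrow> 'a measure) \<Rightarrow> nat \<Rightarrow> 'x \<Rightarrow> 'x measure" where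
  "controlled_kernel_pow X Q \<sigma> 0 x = return X x"
| "controlled_kernel_pow X Q \<sigma> (Suc k) x = controlled_kernel_pow X Q \<sigma> k x \<bind> controlled_kernel Q \<sigma>"

text \<open>
  Each \<open>Q(\<cdot>|x,a)\<close>, \<open>(x, a)\<close> feasible, is absolutely continuous with respect to \<open>Q\<^sub>\<xi>(\<cdot>|x)\<close>;
  \<^const>\<open>absolutely_continuous\<close> takes the dominating measure as its first argument.
\<close>

definition dominating_kernel ::
  "'x measure \<Rightarrow> ('x \<Rightarrow> 'a set) \<Rightarrow> ('x \<times> 'a \<Rightarrow> 'x measure) \<Rightarrow> ('x \<Rightarrow> 'a measure) \<Rightarrow> bool" where
  "dominating_kernel X Ad Q \<xi> \<longleftrightarrow>
     (\<forall>(x, a)\<in>feasible_pairs X Ad. absolutely_continuous (controlled_kernel Q \<xi> x) (Q (x, a)))"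

definition reference_measure ::
  "'x measure \<Rightarrow> ('x \<times> 'a \<Rightarrow> 'x measure) \<Rightarrow> 'x measure \<Rightarrow> ('x \<Rightarrow> 'a measure) \<Rightarrow> real
    \<Rightarrow> 'x measure" where
  "reference_measure X Q \<eta> \<xi> \<beta> =
     measure_of (space X) (sets X)
       (\<lambda>B. ennreal (1 - \<beta>) *
          (\<Sum>k. ennreal (\<beta> ^ k) * emeasure (\<eta> \<bind> controlled_kernel_pow X Q \<xi> k) B))"

end

theory Submission
  imports Defs
begin

text \<open>
  An occupation measure is a solution of the characteristic equations, but these equations may have
  further solutions: to the occupation measure of a policy one can add a finite measure that is
  invariant under the dynamics outside \<open>\<Delta>\<close>. Absorption rules out such an invariant
  part as far as it lives on states that can be reached from \<open>\<eta>\<close>, and domination by the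
  reference measure says exactly that no other states are charged.
  
  \<^item> If \<open>\<mu>\<close> is the occupation measure of \<open>\<pi>\<close>, then \<open>\<mu>\<close> is the sum over \<open>t\<close>
    of the laws of \<open>(X\<^sub>t, A\<^sub>t)\<close> restricted to \<open>X\<^sub>t \<notin> \<Delta>\<close>, because \<open>\<Delta>\<close> is almost surely never left.
    Finiteness is finiteness of the expected hitting time, and shifting the time index by one
    yields the characteristic equation (\<open>occupation_measure_characteristic\<close>). Since every
    \<open>Q(\<cdot>|x,a)\<close> is dominated by \<open>Q\<^sub>\<xi>(\<cdot>|x)\<close>, a set that is null for all \<open>\<eta> Q\<^sub>\<xi>\<^sup>k\<close> is null for
    the law of each \<open>X\<^sub>t\<close>, by induction on \<open>t\<close> (\<open>state_law_null\<close>); so the marginal is dominated.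
  
  \<^item> Conversely let \<open>\<mu>\<close> solve the equations, with state marginal \<open>m\<close> dominated by the reference measure.
    Disintegrate \<open>\<mu>(dx,da) = m(dx) \<sigma>(da|x)\<close> (\<open>polish_disintegration\<close>, \<open>feasible_disintegration\<close>)
    and let \<open>R\<close> be the transition operator of \<open>\<sigma>\<close> killed on \<open>\<Delta>\<close>. Iterating
    \<open>m = \<eta> 1\<^bsub>\<Delta>\<^sup>c\<^esub> + m R\<close> gives \<open>m = \<Sum>\<^bsub>t<n\<^esub> (\<eta> 1\<^bsub>\<Delta>\<^sup>c\<^esub>) R\<^sup>t + m R\<^sup>n\<close>. The sum tends to the marginal
    of the occupation measure of the stationary policy \<open>\<sigma>\<close>. The remainder has mass
    \<open>\<integral> R\<^sup>n 1 dm\<close>, which decreases to the integral of the probability \<open>\<lim> R\<^sup>n 1(x)\<close> of never being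
    absorbed from \<open>x\<close> under \<open>\<sigma>\<close>. This probability vanishes almost everywhere for every
    \<open>\<eta> Q\<^sub>\<xi>\<^sup>k\<close>: the policy that uses \<open>\<xi>\<close> for \<open>k\<close> steps and \<open>\<sigma>\<close> afterwards has a finite expected
    hitting time (\<open>survival_null\<close>). By domination it vanishes \<open>m\<close>-almost everywhere, hence
    \<open>\<mu>\<close> is the occupation measure of \<open>\<sigma>\<close> (\<open>characteristic_is_occupation\<close>).
  
  Two foundations carry this argument. The law of a policy is defined as the unique measure with
  prescribed conditional probabilities, so its existence (Ionescu-Tulcea) and uniqueness have to be
  shown (\<open>policy_law_exists\<close>, \<open>policy_law_unique\<close>). And a finite measure on a product whose second
  factor is a Borel subset of a Polish space has a regular conditional distribution; this is reduced
  to real second coordinates by a Borel retraction from \<open>\<real>\<close>, where conditional distribution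
  functions are available.
\<close>

section \<open>Kernels and conditional laws\<close>

text \<open>
  The measure \<open>M(dx) \<kappa>(x, dy)\<close>. The argument \<open>M\<close> is a measure and not only a measurable space, so the
  product \<open>\<sigma>\<close>-algebra is formed from the spaces underlying \<open>M\<close> and \<open>N\<close>.
\<close>

definition kernel_joint :: "'a measure \<Rightarrow> 'b measure \<Rightarrow> ('a \<Rightarrow> 'b measure) \<Rightarrow> ('a \<times> 'b) measure" where
  "kernel_joint M N \<kappa> = M \<bind> (\<lambda>x. distr (\<kappa> x) (M \<Otimes>\<^sub>M N) (Pair x))"

lemma kernel_joint_measurable:
  assumes "\<kappa> \<in> M \<rightarrow>\<^sub>M prob_algebra N"
  shows "(\<lambda>x. distr (\<kappa> x) (M \<Otimes>\<^sub>M N) (Pair x)) \<in> M \<rightarrow>\<^sub>M subprob_algebra (M \<Otimes>\<^sub>M N)"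
  by (rule measurable_distr2[OF _ measurable_prob_algebraD[OF assms]]) simp

lemma sets_kernel_joint:
  assumes "\<kappa> \<in> M \<rightarrow>\<^sub>M prob_algebra N" "space M \<noteq> {}"
  shows "sets (kernel_joint M N \<kappa>) = sets (M \<Otimes>\<^sub>M N)"
  unfolding kernel_joint_def by (rule sets_bind) (use assms in auto)

lemma sets_kernel_prob:
  assumes "\<kappa> \<in> M \<rightarrow>\<^sub>M prob_algebra N" "x \<in> space M"
  shows "sets (\<kappa> x) = sets N" "space (\<kappa> x) = space N" "prob_space (\<kappa> x)"
proof -
  have "\<kappa> x \<in> space (prob_algebra N)" using assms by (rule measurable_space)
  then show "sets (\<kappa> x) = sets N" "prob_space (\<kappa> x)" by (auto simp: space_prob_algebra)
  then show "space (\<kappa> x) = space N" by (metis sets_eq_imp_space_eq)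
qed

lemma nn_integral_kernel_joint:
  assumes \<kappa>: "\<kappa> \<in> M \<rightarrow>\<^sub>M prob_algebra N" and f: "f \<in> borel_measurable (M \<Otimes>\<^sub>M N)"
  shows "(\<integral>\<^sup>+z. f z \<partial>kernel_joint M N \<kappa>) = (\<integral>\<^sup>+x. \<integral>\<^sup>+y. f (x, y) \<partial>\<kappa> x \<partial>M)"
  unfolding kernel_joint_def
  apply (subst nn_integral_bind[OF f kernel_joint_measurable[OF \<kappa>]])
  apply (rule nn_integral_cong)
  apply (subst nn_integral_distr)
  using f sets_kernel_prob[OF \<kappa>] by (auto cong: measurable_cong_sets)

lemma emeasure_kernel_joint:
  assumes \<kappa>: "\<kappa> \<in> M \<rightarrow>\<^sub>M prob_algebra N" and G[measurable]: "\<Gamma> \<in> sets (M \<Otimes>\<^sub>M N)" and "space M \<noteq> {}"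
  shows "emeasure (kernel_joint M N \<kappa>) \<Gamma> = (\<integral>\<^sup>+x. emeasure (\<kappa> x) (Pair x -` \<Gamma>) \<partial>M)"
  unfolding kernel_joint_def
  apply (subst emeasure_bind[OF \<open>space M \<noteq> {}\<close> kernel_joint_measurable[OF \<kappa>] G])
  apply (rule nn_integral_cong)
  apply (subst emeasure_distr)
  using sets_kernel_prob[OF \<kappa>] sets.sets_into_space[OF G]
  by (auto cong: measurable_cong_sets simp: space_pair_measure intro!: arg_cong[where f="emeasure _"])

text \<open>
  \<open>\<kappa>\<close> is a version of the conditional distribution of \<open>Z\<close> given \<open>Y\<close>. Testing on rectangles avoids
  both conditional expectations and null sets, and it makes sense for an arbitrary finite measure \<open>P\<close>.
  In this form a disintegration of a measure on a product is the special case of the two projections.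
\<close>

definition has_cond_law ::
  "'w measure \<Rightarrow> 'y measure \<Rightarrow> 'z measure \<Rightarrow> ('w \<Rightarrow> 'y) \<Rightarrow> ('w \<Rightarrow> 'z) \<Rightarrow> ('y \<Rightarrow> 'z measure) \<Rightarrow> bool" where
  "has_cond_law P N M Y Z \<kappa> \<longleftrightarrow> (\<forall>D\<in>sets N. \<forall>C\<in>sets M.
     emeasure P {\<omega> \<in> space P. Y \<omega> \<in> D \<and> Z \<omega> \<in> C}
     = (\<integral>\<^sup>+\<omega>. indicator D (Y \<omega>) * emeasure (\<kappa> (Y \<omega>)) C \<partial>P))"

text \<open>
  Every set of the \<open>\<sigma>\<close>-algebra generated by \<open>Y\<close> is a preimage under \<open>Y\<close>, so the defining integral
  identity of the conditional expectation is the rectangle identity, set by set.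
\<close>

lemma has_cond_law_iff_real_cond_exp:
  assumes P: "prob_space P" and Y[measurable]: "Y \<in> P \<rightarrow>\<^sub>M N" and Z[measurable]: "Z \<in> P \<rightarrow>\<^sub>M M"
    and \<kappa>: "\<kappa> \<in> N \<rightarrow>\<^sub>M prob_algebra M"
  shows "has_cond_law P N M Y Z \<kappa> \<longleftrightarrow>
    (\<forall>C\<in>sets M. AE \<omega> in P. real_cond_exp P (vimage_algebra (space P) Y N) (\<lambda>\<omega>. indicator C (Z \<omega>)) \<omega>
       = measure (\<kappa> (Y \<omega>)) C)"
proof -
  interpret P: prob_space P by fact
  let ?F = "vimage_algebra (space P) Y N"
  have YS: "Y \<in> space P \<rightarrow> space N" using measurable_space[OF Y] by auto
  have sub: "subalgebra P ?F"
    unfolding subalgebra_def sets_vimage_algebra2[OF YS] using measurable_sets[OF Y] by auto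
  interpret finite_measure_subalgebra P ?F by standard (rule sub)
  have \<kappa>'[measurable]: "\<kappa> \<in> N \<rightarrow>\<^sub>M subprob_algebra M" using \<kappa> by (rule measurable_prob_algebraD)
  have YF: "Y \<in> ?F \<rightarrow>\<^sub>M N" using YS by (rule measurable_vimage_algebra1)
  have [simp]: "emeasure (\<kappa> (Y \<omega>)) C = ennreal (measure (\<kappa> (Y \<omega>)) C)" if "\<omega> \<in> space P" for \<omega> C
    using sets_kernel_prob(3)[OF \<kappa>, of "Y \<omega>"] YS that
    by (simp add: finite_measure.emeasure_eq_measure prob_space.finite_measure funcset_mem)
  have m1: "(\<lambda>\<omega>. measure (\<kappa> (Y \<omega>)) C) \<in> borel_measurable ?F" if [measurable]: "C \<in> sets M" for C
    by (rule measurable_compose[OF YF]) measurable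
  have b: "measure (\<kappa> (Y \<omega>)) C \<le> 1" if "\<omega> \<in> space P" for \<omega> C
    using prob_space.prob_le_1[OF sets_kernel_prob(3)[OF \<kappa>, of "Y \<omega>"]] YS that by auto
  have i1: "integrable P (\<lambda>\<omega>. measure (\<kappa> (Y \<omega>)) C)" if [measurable]: "C \<in> sets M" for C
    by (rule P.integrable_const_bound[of _ 1]) (auto simp: b)
  have i2: "integrable P (\<lambda>\<omega>. indicator C (Z \<omega>) :: real)" if [measurable]: "C \<in> sets M" for C
    by (rule P.integrable_const_bound[of _ 1]) (auto simp: indicator_def)
  have L: "emeasure P {\<omega> \<in> space P. Y \<omega> \<in> D \<and> Z \<omega> \<in> C} =
      ennreal (\<integral>\<omega>\<in>Y -` D \<inter> space P. indicator C (Z \<omega>) \<partial>P)"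
    if [measurable]: "D \<in> sets N" "C \<in> sets M" for D C
  proof -
    have "(\<integral>\<omega>\<in>Y -` D \<inter> space P. indicator C (Z \<omega>) \<partial>P) = (\<integral>\<omega>. indicat_real {\<omega> \<in> space P. Y \<omega> \<in> D \<and> Z \<omega> \<in> C} \<omega> \<partial>P)"
      unfolding set_lebesgue_integral_def
      by (rule Bochner_Integration.integral_cong) (auto simp: indicator_def)
    then show ?thesis by (simp add: P.emeasure_eq_measure)
  qed
  have R: "(\<integral>\<^sup>+\<omega>. indicator D (Y \<omega>) * emeasure (\<kappa> (Y \<omega>)) C \<partial>P) =
      ennreal (\<integral>\<omega>\<in>Y -` D \<inter> space P. measure (\<kappa> (Y \<omega>)) C \<partial>P)"
    if [measurable]: "D \<in> sets N" "C \<in> sets M" for D C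
  proof -
    have "integrable P (\<lambda>\<omega>. indicator D (Y \<omega>) *\<^sub>R measure (\<kappa> (Y \<omega>)) C)"
      by (rule P.integrable_const_bound[of _ 1]) (auto simp: b indicator_def)
    then have "(\<integral>\<^sup>+\<omega>. ennreal (indicator D (Y \<omega>) *\<^sub>R measure (\<kappa> (Y \<omega>)) C) \<partial>P) =
      ennreal (\<integral>\<omega>. indicator D (Y \<omega>) *\<^sub>R measure (\<kappa> (Y \<omega>)) C \<partial>P)"
      by (rule nn_integral_eq_integral) (auto)
    also have "(\<integral>\<omega>. indicator D (Y \<omega>) *\<^sub>R measure (\<kappa> (Y \<omega>)) C \<partial>P) = (\<integral>\<omega>\<in>Y -` D \<inter> space P. measure (\<kappa> (Y \<omega>)) C \<partial>P)"
      unfolding set_lebesgue_integral_def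
      by (rule Bochner_Integration.integral_cong) (auto simp: indicator_def)
    also have "(\<integral>\<^sup>+\<omega>. ennreal (indicator D (Y \<omega>) *\<^sub>R measure (\<kappa> (Y \<omega>)) C) \<partial>P) = (\<integral>\<^sup>+\<omega>. indicator D (Y \<omega>) * emeasure (\<kappa> (Y \<omega>)) C \<partial>P)"
      by (rule nn_integral_cong) (auto simp: indicator_def)
    finally show ?thesis .
  qed
  show ?thesis
  proof
    assume h: "has_cond_law P N M Y Z \<kappa>"
    show "\<forall>C\<in>sets M. AE \<omega> in P. real_cond_exp P ?F (\<lambda>\<omega>. indicator C (Z \<omega>)) \<omega> = measure (\<kappa> (Y \<omega>)) C"
    proof
      fix C assume C[measurable]: "C \<in> sets M"
      show "AE \<omega> in P. real_cond_exp P ?F (\<lambda>\<omega>. indicator C (Z \<omega>)) \<omega> = measure (\<kappa> (Y \<omega>)) C"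
      proof (rule real_cond_exp_charact)
        fix B assume "B \<in> sets ?F"
        then obtain D where D[measurable]: "D \<in> sets N" and B: "B = Y -` D \<inter> space P"
          unfolding sets_vimage_algebra2[OF YS] by auto
        have "ennreal (\<integral>\<omega>\<in>B. indicator C (Z \<omega>) \<partial>P) = ennreal (\<integral>\<omega>\<in>B. measure (\<kappa> (Y \<omega>)) C \<partial>P)"
          using h D C unfolding has_cond_law_def B by (simp add: L R)
        then show "(\<integral>\<omega>\<in>B. indicator C (Z \<omega>) \<partial>P) = (\<integral>\<omega>\<in>B. measure (\<kappa> (Y \<omega>)) C \<partial>P)"
          by (subst (asm) ennreal_inj) (auto simp: set_lebesgue_integral_def intro!: Bochner_Integration.integral_nonneg)
      qed (use i1 i2 m1 C in auto)
    qed
  next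
    assume h: "\<forall>C\<in>sets M. AE \<omega> in P. real_cond_exp P ?F (\<lambda>\<omega>. indicator C (Z \<omega>)) \<omega> = measure (\<kappa> (Y \<omega>)) C"
    show "has_cond_law P N M Y Z \<kappa>"
      unfolding has_cond_law_def
    proof (intro ballI)
      fix D C assume D[measurable]: "D \<in> sets N" and C[measurable]: "C \<in> sets M"
      have B: "Y -` D \<inter> space P \<in> sets ?F" using D unfolding sets_vimage_algebra2[OF YS] by auto
      have "(\<integral>\<omega>\<in>Y -` D \<inter> space P. indicator C (Z \<omega>) \<partial>P) =
          (\<integral>\<omega>\<in>Y -` D \<inter> space P. real_cond_exp P ?F (\<lambda>\<omega>. indicator C (Z \<omega>)) \<omega> \<partial>P)"
        by (rule real_cond_exp_intA[OF i2[OF C] B])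
      also have "\<dots> = (\<integral>\<omega>\<in>Y -` D \<inter> space P. measure (\<kappa> (Y \<omega>)) C \<partial>P)"
        unfolding set_lebesgue_integral_def
        by (rule integral_cong_AE) (use h C in \<open>auto intro: borel_measurable_cond_exp2\<close>)
      finally show "emeasure P {\<omega> \<in> space P. Y \<omega> \<in> D \<and> Z \<omega> \<in> C} =
         (\<integral>\<^sup>+\<omega>. indicator D (Y \<omega>) * emeasure (\<kappa> (Y \<omega>)) C \<partial>P)"
        by (simp add: L[OF D C] R[OF D C])
    qed
  qed
qed

text \<open>
  Rectangles form an intersection-stable generator, so a conditional law and the law of \<open>Y\<close> determine
  the joint law. This is what makes the uniqueness proof for policy laws an induction over time.
\<close>

lemma has_cond_law_distr:
  assumes P: "finite_measure P" and ne0: "space P \<noteq> {}" and Y[measurable]: "Y \<in> P \<rightarrow>\<^sub>M N" and Z[measurable]: "Z \<in> P \<rightarrow>\<^sub>M M"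
    and \<kappa>: "\<kappa> \<in> N \<rightarrow>\<^sub>M prob_algebra M" and h: "has_cond_law P N M Y Z \<kappa>"
  shows "distr P (N \<Otimes>\<^sub>M M) (\<lambda>\<omega>. (Y \<omega>, Z \<omega>)) = kernel_joint (distr P N Y) M \<kappa>"
proof -
  interpret P: finite_measure P by fact
  have \<kappa>'[measurable]: "\<kappa> \<in> N \<rightarrow>\<^sub>M subprob_algebra M" using \<kappa> by (rule measurable_prob_algebraD)
  have \<kappa>2: "\<kappa> \<in> distr P N Y \<rightarrow>\<^sub>M prob_algebra M" using \<kappa> by simp
  have ne: "space (distr P N Y) \<noteq> {}" using measurable_space[OF Y] ne0 by auto
  have s: "sets (kernel_joint (distr P N Y) M \<kappa>) = sets (N \<Otimes>\<^sub>M M)"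
    unfolding sets_kernel_joint[OF \<kappa>2 ne] by (rule sets_pair_measure_cong) auto
  show ?thesis
  proof (rule measure_eqI_generator_eq[OF Int_stable_pair_measure_generator[of N M] pair_measure_closed])
    show "sets (distr P (N \<Otimes>\<^sub>M M) (\<lambda>\<omega>. (Y \<omega>, Z \<omega>))) = sigma_sets (space N \<times> space M) {a \<times> b |a b. a \<in> sets N \<and> b \<in> sets M}"
      "sets (kernel_joint (distr P N Y) M \<kappa>) = sigma_sets (space N \<times> space M) {a \<times> b |a b. a \<in> sets N \<and> b \<in> sets M}"
      by (simp_all add: s sets_pair_measure)
    show "range (\<lambda>i::nat. space N \<times> space M) \<subseteq> {a \<times> b |a b. a \<in> sets N \<and> b \<in> sets M}" by auto
    show "(\<Union>i::nat. space N \<times> space M) = space N \<times> space M" by simp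
    show "emeasure (distr P (N \<Otimes>\<^sub>M M) (\<lambda>\<omega>. (Y \<omega>, Z \<omega>))) (space N \<times> space M) \<noteq> \<infinity>"
      by (subst emeasure_distr) auto
    fix E assume "E \<in> {a \<times> b |a b. a \<in> sets N \<and> b \<in> sets M}"
    then obtain D C where E: "E = D \<times> C" and [measurable]: "D \<in> sets N" "C \<in> sets M" by auto
    have "emeasure (distr P (N \<Otimes>\<^sub>M M) (\<lambda>\<omega>. (Y \<omega>, Z \<omega>))) E = emeasure P {\<omega> \<in> space P. Y \<omega> \<in> D \<and> Z \<omega> \<in> C}"
      unfolding E by (subst emeasure_distr) (auto intro!: arg_cong[where f="emeasure _"])
    also have "\<dots> = (\<integral>\<^sup>+y. indicator D y * emeasure (\<kappa> y) C \<partial>distr P N Y)"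
      using h unfolding has_cond_law_def by (subst nn_integral_distr) (auto)
    also have "\<dots> = (\<integral>\<^sup>+y. emeasure (\<kappa> y) (Pair y -` E) \<partial>distr P N Y)"
      unfolding E by (rule nn_integral_cong) (auto simp: indicator_def vimage_def)
    also have "\<dots> = emeasure (kernel_joint (distr P N Y) M \<kappa>) E"
      unfolding E by (rule emeasure_kernel_joint[symmetric, OF \<kappa>2 _ ne]) simp
    finally show "emeasure (distr P (N \<Otimes>\<^sub>M M) (\<lambda>\<omega>. (Y \<omega>, Z \<omega>))) E = emeasure (kernel_joint (distr P N Y) M \<kappa>) E" .
  qed
qed

lemma nn_integral_cond_law:
  assumes P: "finite_measure P" and ne0: "space P \<noteq> {}" and Y[measurable]: "Y \<in> P \<rightarrow>\<^sub>M N" and Z[measurable]: "Z \<in> P \<rightarrow>\<^sub>M M"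
    and \<kappa>: "\<kappa> \<in> N \<rightarrow>\<^sub>M prob_algebra M" and h: "has_cond_law P N M Y Z \<kappa>"
    and g[measurable]: "g \<in> borel_measurable (N \<Otimes>\<^sub>M M)"
  shows "(\<integral>\<^sup>+\<omega>. g (Y \<omega>, Z \<omega>) \<partial>P) = (\<integral>\<^sup>+\<omega>. \<integral>\<^sup>+z. g (Y \<omega>, z) \<partial>\<kappa> (Y \<omega>) \<partial>P)"
proof -
  have [measurable]: "\<kappa> \<in> N \<rightarrow>\<^sub>M subprob_algebra M" using \<kappa> by (rule measurable_prob_algebraD)
  have [measurable]: "(\<lambda>y. \<integral>\<^sup>+z. g (y, z) \<partial>\<kappa> y) \<in> borel_measurable N"
    by (rule nn_integral_measurable_subprob_algebra2[where N=M]) measurable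
  have "(\<integral>\<^sup>+\<omega>. g (Y \<omega>, Z \<omega>) \<partial>P) = (\<integral>\<^sup>+v. g v \<partial>distr P (N \<Otimes>\<^sub>M M) (\<lambda>\<omega>. (Y \<omega>, Z \<omega>)))"
    by (subst nn_integral_distr) auto
  also have "\<dots> = (\<integral>\<^sup>+y. \<integral>\<^sup>+z. g (y, z) \<partial>\<kappa> y \<partial>distr P N Y)"
    unfolding has_cond_law_distr[OF P ne0 Y Z \<kappa> h]
    by (rule nn_integral_kernel_joint) (use \<kappa> in \<open>auto cong: measurable_cong_sets sets_pair_measure_cong\<close>)
  also have "\<dots> = (\<integral>\<^sup>+\<omega>. \<integral>\<^sup>+z. g (Y \<omega>, z) \<partial>\<kappa> (Y \<omega>) \<partial>P)"
    by (subst nn_integral_distr) auto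
  finally show ?thesis .
qed

section \<open>Existence and uniqueness of the law of a policy\<close>

lemma (in Ionescu_Tulcea) distr_lim_initial:
  "distr PF.lim (PiM {0..<n} M) (\<lambda>\<omega>. restrict \<omega> {0..<n}) = C 0 n (\<lambda>_. undefined)"
proof (rule measure_eqI)
  show "sets (distr PF.lim (PiM {0..<n} M) (\<lambda>\<omega>. restrict \<omega> {0..<n})) = sets (C 0 n (\<lambda>_. undefined))"
    by (simp add: sets_C)
  fix E assume "E \<in> sets (distr PF.lim (PiM {0..<n} M) (\<lambda>\<omega>. restrict \<omega> {0..<n}))"
  then have E: "E \<in> sets (PiM {0..<n} M)" by simp
  have "emeasure (distr PF.lim (PiM {0..<n} M) (\<lambda>\<omega>. restrict \<omega> {0..<n})) E = emeasure (CI {0..<n}) E"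
    by (subst distr_lim) auto
  also have "\<dots> = emeasure (C 0 n (\<lambda>_. undefined)) (PF.emb {0..<n} {0..<n} E)"
    by (rule emeasure_CI[OF _ E]) simp
  also have "PF.emb {0..<n} {0..<n} E = E"
    by (rule prod_emb_id) (use sets.sets_into_space[OF E] in \<open>auto simp: space_PiM\<close>)
  finally show "emeasure (distr PF.lim (PiM {0..<n} M) (\<lambda>\<omega>. restrict \<omega> {0..<n})) E = emeasure (C 0 n (\<lambda>_. undefined)) E" .
qed

text \<open>
  The law of the first \<open>n + 1\<close> coordinates under the limit measure is obtained from that of the first \<open>n\<close> by
  one application of \<open>P n\<close>; so the given kernels are the conditional laws of the coordinates.
\<close>

lemma (in Ionescu_Tulcea) has_cond_law_lim:
  "has_cond_law PF.lim (PiM {0..<n} M) (M n) (\<lambda>\<omega>. restrict \<omega> {0..<n}) (\<lambda>\<omega>. \<omega> n) (P n)"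
  unfolding has_cond_law_def
proof (intro ballI)
  fix D B assume [measurable]: "D \<in> sets (PiM {0..<n} M)" "B \<in> sets (M n)"
  let ?u = "\<lambda>_::nat. undefined::'a"
  have [measurable_cong]: "sets PF.lim = sets (PiM UNIV M)" by (rule PF.sets_lim)
  have sp: "space PF.lim = space (PiM UNIV M)" by (rule sets_eq_imp_space_eq) (rule PF.sets_lim)
  have u: "?u \<in> space (PiM {0..<0} M)" by simp
  have [measurable_cong]: "sets (C 0 n ?u) = sets (PiM {0..<n} M)" for n by (simp add: sets_C)
  have [measurable]: "(\<lambda>r. restrict r {0..<n}) \<in> PiM {0..<Suc n} M \<rightarrow>\<^sub>M PiM {0..<n} M"
    by (rule measurable_restrict_subset) auto
  have [measurable]: "(\<lambda>r. r n) \<in> PiM {0..<Suc n} M \<rightarrow>\<^sub>M M n" by measurable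
  let ?S = "{r \<in> space (PiM {0..<Suc n} M). restrict r {0..<n} \<in> D \<and> r n \<in> B}"
  have S[measurable]: "?S \<in> sets (PiM {0..<Suc n} M)" by measurable
  have "emeasure PF.lim {\<omega> \<in> space PF.lim. restrict \<omega> {0..<n} \<in> D \<and> \<omega> n \<in> B}
      = emeasure (distr PF.lim (PiM {0..<Suc n} M) (\<lambda>\<omega>. restrict \<omega> {0..<Suc n})) ?S"
    by (subst emeasure_distr)
      (auto simp: sp space_PiM restrict_restrict Int_absorb2 Int_absorb1 intro!: arg_cong[where f="emeasure _"] dest: PiE_mem)
  also have "\<dots> = emeasure (C 0 (Suc n) ?u) ?S"
    unfolding distr_lim_initial ..
  also have "\<dots> = (\<integral>\<^sup>+r. emeasure (eP n r) ?S \<partial>C 0 n ?u)"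
    using u S measurable_eP[of n] unfolding C.simps
    by (subst emeasure_bind[where N="PiM {0..<Suc n} M"])
       (auto simp: space_C prob_space.not_empty prob_space_C cong: measurable_cong_sets)
  also have "\<dots> = (\<integral>\<^sup>+r. indicator D r * emeasure (P n r) B \<partial>C 0 n ?u)"
  proof (rule nn_integral_cong)
    fix r assume "r \<in> space (C 0 n ?u)"
    then have r: "r \<in> space (PiM {0..<n} M)" using space_C[OF u, of n] by simp
    have r': "restrict (r(n := x)) {0..<n} = r" for x
      using r by (auto simp: space_PiM fun_eq_iff PiE_def extensional_def)
    have "(\<lambda>x. r(n := x)) -` ?S \<inter> space (M n) = (if r \<in> D then B else {})"
      using r sets.sets_into_space[OF \<open>B \<in> sets (M n)\<close>]
      by (auto simp: r' simp del: fun_upd_apply simp: fun_upd_same)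
         (auto simp: space_PiM PiE_def extensional_def Pi_iff)
    then show "emeasure (eP n r) ?S = indicator D r * emeasure (P n r) B"
      by (subst emeasure_eP[OF r S]) auto
  qed
  also have "\<dots> = (\<integral>\<^sup>+\<omega>. indicator D (restrict \<omega> {0..<n}) * emeasure (P n (restrict \<omega> {0..<n})) B \<partial>PF.lim)"
    unfolding distr_lim_initial[symmetric] by (subst nn_integral_distr) auto
  finally show "emeasure PF.lim {\<omega> \<in> space PF.lim. restrict \<omega> {0..<n} \<in> D \<and> \<omega> n \<in> B} =
     (\<integral>\<^sup>+\<omega>. indicator D (restrict \<omega> {0..<n}) * emeasure (P n (restrict \<omega> {0..<n})) B \<partial>PF.lim)" .
qed

lemma measurable_history: "history n \<in> trajectories X A \<rightarrow>\<^sub>M histories X A n"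
proof -
  have "(\<lambda>\<omega>. fst (\<omega> n)) \<in> trajectories X A \<rightarrow>\<^sub>M X"
    unfolding trajectories_def by measurable
  then show ?thesis
    unfolding history_def trajectories_def histories_def
    by (intro measurable_Pair measurable_restrict_subset) auto
qed

lemma measurable_traj_component: "(\<lambda>\<omega>. \<omega> n) \<in> trajectories X A \<rightarrow>\<^sub>M state_action X A"
  unfolding trajectories_def by measurable

context control_model
begin

abbreviation "SA \<equiv> state_action X A"
abbreviation "AS \<equiv> action_space A"

lemma Q_measurable[measurable]: "Q \<in> SA \<rightarrow>\<^sub>M prob_algebra X"
  by (rule transition_kernel)

lemma policyD: "\<pi> \<in> policies X A Ad \<Longrightarrow> \<pi> n \<in> histories X A n \<rightarrow>\<^sub>M prob_algebra AS"
  by (auto simp: policies_def)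

text \<open>
  The kernel \<open>Q\<close> as a kernel on the full history including the current action, which is the
  conditioning variable in the definition of a policy law.
\<close>

definition Qstep :: "((nat \<Rightarrow> 'x \<times> 'a) \<times> 'x) \<times> 'a \<Rightarrow> 'x measure" where
  "Qstep y = Q (snd (fst y), snd y)"

lemma Qstep_measurable: "Qstep \<in> histories X A n \<Otimes>\<^sub>M AS \<rightarrow>\<^sub>M prob_algebra X"
  unfolding Qstep_def histories_def by measurable

lemma is_policy_law_iff:
  assumes \<pi>: "\<pi> \<in> policies X A Ad"
  shows "is_policy_law X A Q \<nu> \<pi> P \<longleftrightarrow>
    P \<in> prob_measures (trajectories X A) \<and> distr P X (\<lambda>\<omega>. fst (\<omega> 0)) = \<nu> \<and>
    (\<forall>n. has_cond_law P (histories X A n) AS (history n) (\<lambda>\<omega>. snd (\<omega> n)) (\<pi> n)) \<and>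
    (\<forall>n. has_cond_law P (histories X A n \<Otimes>\<^sub>M AS) X (\<lambda>\<omega>. (history n \<omega>, snd (\<omega> n))) (\<lambda>\<omega>. fst (\<omega> (Suc n))) Qstep)"
proof (cases "P \<in> prob_measures (trajectories X A)")
  case True
  then have P: "prob_space P" and [measurable_cong]: "sets P = sets (trajectories X A)"
    by (auto simp: prob_measures_def)
  note [measurable] = measurable_history measurable_traj_component
  have "has_cond_law P (histories X A n) AS (history n) (\<lambda>\<omega>. snd (\<omega> n)) (\<pi> n) \<longleftrightarrow>
     (\<forall>C\<in>sets AS. AE \<omega> in P.
        real_cond_exp P (vimage_algebra (space P) (history n) (histories X A n))
          (\<lambda>\<omega>. indicator C (snd (\<omega> n))) \<omega>
        = measure (\<pi> n (history n \<omega>)) C)" for n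
    by (rule has_cond_law_iff_real_cond_exp[OF P _ _ policyD[OF \<pi>]]) measurable
  moreover
  have "has_cond_law P (histories X A n \<Otimes>\<^sub>M AS) X (\<lambda>\<omega>. (history n \<omega>, snd (\<omega> n))) (\<lambda>\<omega>. fst (\<omega> (Suc n))) Qstep \<longleftrightarrow>
    (\<forall>B\<in>sets X. AE \<omega> in P.
        real_cond_exp P
          (vimage_algebra (space P) (\<lambda>\<omega>. (history n \<omega>, snd (\<omega> n)))
             (histories X A n \<Otimes>\<^sub>M action_space A))
          (\<lambda>\<omega>. indicator B (fst (\<omega> (Suc n)))) \<omega>
        = measure (Qstep (history n \<omega>, snd (\<omega> n))) B)" for n
    by (rule has_cond_law_iff_real_cond_exp[OF P _ _ Qstep_measurable]) measurable
  moreover have "Qstep (history n \<omega>, snd (\<omega> n)) = Q (\<omega> n)" for n \<omega>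
    by (simp add: Qstep_def history_def)
  ultimately show ?thesis unfolding is_policy_law_def by simp
qed (simp add: is_policy_law_def)

text \<open>
  The law of \<open>(h\<^sub>n, a\<^sub>n)\<close> is the law of \<open>h\<^sub>n\<close> extended by \<open>\<pi>\<^sub>n\<close>, and the law of \<open>h\<^bsub>n+1\<^esub>\<close> is an image of the law of
  \<open>(h\<^sub>n, a\<^sub>n)\<close> extended by \<open>Q\<close>. Hence all history laws are determined, and they determine the measure
  of every finite-dimensional cylinder.
\<close>

lemma policy_law_unique:
  assumes \<pi>: "\<pi> \<in> policies X A Ad"
    and 1: "is_policy_law X A Q \<nu> \<pi> P1" and 2: "is_policy_law X A Q \<nu> \<pi> P2"
  shows "P1 = P2"
proof -
  note [measurable] = measurable_history measurable_traj_component
  let ?H = "\<lambda>n. histories X A n"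
  let ?K = "\<lambda>n. histories X A n \<Otimes>\<^sub>M AS"
  let ?Y = "\<lambda>n \<omega>. (history n \<omega>, snd (\<omega> n)) :: ((nat \<Rightarrow> 'x \<times> 'a) \<times> 'x) \<times> 'a"
  have l1: "distr P (?K n) (?Y n) = kernel_joint (distr P (?H n) (history n)) AS (\<pi> n)"
    if "is_policy_law X A Q \<nu> \<pi> P" for P n
  proof -
    have P: "prob_space P" and [measurable_cong]: "sets P = sets (trajectories X A)"
      using that by (auto simp: prob_measures_def is_policy_law_def)
    show ?thesis
      by (rule has_cond_law_distr[OF prob_space.finite_measure[OF P] prob_space.not_empty[OF P] _ _ policyD[OF \<pi>]]) (use that is_policy_law_iff[OF \<pi>] in auto)
  qed
  have l2: "distr P (?H (Suc n)) (history (Suc n)) =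
      distr (kernel_joint (distr P (?K n) (?Y n)) X Qstep) (?H (Suc n))
        (\<lambda>(((h, x), a), y). (h(n := (x, a)), y))"
    if "is_policy_law X A Q \<nu> \<pi> P" for P n
  proof -
    have P: "prob_space P" and [measurable_cong]: "sets P = sets (trajectories X A)"
      using that by (auto simp: prob_measures_def is_policy_law_def)
    have eq: "kernel_joint (distr P (?K n) (?Y n)) X Qstep = distr P (?K n \<Otimes>\<^sub>M X) (\<lambda>\<omega>. (?Y n \<omega>, fst (\<omega> (Suc n))))"
      by (rule has_cond_law_distr[OF prob_space.finite_measure[OF P] prob_space.not_empty[OF P] _ _ Qstep_measurable, symmetric]) (use that is_policy_law_iff[OF \<pi>] in auto)
    have [measurable]: "(\<lambda>v. (fst (fst (fst v)))(n := (snd (fst (fst v)), snd (fst v)))) \<in> (?K n \<Otimes>\<^sub>M X) \<rightarrow>\<^sub>M PiM {..<Suc n} (\<lambda>i. SA)"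
      unfolding histories_def by (rule measurable_fun_upd[where J="{..<n}"]) (auto simp: lessThan_Suc)
    have "(\<lambda>(((h, x), a), y). (h(n := (x, a)), y)) \<in> (?K n \<Otimes>\<^sub>M X) \<rightarrow>\<^sub>M ?H (Suc n)"
      unfolding split_beta' histories_def[of X A "Suc n"] by measurable
    moreover have "(\<lambda>\<omega>. (?Y n \<omega>, fst (\<omega> (Suc n)))) \<in> P \<rightarrow>\<^sub>M ?K n \<Otimes>\<^sub>M X" by measurable
    ultimately show ?thesis unfolding eq
      by (subst distr_distr)
        (auto simp: comp_def history_def fun_eq_iff restrict_def less_Suc_eq intro!: distr_cong)
  qed
  have l0: "distr P (?H 0) (history 0) = distr \<nu> (?H 0) (\<lambda>x. (\<lambda>_. undefined, x))"
    if "is_policy_law X A Q \<nu> \<pi> P" for P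
  proof -
    have P: "prob_space P" and [measurable_cong]: "sets P = sets (trajectories X A)" and \<nu>: "\<nu> = distr P X (\<lambda>\<omega>. fst (\<omega> 0))"
      using that by (auto simp: prob_measures_def is_policy_law_def)
    have [measurable]: "(\<lambda>x. (\<lambda>_. undefined, x)) \<in> X \<rightarrow>\<^sub>M ?H 0"
      unfolding histories_def by (intro measurable_Pair measurable_const) (auto simp: space_PiM)
    show ?thesis unfolding \<nu> by (subst distr_distr) (auto simp: comp_def history_def restrict_def intro!: distr_cong)
  qed
  have H: "distr P1 (?H n) (history n) = distr P2 (?H n) (history n)" for n
  proof (induction n)
    case 0 show ?case using l0[OF 1] l0[OF 2] by simp
  next
    case (Suc n) show ?case unfolding l2[OF 1] l2[OF 2] l1[OF 1] l1[OF 2] Suc ..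
  qed
  have s: "sets P1 = sets (PiM UNIV (\<lambda>i::nat. SA))" "sets P2 = sets (PiM UNIV (\<lambda>i::nat. SA))" 
    and f: "prob_space P1"
    using 1 2 by (auto simp: is_policy_law_def prob_measures_def trajectories_def)
  note [measurable_cong] = s[folded trajectories_def]
  have sp: "space P1 = space (PiM UNIV (\<lambda>i::nat. SA))" "space P2 = space (PiM UNIV (\<lambda>i::nat. SA))"
    using s by (auto dest: sets_eq_imp_space_eq)
  show ?thesis
  proof (rule measure_eqI_PiM_infinite[OF s])
    show "finite_measure P1" using f by (rule prob_space.finite_measure)
    fix E and J :: "nat set" assume J: "finite J" and E: "\<And>i. i \<in> J \<Longrightarrow> E i \<in> sets SA"
    from J obtain n where n: "J \<subseteq> {..<n}" using finite_nat_iff_bounded by blast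
    let ?E = "{v \<in> space (?H n). \<forall>i\<in>J. fst v i \<in> E i}"
    have [measurable]: "?E \<in> sets (?H n)"
      unfolding histories_def using J E by measurable (use n in auto)
    have eq: "history n -` ?E \<inter> space (PiM UNIV (\<lambda>i::nat. SA)) = prod_emb UNIV (\<lambda>i. SA) J (Pi\<^sub>E J E)"
      using n measurable_space[OF measurable_history, of _ X A n, unfolded trajectories_def]
      by (auto simp: prod_emb_def history_def space_PiM PiE_def Pi_iff subset_eq)
    have "emeasure P1 (prod_emb UNIV (\<lambda>i. SA) J (Pi\<^sub>E J E)) = emeasure (distr P1 (?H n) (history n)) ?E"
      unfolding eq[symmetric] by (subst emeasure_distr) (simp_all add: sp)
    also have "\<dots> = emeasure (distr P2 (?H n) (history n)) ?E" unfolding H ..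
    also have "\<dots> = emeasure P2 (prod_emb UNIV (\<lambda>i. SA) J (Pi\<^sub>E J E))"
      unfolding eq[symmetric] by (subst emeasure_distr) (simp_all add: sp)
    finally show "emeasure P1 (prod_emb UNIV (\<lambda>i. SA) J (Pi\<^sub>E J E)) = emeasure P2 (prod_emb UNIV (\<lambda>i. SA) J (Pi\<^sub>E J E))" .
  qed
qed

text \<open>
  The Ionescu-Tulcea construction is applied to the state-action pairs: given the pairs before time \<open>n\<close>,
  the state is drawn from \<open>Q\<close> at the last pair (from \<open>\<nu>\<close> at time \<open>0\<close>) and then the action from \<open>\<pi>\<^sub>n\<close>.
  Integrating against this two-stage kernel recovers both required conditional laws.
\<close>

lemma policy_law_exists:
  assumes \<pi>: "\<pi> \<in> policies X A Ad" and \<nu>: "\<nu> \<in> prob_measures X"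
  shows "\<exists>P. is_policy_law X A Q \<nu> \<pi> P"
proof -
  note [measurable] = measurable_history measurable_traj_component
  define st :: "nat \<Rightarrow> (nat \<Rightarrow> 'x \<times> 'a) \<Rightarrow> 'x measure" where "st n r = (case n of 0 \<Rightarrow> \<nu> | Suc m \<Rightarrow> Q (r m))" for n r
  define K where "K n r = st n r \<bind> (\<lambda>x. distr (\<pi> n (r, x)) SA (Pair x))" for n r
  have \<nu>': "\<nu> \<in> space (prob_algebra X)" using \<nu> by (auto simp: prob_measures_def space_prob_algebra)
  have st[measurable]: "st n \<in> PiM {0..<n} (\<lambda>_. SA) \<rightarrow>\<^sub>M prob_algebra X" for n
    unfolding st_def by (cases n) (use \<nu>' in \<open>auto intro!: measurable_compose[OF _ Q_measurable]\<close>)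
  have \<pi>m[measurable]: "\<pi> n \<in> PiM {0..<n} (\<lambda>_. SA) \<Otimes>\<^sub>M X \<rightarrow>\<^sub>M prob_algebra AS" for n
    using policyD[OF \<pi>, of n] unfolding histories_def by (simp add: atLeast0LessThan)
  have inner: "(\<lambda>(r, x). distr (\<pi> n (r, x)) SA (Pair x)) \<in> PiM {0..<n} (\<lambda>_. SA) \<Otimes>\<^sub>M X \<rightarrow>\<^sub>M prob_algebra SA" for n
    unfolding split_beta' by (rule measurable_distr_prob_space2[where M=AS]) auto
  have K[measurable]: "K n \<in> PiM {0..<n} (\<lambda>_. SA) \<rightarrow>\<^sub>M prob_algebra SA" for n
    unfolding K_def[abs_def] by (rule measurable_bind_prob_space2[OF st inner])
  have K_int: "(\<integral>\<^sup>+z. g z \<partial>K n r) = (\<integral>\<^sup>+x. \<integral>\<^sup>+a. g (x, a) \<partial>\<pi> n (r, x) \<partial>st n r)"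
    if r: "r \<in> space (PiM {0..<n} (\<lambda>_. SA))" and g[measurable]: "g \<in> borel_measurable SA" for g n r
  proof -
    have [measurable_cong]: "sets (st n r) = sets X" by (rule sets_kernel_prob(1)[OF st r])
    have sp: "space (st n r) = space X" by (rule sets_kernel_prob(2)[OF st r])
    have m: "(\<lambda>x. distr (\<pi> n (r, x)) SA (Pair x)) \<in> st n r \<rightarrow>\<^sub>M subprob_algebra SA"
      using measurable_compose[OF measurable_Pair1'[OF r] inner]
      by (auto intro!: measurable_prob_algebraD cong: measurable_cong_sets)
    show ?thesis unfolding K_def
      apply (subst nn_integral_bind[OF g m])
      apply (rule nn_integral_cong)
      apply (subst nn_integral_distr)
      using sets_kernel_prob[OF \<pi>m, of "(r, _)" n] r
      by (auto cong: measurable_cong_sets simp: sp space_pair_measure)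
  qed
  interpret IT: Ionescu_Tulcea K "\<lambda>_. SA"
    by (rule Ionescu_Tulcea.intro) (rule measurable_prob_algebraD[OF K], rule sets_kernel_prob(3)[OF K])
  let ?P = "IT.PF.lim"
  have sP[measurable_cong]: "sets ?P = sets (trajectories X A)" unfolding trajectories_def by (rule IT.PF.sets_lim)
  have sp: "space ?P = space (trajectories X A)" using sP by (rule sets_eq_imp_space_eq)
  have r[measurable]: "(\<lambda>\<omega>. restrict \<omega> {0..<n}) \<in> ?P \<rightarrow>\<^sub>M PiM {0..<n} (\<lambda>_. SA)" for n
    unfolding measurable_cong_sets[OF IT.PF.sets_lim refl] by (rule measurable_restrict_subset) auto
  have P: "prob_space ?P"
  proof (rule prob_space_distrD[OF r[of 0]])
    show "prob_space (distr ?P (PiM {0..<0} (\<lambda>_. SA)) (\<lambda>\<omega>. restrict \<omega> {0..<0}))"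
      unfolding IT.distr_lim_initial by (rule IT.prob_space_C) simp
  qed
  \<comment> \<open>The conditional law of the next pair given the past, written as an iterated integral; the
    initial law and both conditional laws follow by choosing the integrand.\<close>
  have main: "(\<integral>\<^sup>+\<omega>. g (restrict \<omega> {0..<n}, \<omega> n) \<partial>?P) =
     (\<integral>\<^sup>+\<omega>. \<integral>\<^sup>+x. \<integral>\<^sup>+a. g (restrict \<omega> {0..<n}, x, a) \<partial>\<pi> n (restrict \<omega> {0..<n}, x) \<partial>st n (restrict \<omega> {0..<n}) \<partial>?P)"
    if g[measurable]: "g \<in> borel_measurable (PiM {0..<n} (\<lambda>_. SA) \<Otimes>\<^sub>M SA)" for g n
  proof -
    have "(\<integral>\<^sup>+\<omega>. g (restrict \<omega> {0..<n}, \<omega> n) \<partial>?P) = (\<integral>\<^sup>+\<omega>. \<integral>\<^sup>+z. g (restrict \<omega> {0..<n}, z) \<partial>K n (restrict \<omega> {0..<n}) \<partial>?P)"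
      by (rule nn_integral_cond_law[OF prob_space.finite_measure[OF P] prob_space.not_empty[OF P] r _ K IT.has_cond_law_lim g]) measurable
    also have "\<dots> = (\<integral>\<^sup>+\<omega>. \<integral>\<^sup>+x. \<integral>\<^sup>+a. g (restrict \<omega> {0..<n}, x, a) \<partial>\<pi> n (restrict \<omega> {0..<n}, x) \<partial>st n (restrict \<omega> {0..<n}) \<partial>?P)"
      by (rule nn_integral_cong, rule K_int)
         (use measurable_space[OF r] in \<open>auto intro!: measurable_compose[OF measurable_Pair1' g]\<close>)
    finally show ?thesis .
  qed
  have stD: "space (st n (restrict \<omega> {0..<n})) = space X" "prob_space (st n (restrict \<omega> {0..<n}))"
       "sets (st n (restrict \<omega> {0..<n})) = sets X"
    if "\<omega> \<in> space ?P" for \<omega> n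
    using sets_kernel_prob[OF st measurable_space[OF r that]] by auto
  have \<pi>D: "prob_space (\<pi> n (restrict \<omega> {0..<n}, x))" "sets (\<pi> n (restrict \<omega> {0..<n}, x)) = sets AS"
    if "\<omega> \<in> space ?P" "x \<in> space X" for \<omega> n x
    using sets_kernel_prob[OF \<pi>m, of "(restrict \<omega> {0..<n}, x)" n] measurable_space[OF r that(1)] that by (auto simp: space_pair_measure)
  have hist: "history n \<omega> = (restrict \<omega> {0..<n}, fst (\<omega> n))" for n and \<omega> :: "nat \<Rightarrow> 'x \<times> 'a"
    by (simp add: history_def atLeast0LessThan)
  have Hs: "histories X A n = PiM {0..<n} (\<lambda>_. SA) \<Otimes>\<^sub>M X" for n
    by (simp add: histories_def atLeast0LessThan)
  have "is_policy_law X A Q \<nu> \<pi> ?P"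
    unfolding is_policy_law_iff[OF \<pi>]
  proof (intro conjI allI)
    show "?P \<in> prob_measures (trajectories X A)" using P sP by (simp add: prob_measures_def)
    show "distr ?P X (\<lambda>\<omega>. fst (\<omega> 0)) = \<nu>"
    proof (rule measure_eqI)
      show "sets (distr ?P X (\<lambda>\<omega>. fst (\<omega> 0))) = sets \<nu>" using \<nu> by (simp add: prob_measures_def)
      fix B assume "B \<in> sets (distr ?P X (\<lambda>\<omega>. fst (\<omega> 0)))"
      then have B[measurable]: "B \<in> sets X" by simp
      have "emeasure (distr ?P X (\<lambda>\<omega>. fst (\<omega> 0))) B = (\<integral>\<^sup>+y. indicator B y \<partial>distr ?P X (\<lambda>\<omega>. fst (\<omega> 0)))"
        by simp
      also have "\<dots> = (\<integral>\<^sup>+\<omega>. indicator B (fst (snd (restrict \<omega> {0..<0}, \<omega> 0))) \<partial>?P)"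
        by (subst nn_integral_distr) (auto)
      also have "\<dots> = (\<integral>\<^sup>+\<omega>. \<integral>\<^sup>+x. \<integral>\<^sup>+a. indicator B x \<partial>\<pi> 0 (restrict \<omega> {0..<0}, x) \<partial>st 0 (restrict \<omega> {0..<0}) \<partial>?P)"
        by (subst main) auto
      also have "\<dots> = (\<integral>\<^sup>+\<omega>. emeasure \<nu> B \<partial>?P)"
      proof (rule nn_integral_cong)
        fix \<omega> assume \<omega>: "\<omega> \<in> space ?P"
        have "(\<integral>\<^sup>+x. \<integral>\<^sup>+a. indicator B x \<partial>\<pi> 0 (restrict \<omega> {0..<0}, x) \<partial>st 0 (restrict \<omega> {0..<0})) = (\<integral>\<^sup>+x. indicator B x \<partial>st 0 (restrict \<omega> {0..<0}))"
          by (rule nn_integral_cong) (use \<pi>D[OF \<omega>, of _ 0] stD[OF \<omega>, of 0] in \<open>simp add: prob_space.emeasure_space_1\<close>)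
        also have "\<dots> = emeasure \<nu> B" using \<nu> by (simp add: st_def prob_measures_def)
        finally show "(\<integral>\<^sup>+x. \<integral>\<^sup>+a. indicator B x \<partial>\<pi> 0 (restrict \<omega> {0..<0}, x) \<partial>st 0 (restrict \<omega> {0..<0})) = emeasure \<nu> B" .
      qed
      also have "\<dots> = emeasure \<nu> B" using prob_space.emeasure_space_1[OF P] by simp
      finally show "emeasure (distr ?P X (\<lambda>\<omega>. fst (\<omega> 0))) B = emeasure \<nu> B" .
    qed
    fix n
    show "has_cond_law ?P (histories X A n) AS (history n) (\<lambda>\<omega>. snd (\<omega> n)) (\<pi> n)"
      unfolding has_cond_law_def
    proof (intro ballI)
      fix D C assume D: "D \<in> sets (histories X A n)" and C[measurable]: "C \<in> sets AS"
      have D'[measurable]: "D \<in> sets (PiM {0..<n} (\<lambda>_. SA) \<Otimes>\<^sub>M X)" using D unfolding Hs .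
      have \<pi>s[measurable]: "\<pi> n \<in> PiM {0..<n} (\<lambda>_. SA) \<Otimes>\<^sub>M X \<rightarrow>\<^sub>M subprob_algebra AS"
        by (rule measurable_prob_algebraD) measurable
      have "emeasure ?P {\<omega> \<in> space ?P. history n \<omega> \<in> D \<and> snd (\<omega> n) \<in> C} =
         (\<integral>\<^sup>+\<omega>. indicator {\<omega> \<in> space ?P. history n \<omega> \<in> D \<and> snd (\<omega> n) \<in> C} \<omega> \<partial>?P)"
      proof (rule nn_integral_indicator[symmetric])
        note D[measurable]
        show "{\<omega> \<in> space ?P. history n \<omega> \<in> D \<and> snd (\<omega> n) \<in> C} \<in> sets ?P" by measurable
      qed
      also have "\<dots> = (\<integral>\<^sup>+\<omega>. (\<lambda>(r, x, a). indicator D (r, x) * indicator C a) (restrict \<omega> {0..<n}, \<omega> n) \<partial>?P)"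
        by (rule nn_integral_cong) (auto simp: hist split_beta' indicator_def)
      also have "\<dots> = (\<integral>\<^sup>+\<omega>. \<integral>\<^sup>+x. \<integral>\<^sup>+a. indicator D (restrict \<omega> {0..<n}, x) * indicator C a
           \<partial>\<pi> n (restrict \<omega> {0..<n}, x) \<partial>st n (restrict \<omega> {0..<n}) \<partial>?P)"
        by (subst main) auto
      also have "\<dots> = (\<integral>\<^sup>+\<omega>. \<integral>\<^sup>+x. \<integral>\<^sup>+a. indicator D (restrict \<omega> {0..<n}, x) * emeasure (\<pi> n (restrict \<omega> {0..<n}, x)) C
           \<partial>\<pi> n (restrict \<omega> {0..<n}, x) \<partial>st n (restrict \<omega> {0..<n}) \<partial>?P)"
        by (rule nn_integral_cong, rule nn_integral_cong)
           (simp add: stD \<pi>D nn_integral_cmult_indicator prob_space.emeasure_space_1)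
      also have "\<dots> = (\<integral>\<^sup>+\<omega>. (\<lambda>(r, x, a). indicator D (r, x) * emeasure (\<pi> n (r, x)) C) (restrict \<omega> {0..<n}, \<omega> n) \<partial>?P)"
        by (subst main) auto
      also have "\<dots> = (\<integral>\<^sup>+\<omega>. indicator D (history n \<omega>) * emeasure (\<pi> n (history n \<omega>)) C \<partial>?P)"
        by (rule nn_integral_cong) (auto simp: hist split_beta')
      finally show "emeasure ?P {\<omega> \<in> space ?P. history n \<omega> \<in> D \<and> snd (\<omega> n) \<in> C} =
        (\<integral>\<^sup>+\<omega>. indicator D (history n \<omega>) * emeasure (\<pi> n (history n \<omega>)) C \<partial>?P)" .
    qed
    show "has_cond_law ?P (histories X A n \<Otimes>\<^sub>M AS) X (\<lambda>\<omega>. (history n \<omega>, snd (\<omega> n))) (\<lambda>\<omega>. fst (\<omega> (Suc n))) Qstep"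
      unfolding has_cond_law_def
    proof (intro ballI)
      fix D B assume D[measurable]: "D \<in> sets (histories X A n \<Otimes>\<^sub>M AS)" and B[measurable]: "B \<in> sets X"
      let ?\<phi> = "\<lambda>r. ((restrict r {..<n}, fst (r n)), snd (r n)) :: ((nat \<Rightarrow> 'x \<times> 'a) \<times> 'x) \<times> 'a"
      have \<phi>[measurable]: "?\<phi> \<in> PiM {0..<Suc n} (\<lambda>_. SA) \<rightarrow>\<^sub>M histories X A n \<Otimes>\<^sub>M AS"
      proof -
        have "(\<lambda>r. fst (r n)) \<in> PiM {0..<Suc n} (\<lambda>_. SA) \<rightarrow>\<^sub>M X" "(\<lambda>r. snd (r n)) \<in> PiM {0..<Suc n} (\<lambda>_. SA) \<rightarrow>\<^sub>M AS"
          by measurable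
        then show ?thesis
          unfolding histories_def by (intro measurable_Pair measurable_restrict_subset) auto
      qed
      have e: "(history n \<omega>, snd (\<omega> n)) = ?\<phi> (restrict \<omega> {0..<Suc n})" for \<omega>
        by (auto simp: history_def restrict_def fun_eq_iff)
      have "emeasure ?P {\<omega> \<in> space ?P. (history n \<omega>, snd (\<omega> n)) \<in> D \<and> fst (\<omega> (Suc n)) \<in> B} =
         (\<integral>\<^sup>+\<omega>. indicator {\<omega> \<in> space ?P. (history n \<omega>, snd (\<omega> n)) \<in> D \<and> fst (\<omega> (Suc n)) \<in> B} \<omega> \<partial>?P)"
        by (rule nn_integral_indicator[symmetric]) measurable
      also have "\<dots> = (\<integral>\<^sup>+\<omega>. (\<lambda>(r, z). indicator D (?\<phi> r) * indicator B (fst z)) (restrict \<omega> {0..<Suc n}, \<omega> (Suc n)) \<partial>?P)"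
        by (rule nn_integral_cong) (auto simp: e indicator_def simp del: prod.inject)
      also have "\<dots> = (\<integral>\<^sup>+\<omega>. \<integral>\<^sup>+x. \<integral>\<^sup>+a. indicator D (?\<phi> (restrict \<omega> {0..<Suc n})) * indicator B x
           \<partial>\<pi> (Suc n) (restrict \<omega> {0..<Suc n}, x) \<partial>st (Suc n) (restrict \<omega> {0..<Suc n}) \<partial>?P)"
        by (subst main) auto
      also have "\<dots> = (\<integral>\<^sup>+\<omega>. \<integral>\<^sup>+x. indicator D (?\<phi> (restrict \<omega> {0..<Suc n})) * indicator B x \<partial>st (Suc n) (restrict \<omega> {0..<Suc n}) \<partial>?P)"
        by (intro nn_integral_cong) (simp add: stD \<pi>D prob_space.emeasure_space_1)
      also have "\<dots> = (\<integral>\<^sup>+\<omega>. indicator D (?\<phi> (restrict \<omega> {0..<Suc n})) * emeasure (st (Suc n) (restrict \<omega> {0..<Suc n})) B \<partial>?P)"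
        by (intro nn_integral_cong) (simp add: stD nn_integral_cmult_indicator)
      also have "\<dots> = (\<integral>\<^sup>+\<omega>. indicator D (history n \<omega>, snd (\<omega> n)) * emeasure (Qstep (history n \<omega>, snd (\<omega> n))) B \<partial>?P)"
        by (intro nn_integral_cong) (unfold e, simp add: st_def Qstep_def)
      finally show "emeasure ?P {\<omega> \<in> space ?P. (history n \<omega>, snd (\<omega> n)) \<in> D \<and> fst (\<omega> (Suc n)) \<in> B} =
         (\<integral>\<^sup>+\<omega>. indicator D (history n \<omega>, snd (\<omega> n)) * emeasure (Qstep (history n \<omega>, snd (\<omega> n))) B \<partial>?P)" .
    qed
  qed
  then show ?thesis ..
qed

lemma is_policy_law_policy_law:
  assumes \<pi>: "\<pi> \<in> policies X A Ad" and \<nu>: "\<nu> \<in> prob_measures X"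
  shows "is_policy_law X A Q \<nu> \<pi> (policy_law X A Q \<nu> \<pi>)"
  unfolding policy_law_def
  using policy_law_exists[OF \<pi> \<nu>] policy_law_unique[OF \<pi>] by (metis theI)

end

section \<open>Disintegration over a Borel subset of a Polish space\<close>

text \<open>
  Sequences of bits are coded by the real numbers with ternary digits \<open>0\<close> and \<open>2\<close>. Base three with a gap makes
  decoding unambiguous: the first digit is read off by comparison with \<open>1/2\<close>, and \<open>drop_digit\<close> below
  removes it.
\<close>

definition ternary :: "(nat \<Rightarrow> bool) \<Rightarrow> real" where
  "ternary b = (\<Sum>i. of_bool (b i) * 2 / 3 ^ Suc i)"

definition drop_digit :: "real \<Rightarrow> real" where
  "drop_digit r = (if 1/2 \<le> r then 3 * r - 2 else 3 * r)"

lemma summable_two_thirds: "summable (\<lambda>i. (2/3) * (1/3)^i :: real)"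
  by (intro summable_mult summable_geometric) simp

lemma summable_ternary: "summable (\<lambda>i. of_bool (b i) * 2 / 3 ^ Suc i :: real)"
  by (rule summable_comparison_test'[OF summable_two_thirds, where N=0]) (auto simp: power_divide)

lemma ternary_nonneg: "0 \<le> ternary b"
  unfolding ternary_def by (intro suminf_nonneg summable_ternary) auto

lemma ternary_le_1: "ternary b \<le> 1"
proof -
  have "ternary b \<le> (\<Sum>i. (2/3) * (1/3)^i)"
    unfolding ternary_def
    by (intro suminf_le summable_ternary summable_two_thirds) (auto simp: power_divide)
  also have "\<dots> = 1" by (subst suminf_mult) (auto simp: suminf_geometric summable_geometric)
  finally show ?thesis .
qed

lemma ternary_rec: "ternary b = of_bool (b 0) * 2/3 + ternary (\<lambda>i. b (Suc i)) / 3"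
proof -
  have "ternary b = (\<Sum>i. of_bool (b (Suc i)) * 2 / 3 ^ Suc (Suc i)) + of_bool (b 0) * 2/3"
    unfolding ternary_def using suminf_split_head[OF summable_ternary[of b]] by simp
  also have "(\<Sum>i. of_bool (b (Suc i)) * 2 / 3 ^ Suc (Suc i) :: real) = ternary (\<lambda>i. b (Suc i)) / 3"
    unfolding ternary_def using suminf_divide[OF summable_ternary[of "\<lambda>i. b (Suc i)"], of 3] by (simp add: mult.commute)
  finally show ?thesis by simp
qed

lemma half_le_ternary: "1/2 \<le> ternary b \<longleftrightarrow> b 0"
  using ternary_rec[of b] ternary_nonneg[of "\<lambda>i. b (Suc i)"] ternary_le_1[of "\<lambda>i. b (Suc i)"] by (cases "b 0") auto

lemma drop_digit_ternary: "drop_digit (ternary b) = ternary (\<lambda>i. b (Suc i))"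
  unfolding drop_digit_def half_le_ternary using ternary_rec[of b] by auto

lemma drop_digit_power_ternary: "(drop_digit ^^ n) (ternary b) = ternary (\<lambda>i. b (i + n))"
  by (induction n) (simp_all add: drop_digit_ternary)

lemma ternary_digit: "1/2 \<le> (drop_digit ^^ n) (ternary b) \<longleftrightarrow> b n"
  unfolding drop_digit_power_ternary half_le_ternary by simp

lemma measurable_drop_digit[measurable]: "drop_digit \<in> borel_measurable borel"
  unfolding drop_digit_def[abs_def] by measurable

text \<open>
  Every Polish space is a Borel retract of \<open>\<real>\<close>. A point is coded by the bits that tell, for each \<open>k\<close> and \<open>n\<close>, whether
  it lies within \<open>2\<^sup>-\<^sup>k\<close> of the \<open>n\<close>-th point of a dense sequence. Decoding selects, for each \<open>k\<close>, the first such \<open>n\<close> and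
  passes to the limit, with a default value where the selected points do not converge.
\<close>

lemma polish_real_retract:
  "\<exists>(s :: 'a::polish_space \<Rightarrow> real) \<psi>. s \<in> borel \<rightarrow>\<^sub>M borel \<and> \<psi> \<in> borel \<rightarrow>\<^sub>M borel \<and> (\<forall>a. \<psi> (s a) = a)"
proof -
  obtain D :: "'a set" where D: "countable D" "\<And>U. open U \<Longrightarrow> U \<noteq> {} \<Longrightarrow> \<exists>d\<in>D. d \<in> U"
    using countable_dense_exists by blast
  have D0: "D \<noteq> {}" using D(2)[of UNIV] by auto
  define d where "d = from_nat_into D"
  have d: "\<exists>n. dist a (d n) < e" if "e > 0" for a e
  proof -
    have "\<exists>x\<in>D. x \<in> ball a e" using that by (intro D(2)) auto
    then obtain x where "x \<in> D" "x \<in> ball a e" by blast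
    moreover obtain n where "d n = x" using from_nat_into_surj[OF D(1) \<open>x \<in> D\<close>] d_def by auto
    ultimately show ?thesis by auto
  qed
  define s :: "'a \<Rightarrow> real" where
    "s a = ternary (\<lambda>i. dist a (d (snd (prod_decode i))) < (1/2) ^ fst (prod_decode i))" for a
  define c where "c k r = d (LEAST n. 1/2 \<le> (drop_digit ^^ prod_encode (k, n)) r)" for k r
  define \<psi> where "\<psi> r = (if Cauchy (\<lambda>k. c k r) then lim (\<lambda>k. c k r) else d 0)" for r
  have "s \<in> borel \<rightarrow>\<^sub>M borel"
    unfolding s_def[abs_def] ternary_def of_bool_def by measurable
  moreover have "\<psi> \<in> borel \<rightarrow>\<^sub>M borel"
  proof (rule borel_measurable_LIMSEQ_metric)
    have [measurable]: "(\<lambda>r. (drop_digit ^^ n) r) \<in> borel_measurable borel" for n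
      by (rule measurable_compose_n) measurable
    have "(\<lambda>r. LEAST n. 1/2 \<le> (drop_digit ^^ prod_encode (k, n)) r) \<in> borel \<rightarrow>\<^sub>M count_space UNIV" for k
      by measurable
    from measurable_compose[OF this, of d borel] have c[measurable]: "c k \<in> borel_measurable borel" for k
      unfolding c_def[abs_def] by simp
    have [measurable]: "Measurable.pred borel (\<lambda>r. Cauchy (\<lambda>k. c k r))"
      using sets_Collect_Cauchy[of c borel] c by (simp add: pred_def)
    show "(\<lambda>r. if Cauchy (\<lambda>k. c k r) then c k r else d 0) \<in> borel_measurable borel" for k
      by measurable
    show "(\<lambda>k. if Cauchy (\<lambda>k. c k r) then c k r else d 0) \<longlonglongrightarrow> \<psi> r" for r
      unfolding \<psi>_def by (auto simp: Cauchy_convergent_iff convergent_LIMSEQ_iff)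
  qed
  moreover have "\<psi> (s a) = a" for a
  proof -
    have "c k (s a) = d (LEAST n. dist a (d n) < (1/2)^k)" for k
      unfolding c_def s_def ternary_digit by simp
    moreover have "dist a (d (LEAST n. dist a (d n) < (1/2)^k)) < (1/2)^k" for k
      by (rule LeastI_ex) (rule d, simp)
    ultimately have b: "dist (c k (s a)) a \<le> (1/2)^k" for k by (simp add: dist_commute less_imp_le)
    have "(\<lambda>k. dist (c k (s a)) a) \<longlonglongrightarrow> 0"
      by (rule tendsto_sandwich[OF _ _ tendsto_const LIMSEQ_power_zero[of "1/2::real"]]) (auto simp: b)
    then have "(\<lambda>k. c k (s a)) \<longlonglongrightarrow> a" by (rule tendsto_dist_iff[THEN iffD2])
    then show ?thesis unfolding \<psi>_def by (auto simp: limI Cauchy_convergent_iff convergent_def)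
  qed
  ultimately show ?thesis by blast
qed

lemma sets_borel_eq_rat_atMost:
  "sets (borel :: real measure) = sigma_sets UNIV (range (\<lambda>q::rat. {..of_rat q}))"
proof -
  let ?S = "sigma_sets UNIV (range (\<lambda>q::rat. {..of_rat q :: real}))"
  have sig: "sigma_algebra UNIV ?S" by (rule sigma_algebra_sigma_sets) auto
  have "{..t} \<in> ?S" for t :: real
  proof -
    have eq: "{..t} = (\<Inter>q\<in>{q::rat. t < of_rat q}. {..of_rat q})"
      by (auto simp: not_le[symmetric]) (metis of_rat_dense linorder_not_le not_less_iff_gr_or_eq)
    have "(\<Inter>q\<in>{q::rat. t < of_rat q}. {..of_rat q :: real}) \<in> ?S"
    proof (rule sigma_algebra.countable_INT'[OF sig])
      show "{q::rat. t < of_rat q} \<noteq> {}" using of_rat_dense[of t "t+1"] by auto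
    qed auto
    then show ?thesis using eq by simp
  qed
  then have "sigma_sets UNIV (range (\<lambda>a::real. {..a})) \<subseteq> ?S"
    by (intro sigma_algebra.sigma_sets_subset[OF sig]) auto
  moreover have "?S \<subseteq> sigma_sets UNIV (range (\<lambda>a::real. {..a}))"
    by (rule sigma_sets_mono') auto
  ultimately show ?thesis unfolding borel_eq_atMost by simp
qed

lemma Int_stable_rat_atMost: "Int_stable (range (\<lambda>q::rat. {..of_rat q :: real}))"
proof (rule Int_stableI_image)
  fix p q :: rat
  show "\<exists>r\<in>UNIV. {..of_rat p :: real} \<inter> {..of_rat q} = {..of_rat r}"
    by (rule bexI[of _ "min p q"]) (auto simp: min_def of_rat_less_eq)
qed

text \<open>
  The properties of a distribution function that can be stated on the rationals. There are only countably many
  conditions, so conditional probabilities, which are determined up to null sets for each rational separately,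
  satisfy all of them simultaneously almost everywhere.
\<close>

definition cdf_like :: "(rat \<Rightarrow> ennreal) \<Rightarrow> bool" where
  "cdf_like f \<longleftrightarrow> (\<forall>p q. p \<le> q \<longrightarrow> f p \<le> f q) \<and> (SUP n. f (of_nat n)) = 1 \<and> (INF n. f (- of_nat n)) = 0 \<and>
     (\<forall>q. (INF n. f (q + 1 / of_nat (Suc n))) = f q)"

context
  fixes X :: "'x measure" and \<mu> :: "('x \<times> real) measure"
  assumes fin: "finite_measure \<mu>" and sets_\<mu>: "sets \<mu> = sets (X \<Otimes>\<^sub>M borel)"
begin

interpretation \<mu>: finite_measure \<mu> by (rule fin)

private abbreviation "m \<equiv> distr \<mu> X fst"

private lemma sets_\<mu>'[measurable_cong]: "sets \<mu> = sets (X \<Otimes>\<^sub>M borel)" by (rule sets_\<mu>)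

private lemma space_\<mu>: "space \<mu> = space X \<times> UNIV"
  using sets_eq_imp_space_eq[OF sets_\<mu>] by (simp add: space_pair_measure)

interpretation m: finite_measure m by (rule \<mu>.finite_measure_distr) measurable

text \<open>
  \<open>B \<mapsto> \<mu>(B \<times> E)\<close>; its density with respect to the marginal is the conditional probability of the
  second coordinate being in \<open>E\<close>.
\<close>

definition slice :: "real set \<Rightarrow> 'x measure" where
  "slice E = distr (density \<mu> (\<lambda>z. indicator E (snd z))) X fst"

definition cond_density :: "real set \<Rightarrow> 'x \<Rightarrow> ennreal" where
  "cond_density E = RN_deriv m (slice E)"

lemma emeasure_marginal:
  assumes B: "B \<in> sets X"
  shows "emeasure m B = emeasure \<mu> (B \<times> UNIV)"
proof -
  have "fst -` B \<inter> space \<mu> = B \<times> UNIV" using sets.sets_into_space[OF B] by (auto simp: space_\<mu>)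
  then show ?thesis using B by (simp add: emeasure_distr)
qed

lemma emeasure_slice:
  assumes E[measurable]: "E \<in> sets borel" and B[measurable]: "B \<in> sets X"
  shows "emeasure (slice E) B = emeasure \<mu> (B \<times> E)"
proof -
  have "emeasure (slice E) B = emeasure (density \<mu> (\<lambda>z. indicator E (snd z))) (fst -` B \<inter> space \<mu>)"
    unfolding slice_def by (subst emeasure_distr) auto
  also have "\<dots> = (\<integral>\<^sup>+z. indicator E (snd z) * indicator (fst -` B \<inter> space \<mu>) z \<partial>\<mu>)"
    by (subst emeasure_density) auto
  also have "\<dots> = (\<integral>\<^sup>+z. indicator (B \<times> E) z \<partial>\<mu>)"
    by (rule nn_integral_cong) (auto simp: indicator_def)
  also have "\<dots> = emeasure \<mu> (B \<times> E)" by (simp add: sets_\<mu>)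
  finally show ?thesis .
qed

lemma cond_density_measurable[measurable]: "cond_density E \<in> borel_measurable X"
  using borel_measurable_RN_deriv[of m "slice E"] unfolding cond_density_def by simp

lemma nn_integral_cond_density:
  assumes E[measurable]: "E \<in> sets borel" and B[measurable]: "B \<in> sets X"
  shows "(\<integral>\<^sup>+x. cond_density E x * indicator B x \<partial>m) = emeasure \<mu> (B \<times> E)"
proof -
  have ac: "absolutely_continuous m (slice E)"
    unfolding absolutely_continuous_def
  proof (rule subsetI)
    fix N assume "N \<in> null_sets m"
    then have N[measurable]: "N \<in> sets X" and "emeasure m N = 0" by (auto simp: null_sets_def)
    then have 0: "emeasure \<mu> (N \<times> UNIV) = 0" by (simp add: emeasure_marginal)
    have "emeasure \<mu> (N \<times> E) \<le> emeasure \<mu> (N \<times> UNIV)" by (rule emeasure_mono) (auto simp: sets_\<mu>)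
    then show "N \<in> null_sets (slice E)" using 0 N by (auto simp: null_sets_def emeasure_slice) (simp add: slice_def)
  qed
  have "density m (cond_density E) = slice E"
    unfolding cond_density_def by (rule m.density_RN_deriv[OF ac]) (simp add: slice_def)
  then have "emeasure \<mu> (B \<times> E) = emeasure (density m (cond_density E)) B" by (simp add: emeasure_slice)
  also have "\<dots> = (\<integral>\<^sup>+x. cond_density E x * indicator B x \<partial>m)" by (rule emeasure_density) auto
  finally show ?thesis by simp
qed

text \<open>
  The tool for transferring set-theoretic relations between the sets \<open>E\<close> to almost sure relations between
  their conditional probabilities.
\<close>

lemma cond_density_unique:
  assumes g[measurable]: "g \<in> borel_measurable X" and E: "E \<in> sets borel"
    and eq: "\<And>B. B \<in> sets X \<Longrightarrow> (\<integral>\<^sup>+x. g x * indicator B x \<partial>m) = emeasure \<mu> (B \<times> E)"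
  shows "AE x in m. g x = cond_density E x"
  by (rule m.density_unique_finite_measure) (auto simp: eq nn_integral_cond_density[OF E])

lemma cond_density_mono:
  assumes [measurable]: "E \<in> sets borel" "E' \<in> sets borel" and sub: "E \<subseteq> E'"
  shows "AE x in m. cond_density E x \<le> cond_density E' x"
proof -
  have "AE x in m. cond_density E x + cond_density (E' - E) x = cond_density E' x"
  proof (rule cond_density_unique)
    fix B assume [measurable]: "B \<in> sets X"
    have "(\<integral>\<^sup>+x. (cond_density E x + cond_density (E' - E) x) * indicator B x \<partial>m) =
       emeasure \<mu> (B \<times> E) + emeasure \<mu> (B \<times> (E' - E))"
      by (simp add: distrib_right nn_integral_add nn_integral_cond_density)
    also have "\<dots> = emeasure \<mu> (B \<times> E \<union> B \<times> (E' - E))"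
      by (rule plus_emeasure) (auto simp: sets_\<mu>)
    also have "B \<times> E \<union> B \<times> (E' - E) = B \<times> E'" using sub by auto
    finally show "(\<integral>\<^sup>+x. (cond_density E x + cond_density (E' - E) x) * indicator B x \<partial>m) = emeasure \<mu> (B \<times> E')" .
  qed auto
  then show ?thesis by eventually_elim (metis le_iff_add)
qed

lemma cond_density_SUP:
  assumes [measurable]: "\<And>n. E n \<in> sets borel" and inc: "incseq E"
  shows "AE x in m. (SUP n. cond_density (E n) x) = cond_density (\<Union>n. E n) x"
proof (rule cond_density_unique)
  fix B assume B[measurable]: "B \<in> sets X"
  have "(\<integral>\<^sup>+x. (SUP n. cond_density (E n) x) * indicator B x \<partial>m) = (\<integral>\<^sup>+x. (SUP n. cond_density (E n) x * indicator B x) \<partial>m)"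
    by (rule nn_integral_cong) (auto simp: indicator_def)
  also have "\<dots> = (SUP n. \<integral>\<^sup>+x. cond_density (E n) x * indicator B x \<partial>m)"
  proof (rule nn_integral_monotone_convergence_SUP_AE)
    fix n show "AE x in m. cond_density (E n) x * indicator B x \<le> cond_density (E (Suc n)) x * indicator B x"
      using cond_density_mono[of "E n" "E (Suc n)"] inc
      by (auto simp: incseq_Suc_iff intro!: mult_right_mono elim: AE_mp)
  qed auto
  also have "\<dots> = (SUP n. emeasure \<mu> (B \<times> E n))" by (simp add: nn_integral_cond_density)
  also have "\<dots> = emeasure \<mu> (\<Union>n. B \<times> E n)"
    using inc by (intro SUP_emeasure_incseq) (auto simp: sets_\<mu> incseq_def)
  also have "(\<Union>n. B \<times> E n) = B \<times> (\<Union>n. E n)" by auto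
  finally show "(\<integral>\<^sup>+x. (SUP n. cond_density (E n) x) * indicator B x \<partial>m) = emeasure \<mu> (B \<times> (\<Union>n. E n))" .
qed auto

lemma cond_density_INF:
  assumes [measurable]: "\<And>n. E n \<in> sets borel" and dec: "decseq E"
  shows "AE x in m. (INF n. cond_density (E n) x) = cond_density (\<Inter>n. E n) x"
proof (rule cond_density_unique)
  fix B assume B[measurable]: "B \<in> sets X"
  have "(\<integral>\<^sup>+x. (INF n. cond_density (E n) x) * indicator B x \<partial>m) = (\<integral>\<^sup>+x. (INF n. cond_density (E n) x * indicator B x) \<partial>m)"
    by (rule nn_integral_cong) (auto simp: indicator_def)
  also have "\<dots> = (INF n. \<integral>\<^sup>+x. cond_density (E n) x * indicator B x \<partial>m)"
  proof (rule nn_integral_monotone_convergence_INF_AE)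
    fix n show "AE x in m. cond_density (E (Suc n)) x * indicator B x \<le> cond_density (E n) x * indicator B x"
      using cond_density_mono[of "E (Suc n)" "E n"] dec
      by (auto simp: decseq_Suc_iff intro!: mult_right_mono elim: AE_mp)
    show "(\<integral>\<^sup>+x. cond_density (E 0) x * indicator B x \<partial>m) < \<infinity>"
      by (simp add: nn_integral_cond_density \<mu>.emeasure_finite less_top[symmetric])
  qed auto
  also have "\<dots> = (INF n. emeasure \<mu> (B \<times> E n))" by (simp add: nn_integral_cond_density)
  also have "\<dots> = emeasure \<mu> (\<Inter>n. B \<times> E n)"
    using dec by (intro INF_emeasure_decseq) (auto simp: sets_\<mu> decseq_def)
  also have "(\<Inter>n. B \<times> E n) = B \<times> (\<Inter>n. E n)" by auto
  finally show "(\<integral>\<^sup>+x. (INF n. cond_density (E n) x) * indicator B x \<partial>m) = emeasure \<mu> (B \<times> (\<Inter>n. E n))" .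
qed auto

lemma cond_density_UNIV: "AE x in m. cond_density UNIV x = 1"
proof -
  have "AE x in m. 1 = cond_density UNIV x"
  proof (rule cond_density_unique)
    fix B assume B[measurable]: "B \<in> sets X"
    show "(\<integral>\<^sup>+x. 1 * indicator B x \<partial>m) = emeasure \<mu> (B \<times> UNIV)"
      using emeasure_marginal[OF B] by simp
  qed auto
  then show ?thesis by eventually_elim simp
qed

lemma cond_density_empty: "AE x in m. cond_density {} x = 0"
proof -
  have "AE x in m. 0 = cond_density {} x" by (rule cond_density_unique) auto
  then show ?thesis by eventually_elim simp
qed

definition rat_cdf :: "rat \<Rightarrow> 'x \<Rightarrow> ennreal" where
  "rat_cdf q = cond_density {..of_rat q}"

lemma AE_cdf_like: "AE x in m. cdf_like (\<lambda>q. rat_cdf q x)"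
proof -
  have 1: "AE x in m. \<forall>p q. p \<le> q \<longrightarrow> rat_cdf p x \<le> rat_cdf q x"
    unfolding AE_all_countable rat_cdf_def
    by (intro allI impI AE_impI cond_density_mono) (auto simp: of_rat_less_eq)
  have "AE x in m. (SUP n. rat_cdf (of_nat n) x) = cond_density (\<Union>n. {..real n}) x"
    unfolding rat_cdf_def of_rat_of_nat_eq by (rule cond_density_SUP) (auto simp: incseq_def)
  moreover have "(\<Union>n. {..real n}) = UNIV" by (auto intro: real_arch_simple)
  ultimately have 2: "AE x in m. (SUP n. rat_cdf (of_nat n) x) = 1"
    using cond_density_UNIV by auto
  have "AE x in m. (INF n. rat_cdf (- of_nat n) x) = cond_density (\<Inter>n. {..- real n}) x"
    unfolding rat_cdf_def of_rat_of_nat_eq of_rat_minus by (rule cond_density_INF) (auto simp: decseq_def)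
  moreover have "(\<Inter>n. {..- real n}) = {}" by auto (metis leD le_minus_iff reals_Archimedean2)
  ultimately have 3: "AE x in m. (INF n. rat_cdf (- of_nat n) x) = 0"
    using cond_density_empty by auto
  have 4: "AE x in m. \<forall>q. (INF n. rat_cdf (q + 1 / of_nat (Suc n)) x) = rat_cdf q x"
    unfolding AE_all_countable
  proof
    fix q :: rat
    have "AE x in m. (INF n. rat_cdf (q + 1 / of_nat (Suc n)) x) = cond_density (\<Inter>n. {..of_rat q + 1 / real (Suc n)}) x"
      unfolding rat_cdf_def of_rat_of_nat_eq of_rat_add of_rat_divide of_rat_1
      by (rule cond_density_INF) (auto simp: decseq_def frac_le)
    moreover have "(\<Inter>n. {..of_rat q + 1 / real (Suc n)}) = {..of_rat q}"
    proof (auto)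
      fix y :: real assume h: "\<forall>n. y \<le> of_rat q + 1 / (1 + real n)"
      show "y \<le> of_rat q"
      proof (rule ccontr)
        assume "\<not> y \<le> of_rat q"
        then obtain n where "inverse (real (Suc n)) < y - of_rat q" using reals_Archimedean[of "y - of_rat q"] by auto
        with h[rule_format, of n] show False by (simp add: inverse_eq_divide)
      qed
    next
      fix y :: real and n assume "y \<le> of_rat q"
      then show "y \<le> of_rat q + 1 / (1 + real n)" by (rule order_trans) simp
    qed
    ultimately show "AE x in m. (INF n. rat_cdf (q + 1 / of_nat (Suc n)) x) = rat_cdf q x"
      by (simp add: rat_cdf_def)
  qed
  show ?thesis using 1 2 3 4 unfolding cdf_like_def by eventually_elim blast
qed

end

definition real_cdf :: "(rat \<Rightarrow> ennreal) \<Rightarrow> real \<Rightarrow> real" where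
  "real_cdf f t = enn2real (INF q\<in>{q. t < of_rat q}. f q)"

text \<open>
  A function on the rationals as above extends to a distribution function on \<open>\<real>\<close> as the infimum over the rationals to the right,
  which is automatically right continuous. Right continuity on the rationals is what ensures that
  the extension agrees with the given function there.
\<close>

lemma real_cdf_distribution:
  assumes f: "cdf_like f"
  shows "real_distribution (interval_measure (real_cdf f))"
    and "emeasure (interval_measure (real_cdf f)) {..of_rat q} = f q"
proof -
  have mono: "p \<le> q \<Longrightarrow> f p \<le> f q" for p q using f by (auto simp: cdf_like_def)
  have S: "(SUP n. f (of_nat n)) = 1" and I: "(INF n. f (- of_nat n)) = 0"
    and R: "(INF n. f (q + 1 / of_nat (Suc n))) = f q" for q
    using f by (auto simp: cdf_like_def)
  have le1: "f q \<le> 1" for q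
  proof -
    obtain n :: nat where "q \<le> of_nat n" using real_arch_simple[of q] by blast
    then have "f q \<le> f (of_nat n)" by (rule mono)
    also have "\<dots> \<le> 1" unfolding S[symmetric] by (rule SUP_upper) simp
    finally show ?thesis .
  qed
  define c where "c t = (INF q\<in>{q. t < of_rat q}. f q)" for t :: real
  have c_le: "c t \<le> f q" if "t < of_rat q" for t q unfolding c_def using that by (intro INF_lower) auto
  have c_ge: "f q \<le> c t" if "of_rat q \<le> t" for t q
    unfolding c_def
  proof (intro INF_greatest mono)
    fix i :: rat assume "i \<in> {q. t < of_rat q}"
    with that have "(of_rat q :: real) \<le> of_rat i" by auto
    then show "q \<le> i" by (simp only: of_rat_less_eq)
  qed
  have c1: "c t \<le> 1" for t
  proof -
    obtain q where "t < of_rat q" using of_rat_dense[of t "t+1"] by auto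
    then show ?thesis using c_le[of t q] le1[of q] by (meson order_trans)
  qed
  have cm: "s \<le> t \<Longrightarrow> c s \<le> c t" for s t unfolding c_def by (rule INF_superset_mono) auto
  have fin: "c t < top" for t using c1[of t] by (rule order.strict_trans1) simp
  have cq: "c (of_rat q) = f q" for q
  proof (rule antisym)
    show "c (of_rat q) \<le> f q"
      unfolding R[of q, symmetric] by (intro INF_greatest c_le) (simp add: of_rat_less)
  qed (rule c_ge, simp)
  have real_cdf: "real_cdf f = (\<lambda>t. enn2real (c t))" by (simp add: real_cdf_def c_def fun_eq_iff)
  have t_right: "(c \<longlongrightarrow> c a) (at_right a)" for a
  proof (rule order_tendstoI)
    fix l assume "l < c a"
    then have "\<And>t. a < t \<Longrightarrow> l < c t" using cm less_imp_le order.strict_trans2 by metis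
    then show "\<forall>\<^sub>F t in at_right a. l < c t" by (auto simp: eventually_at_filter)
  next
    fix u assume "c a < u"
    then obtain q where q: "a < of_rat q" "f q < u" unfolding c_def by (auto simp: INF_less_iff)
    have "c t < u" if "t < of_rat q" for t using c_le[OF that] q(2) by (rule order.strict_trans1)
    then show "\<forall>\<^sub>F t in at_right a. c t < u"
      using eventually_at_right_less[of a] q(1) by (auto simp: eventually_at_right)
  qed
  have t_top: "(c \<longlongrightarrow> 1) at_top"
  proof (rule order_tendstoI)
    fix l :: ennreal assume "l < 1"
    then obtain n where n: "l < f (of_nat n)" unfolding S[symmetric] by (auto simp: less_SUP_iff)
    have "l < c t" if "real n \<le> t" for t
    proof -
      have "f (of_nat n) \<le> c t" using that by (intro c_ge) simp
      with n show ?thesis by (rule order.strict_trans2)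
    qed
    then show "\<forall>\<^sub>F t in at_top. l < c t" by (rule eventually_at_top_linorderI)
  next
    fix u :: ennreal assume "1 < u"
    then show "\<forall>\<^sub>F t in at_top. c t < u" 
      by (intro always_eventually allI) (rule order.strict_trans1[OF c1])
  qed
  have t_bot: "(c \<longlongrightarrow> 0) at_bot"
  proof (rule order_tendstoI)
    fix u :: ennreal assume "0 < u"
    then obtain n where n: "f (- of_nat n) < u" unfolding I[symmetric] by (auto simp: INF_less_iff)
    have "c t < u" if "t \<le> - real n - 1" for t
    proof -
      have "c t \<le> f (- of_nat n)" using that by (intro c_le) (simp add: of_rat_minus)
      then show ?thesis using n by (rule order.strict_trans1)
    qed
    then show "\<forall>\<^sub>F t in at_bot. c t < u" unfolding eventually_at_bot_linorder by blast
  qed simp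
  have m': "real_cdf f s \<le> real_cdf f t" if "s \<le> t" for s t
    unfolding real_cdf using cm[OF that] fin by (intro enn2real_mono) auto
  have rc: "continuous (at_right a) (real_cdf f)" for a
    unfolding continuous_within real_cdf
    by (rule tendsto_enn2real) (simp_all only: ennreal_enn2real[OF fin] t_right enn2real_nonneg)
  have lb: "(real_cdf f \<longlongrightarrow> 0) at_bot"
    unfolding real_cdf by (rule tendsto_enn2real) (use t_bot in simp_all)
  have lt: "(real_cdf f \<longlongrightarrow> 1) at_top"
    unfolding real_cdf by (rule tendsto_enn2real) (use t_top in simp_all)
  show "real_distribution (interval_measure (real_cdf f))"
    by (rule real_distribution_interval_measure[OF m' rc lb lt])
  have "emeasure (interval_measure (real_cdf f)) {..of_rat q} = ennreal (real_cdf f (of_rat q))"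
    by (rule emeasure_interval_measure_Iic[OF m' rc lb])
  also have "\<dots> = f q" using ennreal_enn2real[OF fin, of "of_rat q"] unfolding real_cdf cq .
  finally show "emeasure (interval_measure (real_cdf f)) {..of_rat q} = f q" .
qed

text \<open>
  On the exceptional null set the kernel is a Dirac measure. The half-lines with rational end points
  generate the Borel sets, so that measurability of the kernel and the rectangle identity need to be checked only for them.
\<close>

lemma real_disintegration:
  fixes X :: "'x measure" and \<mu> :: "('x \<times> real) measure"
  assumes fin: "finite_measure \<mu>" and sets_\<mu>: "sets \<mu> = sets (X \<Otimes>\<^sub>M borel)"
  shows "\<exists>\<kappa>\<in>X \<rightarrow>\<^sub>M prob_algebra borel. has_cond_law \<mu> X borel fst snd \<kappa>"
proof -
  interpret \<mu>: finite_measure \<mu> by fact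
  note [measurable_cong] = sets_\<mu>
  have [measurable]: "fst \<in> \<mu> \<rightarrow>\<^sub>M X" "snd \<in> \<mu> \<rightarrow>\<^sub>M borel"
    unfolding measurable_cong_sets[OF sets_\<mu> refl] by simp_all
  let ?f = "\<lambda>x q. rat_cdf X \<mu> q x"
  let ?m = "distr \<mu> X fst"
  have f[measurable]: "(\<lambda>x. ?f x q) \<in> borel_measurable X" for q
    unfolding rat_cdf_def[OF fin sets_\<mu>] using cond_density_measurable[OF fin sets_\<mu>] by simp
  have [measurable]: "Measurable.pred X (\<lambda>x. cdf_like (?f x))"
    unfolding cdf_like_def by measurable
  define \<kappa> where "\<kappa> x = (if cdf_like (?f x) then interval_measure (real_cdf (?f x)) else return borel 0)" for x
  have \<kappa>: "\<kappa> \<in> X \<rightarrow>\<^sub>M prob_algebra borel"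
  proof (rule measurable_prob_algebra_generated[OF sets_borel_eq_rat_atMost])
    show "Int_stable (range (\<lambda>q::rat. {..of_rat q :: real}))" by (rule Int_stable_rat_atMost)
    show "prob_space (\<kappa> x)" "sets (\<kappa> x) = sets borel" for x
      using real_cdf_distribution(1)[of "?f x"]
      by (auto simp: \<kappa>_def real_distribution_def real_distribution_axioms_def intro: prob_space_return)
    fix E assume "E \<in> range (\<lambda>q::rat. {..of_rat q :: real})"
    then obtain q :: rat where E: "E = {..of_rat q}" by auto
    have "(\<lambda>x. emeasure (\<kappa> x) E) = (\<lambda>x. if cdf_like (?f x) then ?f x q else indicator E 0)"
      unfolding E by (auto simp: \<kappa>_def fun_eq_iff real_cdf_distribution(2))
    then show "(\<lambda>x. emeasure (\<kappa> x) E) \<in> borel_measurable X" by simp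
  qed auto
  have [measurable]: "\<kappa> \<in> X \<rightarrow>\<^sub>M subprob_algebra borel" using \<kappa> by (rule measurable_prob_algebraD)
  have "has_cond_law \<mu> X borel fst snd \<kappa>"
    unfolding has_cond_law_def
  proof (intro ballI)
    fix D E assume D[measurable]: "D \<in> sets X" and E[measurable]: "E \<in> sets (borel :: real measure)"
    let ?N1 = "distr (density \<mu> (\<lambda>z. indicator D (fst z))) borel snd"
    let ?N2 = "density \<mu> (\<lambda>z. indicator D (fst z)) \<bind> (\<lambda>z. \<kappa> (fst z))"
    have ne: "space \<mu> \<noteq> {} \<or> D = {}" using sets.sets_into_space[OF D] sets_eq_imp_space_eq[OF sets_\<mu>] by (auto simp: space_pair_measure)
    show "emeasure \<mu> {z \<in> space \<mu>. fst z \<in> D \<and> snd z \<in> E} = (\<integral>\<^sup>+z. indicator D (fst z) * emeasure (\<kappa> (fst z)) E \<partial>\<mu>)"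
    proof (cases "D = {}")
      case False
      with ne have ne: "space \<mu> \<noteq> {}" by simp
      have \<kappa>D: "(\<lambda>z. \<kappa> (fst z)) \<in> density \<mu> (\<lambda>z. indicator D (fst z)) \<rightarrow>\<^sub>M subprob_algebra borel"
      proof -
        have "(\<lambda>z. \<kappa> (fst z)) \<in> \<mu> \<rightarrow>\<^sub>M subprob_algebra borel"
          unfolding measurable_cong_sets[OF sets_\<mu> refl]
          by (rule measurable_compose[OF measurable_fst measurable_prob_algebraD[OF \<kappa>]])
        then show ?thesis by (simp cong: measurable_cong_sets)
      qed
      have 1: "emeasure ?N1 E = emeasure \<mu> {z \<in> space \<mu>. fst z \<in> D \<and> snd z \<in> E}" if [measurable]: "E \<in> sets borel" for E
      proof -
        have "emeasure ?N1 E = (\<integral>\<^sup>+z. indicator D (fst z) * indicator (snd -` E \<inter> space \<mu>) z \<partial>\<mu>)"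
          by (subst emeasure_distr) (auto simp: emeasure_density)
        also have "\<dots> = (\<integral>\<^sup>+z. indicator {z \<in> space \<mu>. fst z \<in> D \<and> snd z \<in> E} z \<partial>\<mu>)"
          by (rule nn_integral_cong) (auto simp: indicator_def)
        finally show ?thesis by simp
      qed
      have 2: "emeasure ?N2 E = (\<integral>\<^sup>+z. indicator D (fst z) * emeasure (\<kappa> (fst z)) E \<partial>\<mu>)" if [measurable]: "E \<in> sets borel" for E
        using ne by (subst emeasure_bind[OF _ \<kappa>D]) (auto simp: nn_integral_density)
      have s: "sets ?N1 = sigma_sets UNIV (range (\<lambda>q::rat. {..of_rat q}))" "sets ?N2 = sigma_sets UNIV (range (\<lambda>q::rat. {..of_rat q}))"
      proof -
        have "sets ?N2 = sets borel" by (rule sets_bind) (rule sets_kernel[OF \<kappa>D], simp_all add: ne)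
        then show "sets ?N1 = sigma_sets UNIV (range (\<lambda>q::rat. {..of_rat q}))" "sets ?N2 = sigma_sets UNIV (range (\<lambda>q::rat. {..of_rat q}))"
          by (simp_all add: sets_borel_eq_rat_atMost)
      qed
      have "?N1 = ?N2"
      proof (rule measure_eqI_generator_eq[OF _ _ _ s])
        show "Int_stable (range (\<lambda>q::rat. {..of_rat q :: real}))" by (rule Int_stable_rat_atMost)
        show "range (\<lambda>n::nat. {..of_rat (of_nat n) :: real}) \<subseteq> range (\<lambda>q::rat. {..of_rat q})"
          by (intro image_subsetI rangeI)
        show "(\<Union>n::nat. {..of_rat (of_nat n) :: real}) = UNIV" by (auto intro: real_arch_simple)
        show "emeasure ?N1 {..of_rat (of_nat n)} \<noteq> \<infinity>" for n :: nat
          by (subst 1) (auto simp: \<mu>.emeasure_finite)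
        fix E assume "E \<in> range (\<lambda>q::rat. {..of_rat q :: real})"
        then obtain q :: rat where E: "E = {..of_rat q}" by auto
        then have [measurable]: "E \<in> sets borel" by simp
        have "emeasure ?N2 E = (\<integral>\<^sup>+x. emeasure (\<kappa> x) E * indicator D x \<partial>?m)"
          by (subst 2) (auto simp: nn_integral_distr mult.commute)
        also have "\<dots> = (\<integral>\<^sup>+x. ?f x q * indicator D x \<partial>?m)"
        proof (rule nn_integral_cong_AE)
          show "AE x in ?m. emeasure (\<kappa> x) E * indicator D x = ?f x q * indicator D x"
            using AE_cdf_like[OF fin sets_\<mu>] by eventually_elim (simp add: \<kappa>_def E real_cdf_distribution(2))
        qed
        also have "\<dots> = emeasure \<mu> (D \<times> E)"
          unfolding rat_cdf_def[OF fin sets_\<mu>] E by (rule nn_integral_cond_density[OF fin sets_\<mu>]) auto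
        also have "\<dots> = emeasure ?N1 E"
          using sets.sets_into_space[OF D] sets_eq_imp_space_eq[OF sets_\<mu>]
          by (subst 1) (auto simp: space_pair_measure intro!: arg_cong[where f="emeasure \<mu>"])
        finally show "emeasure ?N1 E = emeasure ?N2 E" by simp
      qed auto
      then show ?thesis using 1[OF E] 2[OF E] by simp
    qed simp
  qed
  with \<kappa> show ?thesis by blast
qed

text \<open>
  With \<open>\<psi> \<circ> s = id\<close>, transport \<open>\<mu>\<close> to \<open>\<real>\<close> by \<open>s\<close>, disintegrate, and push the kernel back by \<open>\<psi>\<close>.
\<close>

lemma polish_disintegration:
  fixes X :: "'x measure" and A :: "'a::polish_space set" and \<mu> :: "('x \<times> 'a) measure"
  assumes fin: "finite_measure \<mu>" and sets_\<mu>: "sets \<mu> = sets (X \<Otimes>\<^sub>M restrict_space borel A)" and A: "A \<in> sets borel" "A \<noteq> {}"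
  shows "\<exists>\<kappa>\<in>X \<rightarrow>\<^sub>M prob_algebra (restrict_space borel A). has_cond_law \<mu> X (restrict_space borel A) fst snd \<kappa>"
proof -
  obtain s :: "'a \<Rightarrow> real" and \<psi>0 where s[measurable]: "s \<in> borel_measurable borel" and \<psi>0[measurable]: "\<psi>0 \<in> borel_measurable borel" and inv: "\<And>a. \<psi>0 (s a) = a"
    using polish_real_retract by blast
  obtain a0 where a0: "a0 \<in> A" using A by auto
  define \<psi> where "\<psi> r = (if \<psi>0 r \<in> A then \<psi>0 r else a0)" for r
  let ?AS = "restrict_space borel A"
  note [measurable] = A(1)
  have \<psi>[measurable]: "\<psi> \<in> borel \<rightarrow>\<^sub>M ?AS"
    by (rule measurable_restrict_space2) (auto simp: \<psi>_def[abs_def] a0)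
  have s'[measurable]: "s \<in> ?AS \<rightarrow>\<^sub>M borel" by (rule measurable_restrict_space1) measurable
  have \<psi>s: "\<psi> (s a) = a" if "a \<in> A" for a using that by (simp add: \<psi>_def inv)
  note [measurable_cong] = sets_\<mu>
  let ?\<mu> = "distr \<mu> (X \<Otimes>\<^sub>M borel) (\<lambda>z. (fst z, s (snd z)))"
  have sp: "space \<mu> = space X \<times> A" using sets_eq_imp_space_eq[OF sets_\<mu>] by (simp add: space_pair_measure space_restrict_space)
  interpret \<mu>: finite_measure \<mu> by fact
  have m: "(\<lambda>z. (fst z, s (snd z))) \<in> \<mu> \<rightarrow>\<^sub>M X \<Otimes>\<^sub>M borel"
    unfolding measurable_cong_sets[OF sets_\<mu> refl]
    by (intro measurable_Pair measurable_fst measurable_compose[OF measurable_snd s'])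
  note [measurable] = m
  have "finite_measure ?\<mu>" by (rule \<mu>.finite_measure_distr[OF m])
  then have "\<exists>\<kappa>\<in>X \<rightarrow>\<^sub>M prob_algebra borel. has_cond_law ?\<mu> X borel fst snd \<kappa>"
    by (rule real_disintegration) simp
  then obtain \<kappa> where \<kappa>[measurable]: "\<kappa> \<in> X \<rightarrow>\<^sub>M prob_algebra borel" and h: "has_cond_law ?\<mu> X borel fst snd \<kappa>"
    by blast
  have [measurable]: "\<kappa> \<in> X \<rightarrow>\<^sub>M subprob_algebra borel" using \<kappa> by (rule measurable_prob_algebraD)
  let ?\<sigma> = "\<lambda>x. distr (\<kappa> x) ?AS \<psi>"
  have "?\<sigma> \<in> X \<rightarrow>\<^sub>M prob_algebra ?AS" by measurable
  moreover have "has_cond_law \<mu> X ?AS fst snd ?\<sigma>"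
    unfolding has_cond_law_def
  proof (intro ballI)
    fix D C assume D[measurable]: "D \<in> sets X" and C[measurable]: "C \<in> sets ?AS"
    let ?C = "\<psi> -` C \<inter> space borel"
    have C'[measurable]: "?C \<in> sets borel" by measurable
    have "emeasure \<mu> {z \<in> space \<mu>. fst z \<in> D \<and> snd z \<in> C} = emeasure ?\<mu> {z \<in> space ?\<mu>. fst z \<in> D \<and> snd z \<in> ?C}"
      by (subst emeasure_distr) (auto simp: sp space_pair_measure \<psi>s intro!: arg_cong[where f="emeasure \<mu>"])
    also have "\<dots> = (\<integral>\<^sup>+z. indicator D (fst z) * emeasure (\<kappa> (fst z)) ?C \<partial>?\<mu>)"
      using h D C' unfolding has_cond_law_def by blast
    also have "\<dots> = (\<integral>\<^sup>+z. indicator D (fst z) * emeasure (\<kappa> (fst z)) ?C \<partial>\<mu>)"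
    proof -
      have "(\<lambda>z. indicator D (fst z) * emeasure (\<kappa> (fst z)) ?C) \<in> borel_measurable (X \<Otimes>\<^sub>M borel)"
        using C' by measurable
      then show ?thesis by (subst nn_integral_distr[OF m]) simp_all
    qed
    also have "\<dots> = (\<integral>\<^sup>+z. indicator D (fst z) * emeasure (?\<sigma> (fst z)) C \<partial>\<mu>)"
    proof (rule nn_integral_cong)
      fix z assume "z \<in> space \<mu>"
      then have z: "fst z \<in> space X" by (auto simp: sp)
      note k = sets_kernel_prob[OF \<kappa> z]
      have "emeasure (?\<sigma> (fst z)) C = emeasure (\<kappa> (fst z)) ?C"
        using k by (subst emeasure_distr) (auto cong: measurable_cong_sets)
      then show "indicator D (fst z) * emeasure (\<kappa> (fst z)) ?C = indicator D (fst z) * emeasure (?\<sigma> (fst z)) C" by simp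
    qed
    finally show "emeasure \<mu> {z \<in> space \<mu>. fst z \<in> D \<and> snd z \<in> C} = (\<integral>\<^sup>+z. indicator D (fst z) * emeasure (?\<sigma> (fst z)) C \<partial>\<mu>)" .
  qed
  ultimately show ?thesis by blast
qed

section \<open>Laws of states and actions, and occupation measures\<close>

lemma countably_additive_suminf_measures:
  fixes M :: "nat \<Rightarrow> 'b measure"
  assumes "\<And>k. sets (M k) = sets N"
  shows "countably_additive (sets N) (\<lambda>B. \<Sum>k. c k * emeasure (M k) B)"
proof (rule countably_additiveI)
  fix E :: "nat \<Rightarrow> 'b set" assume E: "range E \<subseteq> sets N" "disjoint_family E" "\<Union>(range E) \<in> sets N"
  have "(\<Sum>i. \<Sum>k. c k * emeasure (M k) (E i)) = (\<Sum>i. \<integral>\<^sup>+k. c k * emeasure (M k) (E i) \<partial>count_space UNIV)"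
    by (simp add: nn_integral_count_space_nat)
  also have "\<dots> = (\<integral>\<^sup>+k. (\<Sum>i. c k * emeasure (M k) (E i)) \<partial>count_space UNIV)"
    by (rule nn_integral_suminf[symmetric]) simp
  also have "\<dots> = (\<integral>\<^sup>+k. c k * emeasure (M k) (\<Union>(range E)) \<partial>count_space UNIV)"
    using E by (intro nn_integral_cong) (simp add: assms suminf_emeasure)
  finally show "(\<Sum>i. \<Sum>k. c k * emeasure (M k) (E i)) = (\<Sum>k. c k * emeasure (M k) (\<Union>(range E)))"
    by (simp add: nn_integral_count_space_nat)
qed

lemma emeasure_measure_of_suminf:
  fixes M :: "nat \<Rightarrow> 'b measure"
  assumes M: "\<And>k. sets (M k) = sets N" and B: "B \<in> sets N"
    and f: "\<And>B. B \<in> sets N \<Longrightarrow> f B = (\<Sum>k. c k * emeasure (M k) B)"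
  shows "emeasure (measure_of (space N) (sets N) f) B = f B"
proof (rule emeasure_measure_of_sigma[OF sets.sigma_algebra_axioms _ _ B])
  show "positive (sets N) f" by (simp add: positive_def f)
  have "countably_additive (sets N) f \<longleftrightarrow> countably_additive (sets N) (\<lambda>B. \<Sum>k. c k * emeasure (M k) B)"
    unfolding countably_additive_def by (auto simp: f subset_eq cong: suminf_cong)
  then show "countably_additive (sets N) f" by (simp add: countably_additive_suminf_measures[OF M])
qed

text \<open>
  Used for the occupation measure, a sum over time, and for the right-hand side of the characteristic
  equation, a sum of two measures.
\<close>

lemma nn_integral_suminf_measure:
  fixes M :: "nat \<Rightarrow> 'b measure"
  assumes M: "\<And>k. sets (M k) = sets N"
    and eq: "\<And>B. B \<in> sets N \<Longrightarrow> emeasure N B = (\<Sum>k. emeasure (M k) B)"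
    and g: "g \<in> borel_measurable N"
  shows "(\<integral>\<^sup>+z. g z \<partial>N) = (\<Sum>k. \<integral>\<^sup>+z. g z \<partial>M k)"
  using g
proof (induction rule: borel_measurable_induct)
  case (cong f g)
  have sp: "space (M k) = space N" for k using M by (rule sets_eq_imp_space_eq)
  have "(\<integral>\<^sup>+z. g z \<partial>N) = (\<integral>\<^sup>+z. f z \<partial>N)" using cong by (intro nn_integral_cong) auto
  moreover have "(\<integral>\<^sup>+z. g z \<partial>M k) = (\<integral>\<^sup>+z. f z \<partial>M k)" for k using cong by (intro nn_integral_cong) (auto simp: sp)
  ultimately show ?case using cong by simp
next
  case (set B)
  then show ?case by (simp add: eq M)
next
  case (mult u c)
  have [measurable]: "u \<in> borel_measurable (M k)" for k using mult by (simp cong: measurable_cong_sets add: M)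
  show ?case using mult by (simp add: nn_integral_cmult)
next
  case (add u v)
  have [measurable]: "u \<in> borel_measurable (M k)" "v \<in> borel_measurable (M k)" for k
    using add by (simp_all cong: measurable_cong_sets add: M)
  show ?case using add by (simp add: nn_integral_add suminf_add[symmetric])
next
  case (seq U)
  have [measurable]: "U i \<in> borel_measurable (M k)" for k i
    using seq by (simp_all cong: measurable_cong_sets add: M)
  have "(\<integral>\<^sup>+z. (SUP i. U i) z \<partial>N) = (SUP i. \<integral>\<^sup>+z. U i z \<partial>N)"
    unfolding SUP_apply using seq by (intro nn_integral_monotone_convergence_SUP)
  also have "\<dots> = (SUP i. \<integral>\<^sup>+k. \<integral>\<^sup>+z. U i z \<partial>M k \<partial>count_space UNIV)"
    using seq by (simp add: nn_integral_count_space_nat)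
  also have "\<dots> = (\<integral>\<^sup>+k. (SUP i. \<integral>\<^sup>+z. U i z \<partial>M k) \<partial>count_space UNIV)"
    using seq by (intro nn_integral_monotone_convergence_SUP[symmetric])
      (auto simp: incseq_def le_fun_def intro!: nn_integral_mono)
  also have "\<dots> = (\<integral>\<^sup>+k. (\<integral>\<^sup>+z. (SUP i. U i) z \<partial>M k) \<partial>count_space UNIV)"
    unfolding SUP_apply using seq by (intro nn_integral_cong nn_integral_monotone_convergence_SUP[symmetric]) auto
  finally show ?case by (simp add: nn_integral_count_space_nat)
qed

lemma enat_less_hitting_time_iff: "enat t < hitting_time \<Delta> \<omega> \<longleftrightarrow> (\<forall>s\<le>t. fst (\<omega> s) \<notin> \<Delta>)"
proof
  assume h: "enat t < hitting_time \<Delta> \<omega>"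
  show "\<forall>s\<le>t. fst (\<omega> s) \<notin> \<Delta>"
  proof (intro allI impI notI)
    fix s assume "s \<le> t" "fst (\<omega> s) \<in> \<Delta>"
    then have "hitting_time \<Delta> \<omega> \<le> enat s" unfolding hitting_time_def by (intro Inf_lower) auto
    also have "\<dots> \<le> enat t" using \<open>s \<le> t\<close> by simp
    finally show False using h by simp
  qed
next
  assume h: "\<forall>s\<le>t. fst (\<omega> s) \<notin> \<Delta>"
  then have "enat (Suc t) \<le> hitting_time \<Delta> \<omega>"
    unfolding hitting_time_def by (intro Inf_greatest) (auto simp: not_less_eq_eq[symmetric])
  then show "enat t < hitting_time \<Delta> \<omega>"
    by (rule order.strict_trans2[rotated]) simp
qed

lemma ennreal_of_enat_eq_suminf: "ennreal_of_enat T = (\<Sum>t. if enat t < T then 1 else 0)"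
proof (cases T)
  case (enat n)
  have "(\<Sum>t. if enat t < T then 1 else 0 :: ennreal) = (\<Sum>t<n. if enat t < T then 1 else 0)"
    by (rule suminf_finite) (auto simp: enat)
  then show ?thesis by (simp add: enat)
next
  case infinity
  have "(\<Sum>t::nat. 1::ennreal) = \<infinity>"
    by (simp add: nn_integral_count_space_nat[symmetric])
  then show ?thesis by (simp add: infinity)
qed

context control_model
begin

definition pair_law :: "(nat \<Rightarrow> (nat \<Rightarrow> 'x \<times> 'a) \<times> 'x \<Rightarrow> 'a measure) \<Rightarrow> nat \<Rightarrow> ('x \<times> 'a) measure" where
  "pair_law \<pi> t = distr (policy_law X A Q \<eta> \<pi>) SA (\<lambda>\<omega>. \<omega> t)"

definition state_law :: "(nat \<Rightarrow> (nat \<Rightarrow> 'x \<times> 'a) \<times> 'x \<Rightarrow> 'a measure) \<Rightarrow> nat \<Rightarrow> 'x measure" where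
  "state_law \<pi> t = distr (policy_law X A Q \<eta> \<pi>) X (\<lambda>\<omega>. fst (\<omega> t))"

lemma sets_pair_law[simp, measurable_cong]: "sets (pair_law \<pi> t) = sets SA"
  by (simp add: pair_law_def)
lemma sets_state_law[simp, measurable_cong]: "sets (state_law \<pi> t) = sets X"
  by (simp add: state_law_def)
lemma space_pair_law[simp]: "space (pair_law \<pi> t) = space SA"
  by (simp add: pair_law_def)
lemma space_state_law[simp]: "space (state_law \<pi> t) = space X"
  by (simp add: state_law_def)
lemma space_AS[simp]: "space AS = A" by (simp add: space_restrict_space)

lemma Q_kernel: 
  assumes "z \<in> space SA" 
  shows "prob_space (Q z)" "sets (Q z) = sets X" "space (Q z) = space X"
  using sets_kernel_prob[OF transition_kernel assms] by auto

lemma Q_sub[measurable]: "Q \<in> SA \<rightarrow>\<^sub>M subprob_algebra X"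
  by (rule measurable_prob_algebraD) (rule transition_kernel)

context
  fixes \<pi> assumes \<pi>: "\<pi> \<in> policies X A Ad"
begin

abbreviation (input) "P \<equiv> policy_law X A Q \<eta> \<pi>"

lemma policy_law_props:
  shows law_prob: "prob_space P" and law_sets[measurable_cong]: "sets P = sets (trajectories X A)"
    and law_init: "distr P X (\<lambda>\<omega>. fst (\<omega> 0)) = \<eta>"
    and law_action: "has_cond_law P (histories X A n) AS (history n) (\<lambda>\<omega>. snd (\<omega> n)) (\<pi> n)"
    and law_state: "has_cond_law P (histories X A n \<Otimes>\<^sub>M AS) X (\<lambda>\<omega>. (history n \<omega>, snd (\<omega> n))) (\<lambda>\<omega>. fst (\<omega> (Suc n))) Qstep"
  using is_policy_law_policy_law[OF \<pi> initial_distribution] unfolding is_policy_law_iff[OF \<pi>]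
  by (auto simp: prob_measures_def)

lemma law_measurable[measurable]: "(\<lambda>\<omega>. \<omega> t) \<in> P \<rightarrow>\<^sub>M SA" "history t \<in> P \<rightarrow>\<^sub>M histories X A t"
  using measurable_traj_component[of t X A] measurable_history[of t X A] law_sets by (simp_all cong: measurable_cong_sets)

lemma state_law_0: "state_law \<pi> 0 = \<eta>"
  unfolding state_law_def by (rule law_init)

lemma prob_state_law: "prob_space (state_law \<pi> t)"
  unfolding state_law_def by (rule prob_space.prob_space_distr[OF law_prob]) measurable

lemma nn_integral_pair_law: "g \<in> borel_measurable SA \<Longrightarrow> (\<integral>\<^sup>+z. g z \<partial>pair_law \<pi> t) = (\<integral>\<^sup>+\<omega>. g (\<omega> t) \<partial>P)"
  unfolding pair_law_def by (rule nn_integral_distr) measurable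

lemma nn_integral_state_law: "g \<in> borel_measurable X \<Longrightarrow> (\<integral>\<^sup>+x. g x \<partial>state_law \<pi> t) = (\<integral>\<^sup>+\<omega>. g (fst (\<omega> t)) \<partial>P)"
  unfolding state_law_def by (rule nn_integral_distr) measurable

lemma nn_integral_transition:
  assumes g[measurable]: "g \<in> borel_measurable (SA \<Otimes>\<^sub>M X)"
  shows "(\<integral>\<^sup>+\<omega>. g (\<omega> t, fst (\<omega> (Suc t))) \<partial>P) = (\<integral>\<^sup>+z. \<integral>\<^sup>+y. g (z, y) \<partial>Q z \<partial>pair_law \<pi> t)"
proof -
  let ?g = "\<lambda>(((h, x), a), y). g ((x, a), y)"
  have m: "?g \<in> borel_measurable ((histories X A t \<Otimes>\<^sub>M AS) \<Otimes>\<^sub>M X)"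
    unfolding split_beta' histories_def by measurable
  have [measurable]: "(\<lambda>z. \<integral>\<^sup>+y. g (z, y) \<partial>Q z) \<in> borel_measurable SA"
    by (rule nn_integral_measurable_subprob_algebra2[where N=X]) measurable
  have "(\<integral>\<^sup>+\<omega>. g (\<omega> t, fst (\<omega> (Suc t))) \<partial>P) = (\<integral>\<^sup>+\<omega>. ?g ((history t \<omega>, snd (\<omega> t)), fst (\<omega> (Suc t))) \<partial>P)"
    by (simp add: history_def)
  also have "\<dots> = (\<integral>\<^sup>+\<omega>. \<integral>\<^sup>+y. ?g ((history t \<omega>, snd (\<omega> t)), y) \<partial>Qstep (history t \<omega>, snd (\<omega> t)) \<partial>P)"
    by (rule nn_integral_cond_law[OF prob_space.finite_measure[OF law_prob] prob_space.not_empty[OF law_prob] _ _ Qstep_measurable law_state m]) measurable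
  also have "\<dots> = (\<integral>\<^sup>+\<omega>. \<integral>\<^sup>+y. g (\<omega> t, y) \<partial>Q (\<omega> t) \<partial>P)"
    by (simp add: history_def Qstep_def)
  also have "\<dots> = (\<integral>\<^sup>+z. \<integral>\<^sup>+y. g (z, y) \<partial>Q z \<partial>pair_law \<pi> t)"
    by (rule nn_integral_pair_law[symmetric]) measurable
  finally show ?thesis .
qed

lemma emeasure_state_law_Suc:
  assumes B[measurable]: "B \<in> sets X"
  shows "emeasure (state_law \<pi> (Suc t)) B = (\<integral>\<^sup>+z. emeasure (Q z) B \<partial>pair_law \<pi> t)"
proof -
  have "emeasure (state_law \<pi> (Suc t)) B = (\<integral>\<^sup>+x. indicator B x \<partial>state_law \<pi> (Suc t))" by simp
  also have "\<dots> = (\<integral>\<^sup>+\<omega>. indicator B (snd (\<omega> t, fst (\<omega> (Suc t)))) \<partial>P)"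
    by (subst nn_integral_state_law) auto
  also have "\<dots> = (\<integral>\<^sup>+z. \<integral>\<^sup>+y. indicator B (snd (z, y)) \<partial>Q z \<partial>pair_law \<pi> t)"
    by (rule nn_integral_transition) measurable
  also have "\<dots> = (\<integral>\<^sup>+z. emeasure (Q z) B \<partial>pair_law \<pi> t)"
    by (rule nn_integral_cong) (simp add: Q_kernel)
  finally show ?thesis .
qed

text \<open>
  The action is drawn from a kernel that gives full mass to the available actions.
\<close>

lemma pair_law_feasible: "emeasure (pair_law \<pi> t) (space SA - feasible_pairs X Ad) = 0"
proof -
  let ?N = "space SA - feasible_pairs X Ad"
  have N[measurable]: "?N \<in> sets SA" using feasible_measurable by simp
  let ?g = "\<lambda>((h, x), a). indicator ?N (x, a) :: ennreal"
  have m: "?g \<in> borel_measurable (histories X A t \<Otimes>\<^sub>M AS)"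
    unfolding split_beta' histories_def by measurable
  have "emeasure (pair_law \<pi> t) ?N = (\<integral>\<^sup>+z. indicator ?N z \<partial>pair_law \<pi> t)" by simp
  also have "\<dots> = (\<integral>\<^sup>+\<omega>. ?g (history t \<omega>, snd (\<omega> t)) \<partial>P)"
    by (subst nn_integral_pair_law) (auto simp: history_def)
  also have "\<dots> = (\<integral>\<^sup>+\<omega>. \<integral>\<^sup>+a. ?g (history t \<omega>, a) \<partial>\<pi> t (history t \<omega>) \<partial>P)"
    by (rule nn_integral_cond_law[OF prob_space.finite_measure[OF law_prob] prob_space.not_empty[OF law_prob] _ _ policyD[OF \<pi>] law_action m]) measurable
  also have "\<dots> = (\<integral>\<^sup>+\<omega>. 0 \<partial>P)"
  proof (rule nn_integral_cong)
    fix \<omega> assume \<omega>: "\<omega> \<in> space P"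
    let ?x = "fst (\<omega> t)" and ?K = "\<pi> t (history t \<omega>)"
    have h: "history t \<omega> \<in> space (histories X A t)" using measurable_space[OF law_measurable(2) \<omega>] .
    have x: "?x \<in> space X" using measurable_space[OF law_measurable(1)[of t] \<omega>] by (auto simp: space_pair_measure)
    interpret K: prob_space ?K using sets_kernel_prob(3)[OF policyD[OF \<pi>] h] .
    have s: "sets ?K = sets AS" "space ?K = A" using sets_kernel_prob(1,2)[OF policyD[OF \<pi>] h] by auto
    have "measure ?K (Ad ?x) = 1" using \<pi> h by (auto simp: policies_def history_def)
    then have "AE a in ?K. a \<in> Ad ?x"
      using available_measurable[OF x] by (subst (asm) K.prob_eq_1) (auto simp: s)
    then have "AE a in ?K. ?g (history t \<omega>, a) = 0"
      by eventually_elim (auto simp: history_def feasible_pairs_def x)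
    then have "(\<integral>\<^sup>+a. ?g (history t \<omega>, a) \<partial>?K) = (\<integral>\<^sup>+a. 0 \<partial>?K)" by (rule nn_integral_cong_AE)
    then show "(\<integral>\<^sup>+a. ?g (history t \<omega>, a) \<partial>?K) = 0" by simp
  qed
  finally show ?thesis by simp
qed

lemma nn_integral_pair_law_markov:
  assumes \<sigma>: "\<sigma> \<in> markov_kernels X A Ad" and eq: "\<And>h x. x \<in> space X \<Longrightarrow> \<pi> t (h, x) = \<sigma> x"
    and g[measurable]: "g \<in> borel_measurable SA"
  shows "(\<integral>\<^sup>+z. g z \<partial>pair_law \<pi> t) = (\<integral>\<^sup>+x. \<integral>\<^sup>+a. g (x, a) \<partial>\<sigma> x \<partial>state_law \<pi> t)"
proof -
  have \<sigma>m[measurable]: "\<sigma> \<in> X \<rightarrow>\<^sub>M prob_algebra AS" using \<sigma> by (simp add: markov_kernels_def)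
  have [measurable]: "\<sigma> \<in> X \<rightarrow>\<^sub>M subprob_algebra AS" by (rule measurable_prob_algebraD) measurable
  let ?g = "\<lambda>((h, x), a). g (x, a) :: ennreal"
  have m: "?g \<in> borel_measurable (histories X A t \<Otimes>\<^sub>M AS)"
    unfolding split_beta' histories_def by measurable
  have [measurable]: "(\<lambda>x. \<integral>\<^sup>+a. g (x, a) \<partial>\<sigma> x) \<in> borel_measurable X"
    by (rule nn_integral_measurable_subprob_algebra2[where N=AS]) measurable
  have "(\<integral>\<^sup>+z. g z \<partial>pair_law \<pi> t) = (\<integral>\<^sup>+\<omega>. ?g (history t \<omega>, snd (\<omega> t)) \<partial>P)"
    by (subst nn_integral_pair_law) (auto simp: history_def)
  also have "\<dots> = (\<integral>\<^sup>+\<omega>. \<integral>\<^sup>+a. ?g (history t \<omega>, a) \<partial>\<pi> t (history t \<omega>) \<partial>P)"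
    by (rule nn_integral_cond_law[OF prob_space.finite_measure[OF law_prob] prob_space.not_empty[OF law_prob] _ _ policyD[OF \<pi>] law_action m]) measurable
  also have "\<dots> = (\<integral>\<^sup>+\<omega>. \<integral>\<^sup>+a. g (fst (\<omega> t), a) \<partial>\<sigma> (fst (\<omega> t)) \<partial>P)"
  proof (rule nn_integral_cong)
    fix \<omega> assume \<omega>: "\<omega> \<in> space P"
    have "fst (\<omega> t) \<in> space X" using measurable_space[OF law_measurable(1)[of t] \<omega>] by (auto simp: space_pair_measure)
    then show "(\<integral>\<^sup>+a. ?g (history t \<omega>, a) \<partial>\<pi> t (history t \<omega>)) = (\<integral>\<^sup>+a. g (fst (\<omega> t), a) \<partial>\<sigma> (fst (\<omega> t)))"
      by (simp add: history_def eq)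
  qed
  also have "\<dots> = (\<integral>\<^sup>+x. \<integral>\<^sup>+a. g (x, a) \<partial>\<sigma> x \<partial>state_law \<pi> t)"
    by (subst nn_integral_state_law) auto
  finally show ?thesis .
qed

context
  assumes absorb: "\<And>x a. x \<in> \<Delta> \<Longrightarrow> a \<in> A \<Longrightarrow> measure (Q (x, a)) \<Delta> = 1"
begin

text \<open>
  Since \<open>\<Delta>\<close> is almost surely never left, survival until \<open>t\<close> depends only on the state at time \<open>t\<close>. This turns functionals
  of the hitting time into functionals of the one-dimensional laws.
\<close>

lemma AE_absorbed: "AE \<omega> in P. enat t < hitting_time \<Delta> \<omega> \<longleftrightarrow> fst (\<omega> t) \<notin> \<Delta>"
proof -
  have step: "AE \<omega> in P. fst (\<omega> s) \<in> \<Delta> \<longrightarrow> fst (\<omega> (Suc s)) \<in> \<Delta>" for s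
  proof -
    note target_measurable[measurable]
    let ?g = "\<lambda>v. indicator \<Delta> (fst (fst v)) * indicator (space X - \<Delta>) (snd v) :: ennreal"
    have "(\<integral>\<^sup>+\<omega>. ?g (\<omega> s, fst (\<omega> (Suc s))) \<partial>P) = (\<integral>\<^sup>+z. \<integral>\<^sup>+y. ?g (z, y) \<partial>Q z \<partial>pair_law \<pi> s)"
      by (rule nn_integral_transition) measurable
    also have "\<dots> = (\<integral>\<^sup>+z. 0 \<partial>pair_law \<pi> s)"
    proof (rule nn_integral_cong)
      fix z assume "z \<in> space (pair_law \<pi> s)"
      then have z: "z \<in> space SA" by simp
      note q = Q_kernel[OF z]
      interpret q: prob_space "Q z" by (rule q)
      show "(\<integral>\<^sup>+y. ?g (z, y) \<partial>Q z) = 0"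
      proof (cases "fst z \<in> \<Delta>")
        case True
        then have "measure (Q z) \<Delta> = 1" using absorb[of "fst z" "snd z"] z by (auto simp: space_pair_measure)
        then have "AE y in Q z. y \<in> \<Delta>" using target_measurable by (subst (asm) q.prob_eq_1) (auto simp: q)
        then have "AE y in Q z. ?g (z, y) = 0" by eventually_elim simp
        then have "(\<integral>\<^sup>+y. ?g (z, y) \<partial>Q z) = (\<integral>\<^sup>+y. 0 \<partial>Q z)" by (rule nn_integral_cong_AE)
        then show ?thesis by simp
      qed simp
    qed
    finally have z: "(\<integral>\<^sup>+\<omega>. ?g (\<omega> s, fst (\<omega> (Suc s))) \<partial>P) = 0" by simp
    have m: "(\<lambda>\<omega>. ?g (\<omega> s, fst (\<omega> (Suc s)))) \<in> borel_measurable P" by measurable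
    have "AE \<omega> in P. ?g (\<omega> s, fst (\<omega> (Suc s))) = 0"
      using z unfolding nn_integral_0_iff_AE[OF m] .
    then show ?thesis
    proof (rule AE_mp, intro AE_I2 impI)
      fix \<omega> assume \<omega>: "\<omega> \<in> space P" and "?g (\<omega> s, fst (\<omega> (Suc s))) = 0" "fst (\<omega> s) \<in> \<Delta>"
      moreover have "fst (\<omega> (Suc s)) \<in> space X" using measurable_space[OF law_measurable(1)[of "Suc s"] \<omega>] by (auto simp: space_pair_measure)
      ultimately show "fst (\<omega> (Suc s)) \<in> \<Delta>" by (auto split: split_indicator_asm)
    qed
  qed
  then have "AE \<omega> in P. \<forall>s. fst (\<omega> s) \<in> \<Delta> \<longrightarrow> fst (\<omega> (Suc s)) \<in> \<Delta>" by (simp add: AE_all_countable)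
  then show ?thesis
  proof eventually_elim
    case (elim \<omega>)
    have mono: "fst (\<omega> t) \<in> \<Delta>" if "s \<le> t" "fst (\<omega> s) \<in> \<Delta>" for s t
      using that by (induction rule: dec_induct) (use elim in auto)
    show ?case unfolding enat_less_hitting_time_iff using mono by auto
  qed
qed

lemma expectation_hitting_time:
  "(\<integral>\<^sup>+\<omega>. ennreal_of_enat (hitting_time \<Delta> \<omega>) \<partial>P) = (\<Sum>t. emeasure (state_law \<pi> t) (space X - \<Delta>))"
proof -
  note target_measurable[measurable]
  have [measurable]: "Measurable.pred P (\<lambda>\<omega>. enat t < hitting_time \<Delta> \<omega>)" for t
    unfolding enat_less_hitting_time_iff by measurable
  have h: "(\<integral>\<^sup>+\<omega>. (if enat t < hitting_time \<Delta> \<omega> then 1 else 0) \<partial>P) = emeasure (state_law \<pi> t) (space X - \<Delta>)" for t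
  proof -
    have "(\<integral>\<^sup>+\<omega>. (if enat t < hitting_time \<Delta> \<omega> then 1 else 0) \<partial>P) = (\<integral>\<^sup>+\<omega>. indicator (space X - \<Delta>) (fst (\<omega> t)) \<partial>P)"
    proof (rule nn_integral_cong_AE, rule AE_mp[OF AE_absorbed[of t]], intro AE_I2 impI)
      fix \<omega> assume \<omega>: "\<omega> \<in> space P" and "(enat t < hitting_time \<Delta> \<omega>) = (fst (\<omega> t) \<notin> \<Delta>)"
      moreover have "fst (\<omega> t) \<in> space X" using measurable_space[OF law_measurable(1)[of t] \<omega>] by (auto simp: space_pair_measure)
      ultimately show "(if enat t < hitting_time \<Delta> \<omega> then 1 else 0) = indicator (space X - \<Delta>) (fst (\<omega> t))"
        by (auto split: split_indicator)
    qed
    also have "\<dots> = (\<integral>\<^sup>+x. indicator (space X - \<Delta>) x \<partial>state_law \<pi> t)" by (subst nn_integral_state_law) auto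
    finally show ?thesis by simp
  qed
  have "(\<integral>\<^sup>+\<omega>. ennreal_of_enat (hitting_time \<Delta> \<omega>) \<partial>P) = (\<Sum>t. \<integral>\<^sup>+\<omega>. (if enat t < hitting_time \<Delta> \<omega> then 1 else 0) \<partial>P)"
    unfolding ennreal_of_enat_eq_suminf by (rule nn_integral_suminf) measurable
  also have "\<dots> = (\<Sum>t. emeasure (state_law \<pi> t) (space X - \<Delta>))" by (simp only: h)
  finally show ?thesis .
qed

text \<open>
  The contribution of time \<open>t\<close> to the occupation measure.
\<close>

definition alive_law :: "nat \<Rightarrow> ('x \<times> 'a) measure" where
  "alive_law t = density (pair_law \<pi> t) (\<lambda>z. indicator (space X - \<Delta>) (fst z))"

lemma sets_alive_law[simp]: "sets (alive_law t) = sets SA"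
  by (simp add: alive_law_def)

lemma nn_integral_alive_law:
  assumes g[measurable]: "g \<in> borel_measurable SA"
  shows "(\<integral>\<^sup>+z. g z \<partial>alive_law t) = (\<integral>\<^sup>+z. indicator (space X - \<Delta>) (fst z) * g z \<partial>pair_law \<pi> t)"
proof -
  note target_measurable[measurable]
  have "(\<lambda>z. indicator (space X - \<Delta>) (fst z) :: ennreal) \<in> borel_measurable SA" by measurable
  then show ?thesis
    unfolding alive_law_def by (intro nn_integral_density) (auto cong: measurable_cong_sets)
qed

lemma sets_occupation_measure: "sets (occupation_measure X A Q \<eta> \<Delta> \<pi>) = sets SA"
  unfolding occupation_measure_def by (rule sets.sets_measure_of_eq)

lemma emeasure_occupation_measure:
  assumes G: "\<Gamma> \<in> sets SA"
  shows "emeasure (occupation_measure X A Q \<eta> \<Delta> \<pi>) \<Gamma> = (\<Sum>t. emeasure (alive_law t) \<Gamma>)"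
proof -
  note target_measurable[measurable]
  let ?f = "\<lambda>\<Gamma>. \<integral>\<^sup>+ \<omega>. (\<Sum>t. indicator {\<omega>. hitting_time \<Delta> \<omega> > enat t} \<omega> * indicator \<Gamma> (\<omega> t)) \<partial>P"
  have [measurable]: "Measurable.pred P (\<lambda>\<omega>. enat t < hitting_time \<Delta> \<omega>)" for t
    unfolding enat_less_hitting_time_iff by measurable
  have f: "?f \<Gamma> = (\<Sum>t. emeasure (alive_law t) \<Gamma>)" if [measurable]: "\<Gamma> \<in> sets SA" for \<Gamma>
  proof -
    have h: "(\<integral>\<^sup>+ \<omega>. indicator {\<omega>. hitting_time \<Delta> \<omega> > enat t} \<omega> * indicator \<Gamma> (\<omega> t) \<partial>P) = emeasure (alive_law t) \<Gamma>" for t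
    proof -
      have "(\<integral>\<^sup>+ \<omega>. indicator {\<omega>. hitting_time \<Delta> \<omega> > enat t} \<omega> * indicator \<Gamma> (\<omega> t) \<partial>P) =
          (\<integral>\<^sup>+\<omega>. indicator (space X - \<Delta>) (fst (\<omega> t)) * indicator \<Gamma> (\<omega> t) \<partial>P)"
      proof (rule nn_integral_cong_AE, rule AE_mp[OF AE_absorbed[of t]], intro AE_I2 impI)
        fix \<omega> assume \<omega>: "\<omega> \<in> space P" and "(enat t < hitting_time \<Delta> \<omega>) = (fst (\<omega> t) \<notin> \<Delta>)"
        moreover have "fst (\<omega> t) \<in> space X" using measurable_space[OF law_measurable(1)[of t] \<omega>] by (auto simp: space_pair_measure)
        ultimately show "indicator {\<omega>. hitting_time \<Delta> \<omega> > enat t} \<omega> * indicator \<Gamma> (\<omega> t) = 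
            (indicator (space X - \<Delta>) (fst (\<omega> t)) * indicator \<Gamma> (\<omega> t) :: ennreal)"
          by (auto split: split_indicator)
      qed
      also have "\<dots> = (\<integral>\<^sup>+z. indicator (space X - \<Delta>) (fst z) * indicator \<Gamma> z \<partial>pair_law \<pi> t)"
        by (subst nn_integral_pair_law) auto
      also have "\<dots> = emeasure (alive_law t) \<Gamma>"
        by (subst nn_integral_alive_law[symmetric]) auto
      finally show ?thesis .
    qed
    have "?f \<Gamma> = (\<Sum>t. \<integral>\<^sup>+ \<omega>. indicator {\<omega>. hitting_time \<Delta> \<omega> > enat t} \<omega> * indicator \<Gamma> (\<omega> t) \<partial>P)"
      by (rule nn_integral_suminf) measurable
    also have "\<dots> = (\<Sum>t. emeasure (alive_law t) \<Gamma>)" by (simp only: h)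
    finally show ?thesis .
  qed
  show ?thesis unfolding occupation_measure_def
    by (subst emeasure_measure_of_suminf[where M="alive_law" and c="\<lambda>_. 1"]) (auto simp: f G)
qed

lemma nn_integral_occupation_measure:
  assumes g[measurable]: "g \<in> borel_measurable SA"
  shows "(\<integral>\<^sup>+z. g z \<partial>occupation_measure X A Q \<eta> \<Delta> \<pi>) =
    (\<Sum>t. \<integral>\<^sup>+z. indicator (space X - \<Delta>) (fst z) * g z \<partial>pair_law \<pi> t)"
  unfolding nn_integral_alive_law[OF g, symmetric]
  by (rule nn_integral_suminf_measure)
     (use g emeasure_occupation_measure sets_occupation_measure in \<open>auto cong: measurable_cong_sets\<close>)

end

end

section \<open>Occupation measures solve the equations and are dominated\<close>

lemma target_compl_measurable[measurable]: "space X - \<Delta> \<in> sets X"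
  using target_measurable by simp

lemma state_space_nonempty: "space X \<noteq> {}"
  using initial_distribution sets_eq_imp_space_eq[of \<eta> X] prob_space.not_empty[of \<eta>]
  by (auto simp: prob_measures_def)

lemma markov_kernelD:
  assumes "\<sigma> \<in> markov_kernels X A Ad"
  shows "\<sigma> \<in> X \<rightarrow>\<^sub>M prob_algebra AS" "\<sigma> \<in> X \<rightarrow>\<^sub>M subprob_algebra AS"
  using assms by (auto simp: markov_kernels_def intro: measurable_prob_algebraD)

lemma controlled_kernel_measurable:
  assumes \<sigma>: "\<sigma> \<in> markov_kernels X A Ad"
  shows "controlled_kernel Q \<sigma> \<in> X \<rightarrow>\<^sub>M prob_algebra X"
  unfolding controlled_kernel_def[abs_def]
  by (rule measurable_bind_prob_space2[OF markov_kernelD(1)[OF \<sigma>]]) measurable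

lemma nn_integral_controlled_kernel:
  assumes \<sigma>: "\<sigma> \<in> markov_kernels X A Ad" and x: "x \<in> space X" and g[measurable]: "g \<in> borel_measurable X"
  shows "(\<integral>\<^sup>+y. g y \<partial>controlled_kernel Q \<sigma> x) = (\<integral>\<^sup>+a. \<integral>\<^sup>+y. g y \<partial>Q (x, a) \<partial>\<sigma> x)"
proof -
  have [measurable_cong]: "sets (\<sigma> x) = sets AS" by (rule sets_kernel_prob(1)[OF markov_kernelD(1)[OF \<sigma>] x])
  have "(\<lambda>a. Q (x, a)) \<in> AS \<rightarrow>\<^sub>M subprob_algebra X"
    by (rule measurable_compose[OF measurable_Pair1'[OF x] Q_sub])
  then have "(\<lambda>a. Q (x, a)) \<in> \<sigma> x \<rightarrow>\<^sub>M subprob_algebra X" by (simp cong: measurable_cong_sets)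
  then show ?thesis unfolding controlled_kernel_def by (rule nn_integral_bind[OF g])
qed

lemma nn_integral_pair_law_fst:
  assumes \<pi>: "\<pi> \<in> policies X A Ad" and g[measurable]: "g \<in> borel_measurable X"
  shows "(\<integral>\<^sup>+z. g (fst z) \<partial>pair_law \<pi> t) = (\<integral>\<^sup>+x. g x \<partial>state_law \<pi> t)"
  by (subst nn_integral_pair_law[OF \<pi>], measurable, subst nn_integral_state_law[OF \<pi>], auto)

lemma nn_integral_state_law_Suc:
  assumes \<pi>: "\<pi> \<in> policies X A Ad" and g[measurable]: "g \<in> borel_measurable X"
  shows "(\<integral>\<^sup>+x. g x \<partial>state_law \<pi> (Suc t)) = (\<integral>\<^sup>+z. \<integral>\<^sup>+y. g y \<partial>Q z \<partial>pair_law \<pi> t)"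
proof -
  have "(\<integral>\<^sup>+x. g x \<partial>state_law \<pi> (Suc t)) = (\<integral>\<^sup>+\<omega>. g (snd (\<omega> t, fst (\<omega> (Suc t)))) \<partial>policy_law X A Q \<eta> \<pi>)"
    by (subst nn_integral_state_law[OF \<pi>]) auto
  also have "\<dots> = (\<integral>\<^sup>+z. \<integral>\<^sup>+y. g (snd (z, y)) \<partial>Q z \<partial>pair_law \<pi> t)"
    by (rule nn_integral_transition[OF \<pi>, of "\<lambda>v. g (snd v)"]) measurable
  finally show ?thesis by simp
qed

lemma nn_integral_Q_measurable:
  assumes g[measurable]: "g \<in> borel_measurable X"
  shows "(\<lambda>z. \<integral>\<^sup>+y. g y \<partial>Q z) \<in> borel_measurable SA"
  by (rule measurable_compose[OF Q_sub nn_integral_measurable_subprob_algebra]) measurable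

lemma nn_integral_kernel_measurable:
  assumes \<sigma>: "\<sigma> \<in> markov_kernels X A Ad" and g[measurable]: "g \<in> borel_measurable SA"
  shows "(\<lambda>x. \<integral>\<^sup>+a. g (x, a) \<partial>\<sigma> x) \<in> borel_measurable X"
  by (rule nn_integral_measurable_subprob_algebra2[OF _ markov_kernelD(2)[OF \<sigma>]]) measurable

lemma nn_integral_state_law_Suc_markov:
  assumes \<pi>: "\<pi> \<in> policies X A Ad" and \<sigma>: "\<sigma> \<in> markov_kernels X A Ad"
    and eq: "\<And>h x. x \<in> space X \<Longrightarrow> \<pi> t (h, x) = \<sigma> x" and g: "g \<in> borel_measurable X"
  shows "(\<integral>\<^sup>+x. g x \<partial>state_law \<pi> (Suc t)) = (\<integral>\<^sup>+x. \<integral>\<^sup>+y. g y \<partial>controlled_kernel Q \<sigma> x \<partial>state_law \<pi> t)"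
proof -
  have "(\<integral>\<^sup>+x. g x \<partial>state_law \<pi> (Suc t)) = (\<integral>\<^sup>+x. \<integral>\<^sup>+a. \<integral>\<^sup>+y. g y \<partial>Q (x, a) \<partial>\<sigma> x \<partial>state_law \<pi> t)"
    unfolding nn_integral_state_law_Suc[OF \<pi> g]
    by (rule nn_integral_pair_law_markov[OF \<pi> \<sigma> eq nn_integral_Q_measurable[OF g]])
  also have "\<dots> = (\<integral>\<^sup>+x. \<integral>\<^sup>+y. g y \<partial>controlled_kernel Q \<sigma> x \<partial>state_law \<pi> t)"
    by (rule nn_integral_cong) (simp add: nn_integral_controlled_kernel[OF \<sigma> _ g])
  finally show ?thesis .
qed

text \<open>
  Follow \<open>\<xi>\<close> for \<open>k\<close> steps and \<open>\<sigma>\<close> afterwards. With \<open>k = 0\<close> this is the stationary policy \<open>\<sigma>\<close>.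
\<close>

definition switch_policy :: "('x \<Rightarrow> 'a measure) \<Rightarrow> nat \<Rightarrow> ('x \<Rightarrow> 'a measure) \<Rightarrow> nat \<Rightarrow> (nat \<Rightarrow> 'x \<times> 'a) \<times> 'x \<Rightarrow> 'a measure" where
  "switch_policy \<xi> k \<sigma> n v = (if n < k then \<xi> (snd v) else \<sigma> (snd v))"

lemma switch_policy:
  assumes "\<xi> \<in> markov_kernels X A Ad" "\<sigma> \<in> markov_kernels X A Ad"
  shows "switch_policy \<xi> k \<sigma> \<in> policies X A Ad"
proof -
  have "(\<lambda>v. \<tau> (snd v)) \<in> histories X A n \<rightarrow>\<^sub>M prob_algebra AS" if "\<tau> \<in> markov_kernels X A Ad" for \<tau> n
    unfolding histories_def by (rule measurable_compose[OF measurable_snd markov_kernelD(1)[OF that]])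
  then have "switch_policy \<xi> k \<sigma> n \<in> histories X A n \<rightarrow>\<^sub>M prob_algebra AS" for n
    using assms unfolding switch_policy_def[abs_def] by (cases "n < k") auto
  moreover have "x \<in> space X" if "(h, x) \<in> space (histories X A n)" for h x n
    using that by (auto simp: histories_def space_pair_measure)
  ultimately show ?thesis
    using assms by (auto simp: policies_def switch_policy_def markov_kernels_def)
qed

text \<open>
  The summands \<open>\<eta> Q\<^sub>\<xi>\<^sup>k\<close> of the reference measure.
\<close>

definition ref_law :: "('x \<Rightarrow> 'a measure) \<Rightarrow> nat \<Rightarrow> 'x measure" where
  "ref_law \<xi> k = \<eta> \<bind> controlled_kernel_pow X Q \<xi> k"

lemma initial_prob_algebra: "\<eta> \<in> space (prob_algebra X)"
  using initial_distribution by (auto simp: prob_measures_def space_prob_algebra)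

lemma controlled_kernel_pow_measurable:
  assumes \<sigma>: "\<sigma> \<in> markov_kernels X A Ad"
  shows "controlled_kernel_pow X Q \<sigma> k \<in> X \<rightarrow>\<^sub>M prob_algebra X"
proof (induction k)
  case 0
  then show ?case by (simp add: measurable_return_prob_space cong: measurable_cong) 
next
  case (Suc k)
  have "(\<lambda>x. controlled_kernel_pow X Q \<sigma> k x \<bind> controlled_kernel Q \<sigma>) \<in> X \<rightarrow>\<^sub>M prob_algebra X"
    by (rule measurable_bind_prob_space[OF Suc controlled_kernel_measurable[OF \<sigma>]])
  then show ?case by simp
qed

lemma ref_law_prob:
  assumes \<xi>: "\<xi> \<in> markov_kernels X A Ad"
  shows "prob_space (ref_law \<xi> k)" "sets (ref_law \<xi> k) = sets X"
  using prob_space_bind'[OF initial_prob_algebra controlled_kernel_pow_measurable[OF \<xi>, of k]]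
    sets_bind'[OF initial_prob_algebra controlled_kernel_pow_measurable[OF \<xi>, of k]]
  by (simp_all add: ref_law_def)

lemma ref_law_0: "ref_law \<xi> 0 = \<eta>"
proof -
  have s: "sets \<eta> = sets X" using initial_distribution by (simp add: prob_measures_def)
  have "ref_law \<xi> 0 = \<eta> \<bind> return \<eta>"
    unfolding ref_law_def by (rule bind_cong) (simp_all add: return_cong[OF s])
  then show ?thesis by (simp add: bind_return')
qed

lemma nn_integral_ref_law_Suc:
  assumes \<xi>: "\<xi> \<in> markov_kernels X A Ad" and g: "g \<in> borel_measurable X"
  shows "(\<integral>\<^sup>+x. g x \<partial>ref_law \<xi> (Suc k)) = (\<integral>\<^sup>+x. \<integral>\<^sup>+y. g y \<partial>controlled_kernel Q \<xi> x \<partial>ref_law \<xi> k)"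
proof -
  have [measurable_cong]: "sets \<eta> = sets X" using initial_distribution by (simp add: prob_measures_def)
  have p: "controlled_kernel_pow X Q \<xi> k \<in> \<eta> \<rightarrow>\<^sub>M subprob_algebra X"
    using measurable_prob_algebraD[OF controlled_kernel_pow_measurable[OF \<xi>]] by (simp cong: measurable_cong_sets)
  have c: "controlled_kernel Q \<xi> \<in> X \<rightarrow>\<^sub>M subprob_algebra X"
    by (rule measurable_prob_algebraD[OF controlled_kernel_measurable[OF \<xi>]])
  have c': "controlled_kernel Q \<xi> \<in> ref_law \<xi> k \<rightarrow>\<^sub>M subprob_algebra X"
    using c ref_law_prob(2)[OF \<xi>, of k] by (simp cong: measurable_cong_sets)
  have "ref_law \<xi> (Suc k) = \<eta> \<bind> (\<lambda>x. controlled_kernel_pow X Q \<xi> k x \<bind> controlled_kernel Q \<xi>)"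
    unfolding ref_law_def by (rule arg_cong[where f="bind \<eta>"]) (simp add: fun_eq_iff)
  also have "\<dots> = ref_law \<xi> k \<bind> controlled_kernel Q \<xi>"
    unfolding ref_law_def by (rule bind_assoc[OF p c, symmetric])
  finally show ?thesis using nn_integral_bind[OF g c'] by simp
qed

lemma state_law_eq_ref_law:
  assumes \<xi>: "\<xi> \<in> markov_kernels X A Ad" and \<sigma>: "\<sigma> \<in> markov_kernels X A Ad"
    and g: "g \<in> borel_measurable X" and "t \<le> k"
  shows "(\<integral>\<^sup>+x. g x \<partial>state_law (switch_policy \<xi> k \<sigma>) t) = (\<integral>\<^sup>+x. g x \<partial>ref_law \<xi> t)"
  using g \<open>t \<le> k\<close>
proof (induction t arbitrary: g)
  case 0
  then show ?case by (simp add: state_law_0[OF switch_policy[OF \<xi> \<sigma>]] ref_law_0)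
next
  case (Suc t)
  have m: "(\<lambda>x. \<integral>\<^sup>+y. g y \<partial>controlled_kernel Q \<xi> x) \<in> borel_measurable X"
    by (rule measurable_compose[OF measurable_prob_algebraD[OF controlled_kernel_measurable[OF \<xi>]] nn_integral_measurable_subprob_algebra[OF Suc.prems(1)]])
  have "(\<integral>\<^sup>+x. g x \<partial>state_law (switch_policy \<xi> k \<sigma>) (Suc t)) =
      (\<integral>\<^sup>+x. \<integral>\<^sup>+y. g y \<partial>controlled_kernel Q \<xi> x \<partial>state_law (switch_policy \<xi> k \<sigma>) t)"
    by (rule nn_integral_state_law_Suc_markov[OF switch_policy[OF \<xi> \<sigma>] \<xi> _ Suc.prems(1)])
       (use Suc.prems in \<open>simp add: switch_policy_def\<close>)
  also have "\<dots> = (\<integral>\<^sup>+x. g x \<partial>ref_law \<xi> (Suc t))"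
    using Suc.IH[OF m] Suc.prems by (simp add: nn_integral_ref_law_Suc[OF \<xi>])
  finally show ?case .
qed

text \<open>
  All weights \<open>(1 - \<beta>) \<beta>\<^sup>k\<close> are positive, so the null sets do not depend on \<open>\<beta>\<close>.
\<close>

lemma reference_null_iff:
  assumes \<xi>: "\<xi> \<in> markov_kernels X A Ad" and \<beta>: "0 < \<beta>" "\<beta> < 1"
  shows "N \<in> null_sets (reference_measure X Q \<eta> \<xi> \<beta>) \<longleftrightarrow> N \<in> sets X \<and> (\<forall>k. emeasure (ref_law \<xi> k) N = 0)"
proof -
  have s: "sets (reference_measure X Q \<eta> \<xi> \<beta>) = sets X"
    unfolding reference_measure_def by (rule sets.sets_measure_of_eq)
  have "emeasure (reference_measure X Q \<eta> \<xi> \<beta>) N =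
      ennreal (1 - \<beta>) * (\<Sum>k. ennreal (\<beta> ^ k) * emeasure (ref_law \<xi> k) N)" if N: "N \<in> sets X"
    unfolding reference_measure_def ref_law_def[symmetric]
    by (rule emeasure_measure_of_suminf[where M="ref_law \<xi>" and c="\<lambda>k. ennreal (1 - \<beta>) * ennreal (\<beta> ^ k)"])
       (simp_all add: ref_law_prob(2)[OF \<xi>] N ennreal_suminf_cmult mult.assoc)
  moreover have "\<not> \<beta> ^ k \<le> 0" for k using \<beta>(1) by (simp add: not_le)
  ultimately show ?thesis using \<beta> by (auto simp: null_sets_def s suminf_eq_zero_iff ennreal_eq_0_iff)
qed

text \<open>
  The induction on \<open>t\<close> generalizes over \<open>B\<close>: if \<open>B\<close> is null for all \<open>\<eta> Q\<^sub>\<xi>\<^sup>k\<close>, then so is the set \<open>N\<close> of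
  states \<open>x\<close> with \<open>Q\<^sub>\<xi>(B|x) > 0\<close>, since \<open>\<eta> Q\<^sub>\<xi>\<^sup>k\<close> integrates \<open>Q\<^sub>\<xi>(B|\<cdot>)\<close> to the measure of \<open>B\<close> at \<open>k + 1\<close>.
  Outside \<open>N\<close> domination gives \<open>Q(B|x,a) = 0\<close> for every available action.
\<close>

lemma state_law_null:
  assumes \<xi>: "\<xi> \<in> markov_kernels X A Ad" and dom: "dominating_kernel X Ad Q \<xi>"
    and \<pi>: "\<pi> \<in> policies X A Ad" and B: "B \<in> sets X" "\<And>k. emeasure (ref_law \<xi> k) B = 0"
  shows "emeasure (state_law \<pi> t) B = 0"
  using B
proof (induction t arbitrary: B)
  case 0
  then show ?case using ref_law_0[of \<xi>] by (metis state_law_0[OF \<pi>])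
next
  case (Suc t)
  note B[measurable] = Suc.prems(1)
  have c: "controlled_kernel Q \<xi> \<in> X \<rightarrow>\<^sub>M subprob_algebra X"
    by (rule measurable_prob_algebraD[OF controlled_kernel_measurable[OF \<xi>]])
  note cs = sets_kernel_prob[OF controlled_kernel_measurable[OF \<xi>]]
  have m: "(\<lambda>x. emeasure (controlled_kernel Q \<xi> x) B) \<in> borel_measurable X"
    using c B by measurable
  define N where "N = {x \<in> space X. emeasure (controlled_kernel Q \<xi> x) B \<noteq> 0}"
  have N[measurable]: "N \<in> sets X" unfolding N_def using m by measurable
  have "emeasure (ref_law \<xi> k) N = 0" for k
  proof -
    have "(\<integral>\<^sup>+x. emeasure (controlled_kernel Q \<xi> x) B \<partial>ref_law \<xi> k) = (\<integral>\<^sup>+x. \<integral>\<^sup>+y. indicator B y \<partial>controlled_kernel Q \<xi> x \<partial>ref_law \<xi> k)"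
      by (rule nn_integral_cong) (use cs(1) sets_eq_imp_space_eq[OF ref_law_prob(2)[OF \<xi>]] in simp)
    also have "\<dots> = (\<integral>\<^sup>+x. indicator B x \<partial>ref_law \<xi> (Suc k))"
      by (rule nn_integral_ref_law_Suc[OF \<xi>, symmetric]) measurable
    also have "\<dots> = 0" using Suc.prems(2)[of "Suc k"] ref_law_prob(2)[OF \<xi>] by simp
    finally have "AE x in ref_law \<xi> k. emeasure (controlled_kernel Q \<xi> x) B = 0"
      using m ref_law_prob(2)[OF \<xi>, of k] by (subst (asm) nn_integral_0_iff_AE) (auto cong: measurable_cong_sets)
    then show ?thesis
      using sets_eq_imp_space_eq[OF ref_law_prob(2)[OF \<xi>, of k]] N ref_law_prob(2)[OF \<xi>, of k]
      by (subst (asm) AE_iff_measurable[where N=N]) (auto simp: N_def)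
  qed
  from Suc.IH[OF N this] have tN: "emeasure (state_law \<pi> t) N = 0" .
  have "(\<lambda>z. indicator N (fst z) :: ennreal) \<in> borel_measurable SA" by measurable
  then have Nm: "(\<lambda>z. indicator N (fst z) :: ennreal) \<in> borel_measurable (pair_law \<pi> t)"
    by (simp cong: measurable_cong_sets)
  have "(\<integral>\<^sup>+z. indicator N (fst z) \<partial>pair_law \<pi> t) = 0"
    using tN by (subst nn_integral_pair_law_fst[OF \<pi>]) auto
  then have 1: "AE z in pair_law \<pi> t. fst z \<notin> N"
    unfolding nn_integral_0_iff_AE[OF Nm] by (auto split: split_indicator_asm)
  have 2: "AE z in pair_law \<pi> t. z \<in> feasible_pairs X Ad"
    by (rule AE_I[OF _ pair_law_feasible[OF \<pi>, of t]]) (use feasible_measurable in auto)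
  have "AE z in pair_law \<pi> t. emeasure (Q z) B = 0"
    using 1 2
  proof eventually_elim
    case (elim z)
    obtain x a where z: "z = (x, a)" by (cases z)
    with elim have x: "x \<in> space X" and a: "a \<in> Ad x" by (auto simp: feasible_pairs_def)
    have zs: "z \<in> space SA" using x a available_subset[OF x] by (auto simp: z space_pair_measure)
    have "B \<in> null_sets (controlled_kernel Q \<xi> x)"
      using elim x cs(1)[OF x] by (auto simp: z N_def null_sets_def)
    moreover have "absolutely_continuous (controlled_kernel Q \<xi> x) (Q (x, a))"
      using dom elim by (auto simp: dominating_kernel_def z)
    ultimately show ?case by (auto simp: absolutely_continuous_def z null_sets_def subset_eq)
  qed
  then have "(\<integral>\<^sup>+z. emeasure (Q z) B \<partial>pair_law \<pi> t) = (\<integral>\<^sup>+z. 0 \<partial>pair_law \<pi> t)" by (rule nn_integral_cong_AE)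
  then show ?case by (simp add: emeasure_state_law_Suc[OF \<pi> B])
qed

context
  assumes absorbing: "absorbing X A Ad Q \<eta> \<Delta>"
begin

lemma absorb: "x \<in> \<Delta> \<Longrightarrow> a \<in> A \<Longrightarrow> measure (Q (x, a)) \<Delta> = 1"
  using absorbing by (auto simp: absorbing_def)

lemma Q_absorbed:
  assumes z: "z \<in> space SA" "fst z \<in> \<Delta>"
  shows "AE y in Q z. y \<notin> (space X - \<Delta>)"
proof -
  note q = Q_kernel[OF z(1)]
  interpret q: prob_space "Q z" by (rule q)
  have "measure (Q z) \<Delta> = 1" using absorb[of "fst z" "snd z"] z by (auto simp: space_pair_measure)
  then have "AE y in Q z. y \<in> \<Delta>" using target_measurable by (subst (asm) q.prob_eq_1) (auto simp: q)
  then show ?thesis by eventually_elim simp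
qed

lemma nn_integral_Q_absorbed:
  assumes z: "z \<in> space SA" "fst z \<in> \<Delta>"
  shows "(\<integral>\<^sup>+y. g y * indicator (space X - \<Delta>) y \<partial>Q z) = 0"
proof -
  have "(\<integral>\<^sup>+y. g y * indicator (space X - \<Delta>) y \<partial>Q z) = (\<integral>\<^sup>+y. 0 \<partial>Q z)"
    by (rule nn_integral_cong_AE) (use Q_absorbed[OF z] in \<open>eventually_elim, simp\<close>)
  then show ?thesis by simp
qed

lemma suminf_alive_finite:
  assumes \<pi>: "\<pi> \<in> policies X A Ad"
  shows "(\<Sum>t. emeasure (state_law \<pi> t) (space X - \<Delta>)) < \<infinity>"
proof -
  have "(\<Sum>t. emeasure (state_law \<pi> t) (space X - \<Delta>)) = (\<integral>\<^sup>+\<omega>. ennreal_of_enat (hitting_time \<Delta> \<omega>) \<partial>policy_law X A Q \<eta> \<pi>)"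
    by (rule expectation_hitting_time[OF \<pi> absorb, symmetric])
  also have "\<dots> < \<infinity>" using absorbing \<pi> by (simp add: absorbing_def)
  finally show ?thesis .
qed

lemma alive_tendsto_0:
  assumes \<pi>: "\<pi> \<in> policies X A Ad"
  shows "(\<lambda>t. emeasure (state_law \<pi> t) (space X - \<Delta>)) \<longlonglongrightarrow> 0"
proof -
  have e: "emeasure (state_law \<pi> t) (space X - \<Delta>) = ennreal (measure (state_law \<pi> t) (space X - \<Delta>))" for t
    using prob_space.finite_measure[OF prob_state_law[OF \<pi>]] by (simp add: finite_measure.emeasure_eq_measure)
  have "summable (\<lambda>t. measure (state_law \<pi> t) (space X - \<Delta>))"
    using suminf_alive_finite[OF \<pi>] unfolding e by (intro summable_suminf_not_top) auto
  then have "(\<lambda>t. measure (state_law \<pi> t) (space X - \<Delta>)) \<longlonglongrightarrow> 0" by (rule summable_LIMSEQ_zero)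
  then have "(\<lambda>t. ennreal (measure (state_law \<pi> t) (space X - \<Delta>))) \<longlonglongrightarrow> ennreal 0" by (rule tendsto_ennrealI)
  then show ?thesis unfolding e by simp
qed

lemma nn_integral_occupation_fst:
  assumes \<pi>: "\<pi> \<in> policies X A Ad" and g[measurable]: "g \<in> borel_measurable X"
  shows "(\<integral>\<^sup>+z. g (fst z) \<partial>occupation_measure X A Q \<eta> \<Delta> \<pi>) = (\<Sum>t. \<integral>\<^sup>+x. indicator (space X - \<Delta>) x * g x \<partial>state_law \<pi> t)"
proof -
  have "(\<integral>\<^sup>+z. indicator (space X - \<Delta>) (fst z) * g (fst z) \<partial>pair_law \<pi> t) = (\<integral>\<^sup>+x. indicator (space X - \<Delta>) x * g x \<partial>state_law \<pi> t)" for t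
    by (rule nn_integral_pair_law_fst[OF \<pi>, of "\<lambda>x. indicator (space X - \<Delta>) x * g x"]) measurable
  moreover have "(\<integral>\<^sup>+z. g (fst z) \<partial>occupation_measure X A Q \<eta> \<Delta> \<pi>) = (\<Sum>t. \<integral>\<^sup>+z. indicator (space X - \<Delta>) (fst z) * g (fst z) \<partial>pair_law \<pi> t)"
    by (rule nn_integral_occupation_measure[OF \<pi> absorb, of "\<lambda>z. g (fst z)"]) measurable
  ultimately show ?thesis by simp
qed

lemma emeasure_occupation_marginal:
  assumes \<pi>: "\<pi> \<in> policies X A Ad" and B[measurable]: "B \<in> sets X"
  shows "emeasure (state_marginal X (occupation_measure X A Q \<eta> \<Delta> \<pi>)) B = (\<Sum>t. emeasure (state_law \<pi> t) (B \<inter> (space X - \<Delta>)))"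
proof -
  let ?\<mu> = "occupation_measure X A Q \<eta> \<Delta> \<pi>"
  have s: "sets ?\<mu> = sets SA" by (rule sets_occupation_measure[OF \<pi> absorb])
  have [measurable]: "fst \<in> ?\<mu> \<rightarrow>\<^sub>M X" unfolding measurable_cong_sets[OF s refl] by simp
  have "emeasure (state_marginal X ?\<mu>) B = (\<integral>\<^sup>+x. indicator B x \<partial>state_marginal X ?\<mu>)"
    by (simp add: state_marginal_def)
  also have "\<dots> = (\<integral>\<^sup>+z. indicator B (fst z) \<partial>?\<mu>)"
    unfolding state_marginal_def by (subst nn_integral_distr) auto
  also have "\<dots> = (\<Sum>t. \<integral>\<^sup>+x. indicator (space X - \<Delta>) x * indicator B x \<partial>state_law \<pi> t)"
    by (rule nn_integral_occupation_fst[OF \<pi>]) measurable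
  also have "(\<lambda>t. \<integral>\<^sup>+x. indicator (space X - \<Delta>) x * indicator B x \<partial>state_law \<pi> t) = (\<lambda>t. emeasure (state_law \<pi> t) (B \<inter> (space X - \<Delta>)))"
  proof
    fix t
    have "(\<integral>\<^sup>+x. indicator (space X - \<Delta>) x * indicator B x \<partial>state_law \<pi> t) = (\<integral>\<^sup>+x. indicator (B \<inter> (space X - \<Delta>)) x \<partial>state_law \<pi> t)"
      by (rule nn_integral_cong) (auto simp: indicator_def)
    also have "\<dots> = emeasure (state_law \<pi> t) (B \<inter> (space X - \<Delta>))" by (rule nn_integral_indicator) simp
    finally show "(\<integral>\<^sup>+x. indicator (space X - \<Delta>) x * indicator B x \<partial>state_law \<pi> t) = emeasure (state_law \<pi> t) (B \<inter> (space X - \<Delta>))" .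
  qed
  finally show ?thesis .
qed

text \<open>
  The marginal is the sum over \<open>t\<close> of the laws of the surviving states. Its term at \<open>t = 0\<close> is \<open>\<eta>\<close> outside \<open>\<Delta>\<close>;
  the term at \<open>t + 1\<close> is obtained from that at \<open>t\<close> by one transition, in which pairs with state in \<open>\<Delta>\<close> can be
  dropped, because from there the complement of \<open>\<Delta>\<close> is reached with probability zero.
\<close>

lemma occupation_measure_characteristic:
  assumes \<pi>: "\<pi> \<in> policies X A Ad"
  shows "occupation_measure X A Q \<eta> \<Delta> \<pi> \<in> characteristic_measures X A Ad Q \<eta> \<Delta>"
proof -
  let ?\<mu> = "occupation_measure X A Q \<eta> \<Delta> \<pi>"
  have s: "sets ?\<mu> = sets SA" by (rule sets_occupation_measure[OF \<pi> absorb])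
  have "emeasure ?\<mu> (space ?\<mu>) = (\<integral>\<^sup>+z. 1 \<partial>?\<mu>)" by simp
  also have "\<dots> = (\<Sum>t. \<integral>\<^sup>+x. indicator (space X - \<Delta>) x * 1 \<partial>state_law \<pi> t)"
    by (rule nn_integral_occupation_fst[OF \<pi>, of "\<lambda>_. 1"]) measurable
  also have "\<dots> < \<infinity>" using suminf_alive_finite[OF \<pi>] by simp
  finally have fin: "finite_measure ?\<mu>" by (intro finite_measureI) simp
  have K: "emeasure ?\<mu> (space SA - feasible_pairs X Ad) = 0"
  proof -
    let ?N = "space SA - feasible_pairs X Ad"
    have N: "?N \<in> sets SA" using feasible_measurable by simp
    have "emeasure (alive_law \<pi> t) ?N = 0" for t
    proof -
      have "emeasure (alive_law \<pi> t) ?N = (\<integral>\<^sup>+z. indicator (space X - \<Delta>) (fst z) * indicator ?N z \<partial>pair_law \<pi> t)"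
        using N nn_integral_alive_law[OF \<pi> absorb, of "indicator ?N" t] sets_alive_law[OF \<pi> absorb] by simp
      also have "\<dots> \<le> (\<integral>\<^sup>+z. indicator ?N z \<partial>pair_law \<pi> t)" by (rule nn_integral_mono) (auto simp: indicator_def)
      also have "\<dots> = 0" using N pair_law_feasible[OF \<pi>, of t] by simp
      finally show ?thesis by simp
    qed
    then show ?thesis using emeasure_occupation_measure[OF \<pi> absorb N] by simp
  qed
  have "emeasure (state_marginal X ?\<mu>) B = emeasure \<eta> (B \<inter> (space X - \<Delta>)) + (\<integral>\<^sup>+z. emeasure (Q z) (B \<inter> (space X - \<Delta>)) \<partial>?\<mu>)"
    if B[measurable]: "B \<in> sets X" for B
  proof -
    have "emeasure (state_marginal X ?\<mu>) B = (\<Sum>t. emeasure (state_law \<pi> (Suc t)) (B \<inter> (space X - \<Delta>))) + emeasure (state_law \<pi> 0) (B \<inter> (space X - \<Delta>))"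
      unfolding emeasure_occupation_marginal[OF \<pi> B]
      using suminf_offset[of "\<lambda>t. emeasure (state_law \<pi> t) (B \<inter> (space X - \<Delta>))" 1] by (simp add: add.commute)
    also have "(\<lambda>t. emeasure (state_law \<pi> (Suc t)) (B \<inter> (space X - \<Delta>))) = (\<lambda>t. \<integral>\<^sup>+z. indicator (space X - \<Delta>) (fst z) * emeasure (Q z) (B \<inter> (space X - \<Delta>)) \<partial>pair_law \<pi> t)"
    proof
      fix t
      have "emeasure (state_law \<pi> (Suc t)) (B \<inter> (space X - \<Delta>)) = (\<integral>\<^sup>+z. emeasure (Q z) (B \<inter> (space X - \<Delta>)) \<partial>pair_law \<pi> t)"
        by (rule emeasure_state_law_Suc[OF \<pi>]) measurable
      also have "\<dots> = (\<integral>\<^sup>+z. indicator (space X - \<Delta>) (fst z) * emeasure (Q z) (B \<inter> (space X - \<Delta>)) \<partial>pair_law \<pi> t)"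
      proof (rule nn_integral_cong)
        fix z assume "z \<in> space (pair_law \<pi> t)"
        then have z: "z \<in> space SA" by simp
        show "emeasure (Q z) (B \<inter> (space X - \<Delta>)) = indicator (space X - \<Delta>) (fst z) * emeasure (Q z) (B \<inter> (space X - \<Delta>))"
        proof (cases "fst z \<in> \<Delta>")
          case True
          have "emeasure (Q z) (B \<inter> (space X - \<Delta>)) = (\<integral>\<^sup>+y. indicator (B \<inter> (space X - \<Delta>)) y \<partial>Q z)" using Q_kernel(2)[OF z] by simp
          also have "\<dots> = (\<integral>\<^sup>+y. indicator B y * indicator (space X - \<Delta>) y \<partial>Q z)" by (rule nn_integral_cong) (auto simp: indicator_def)
          also have "\<dots> = 0" by (rule nn_integral_Q_absorbed[OF z True])
          finally show ?thesis by simp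
        next
          case False
          then show ?thesis using z by (auto simp: space_pair_measure)
        qed
      qed
      finally show "emeasure (state_law \<pi> (Suc t)) (B \<inter> (space X - \<Delta>)) = (\<integral>\<^sup>+z. indicator (space X - \<Delta>) (fst z) * emeasure (Q z) (B \<inter> (space X - \<Delta>)) \<partial>pair_law \<pi> t)" .
    qed
    also have "(\<Sum>t. \<integral>\<^sup>+z. indicator (space X - \<Delta>) (fst z) * emeasure (Q z) (B \<inter> (space X - \<Delta>)) \<partial>pair_law \<pi> t) = (\<integral>\<^sup>+z. emeasure (Q z) (B \<inter> (space X - \<Delta>)) \<partial>?\<mu>)"
      by (rule nn_integral_occupation_measure[OF \<pi> absorb, symmetric]) measurable
    finally show ?thesis by (simp add: state_law_0[OF \<pi>] add.commute)
  qed
  with s fin K show ?thesis by (auto simp: characteristic_measures_def finite_measures_def)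
qed

lemma occupation_marginal_dominated:
  assumes \<xi>: "\<xi> \<in> markov_kernels X A Ad" and dom: "dominating_kernel X Ad Q \<xi>" and \<beta>: "0 < \<beta>" "\<beta> < 1"
    and \<pi>: "\<pi> \<in> policies X A Ad"
  shows "absolutely_continuous (reference_measure X Q \<eta> \<xi> \<beta>) (state_marginal X (occupation_measure X A Q \<eta> \<Delta> \<pi>))"
  unfolding absolutely_continuous_def
proof
  fix N assume "N \<in> null_sets (reference_measure X Q \<eta> \<xi> \<beta>)"
  then have N: "N \<in> sets X" "\<And>k. emeasure (ref_law \<xi> k) N = 0" by (auto simp: reference_null_iff[OF \<xi> \<beta>])
  have "emeasure (state_law \<pi> t) (N \<inter> (space X - \<Delta>)) = 0" for t
  proof -
    have "emeasure (state_law \<pi> t) (N \<inter> (space X - \<Delta>)) \<le> emeasure (state_law \<pi> t) N" using N by (intro emeasure_mono) auto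
    then show ?thesis using state_law_null[OF \<xi> dom \<pi> N, of t] by simp
  qed
  then show "N \<in> null_sets (state_marginal X (occupation_measure X A Q \<eta> \<Delta> \<pi>))"
    using N emeasure_occupation_marginal[OF \<pi> N(1)] by (auto simp: null_sets_def state_marginal_def)
qed

end

section \<open>Dominated solutions are occupation measures\<close>

text \<open>
  The kernel from the disintegration respects the constraints only almost everywhere. It is
  replaced by the measurable selector on the measurable set of states where it does not, which
  changes it on a null set only.
\<close>

lemma feasible_disintegration:
  assumes fin: "finite_measure \<mu>" and s: "sets \<mu> = sets SA"
    and K: "emeasure \<mu> (space SA - feasible_pairs X Ad) = 0"
  shows "\<exists>\<sigma>\<in>markov_kernels X A Ad. has_cond_law \<mu> X AS fst snd \<sigma>"
proof -
  obtain f where f: "f \<in> X \<rightarrow>\<^sub>M AS" and fAd: "\<And>x. x \<in> space X \<Longrightarrow> f x \<in> Ad x" using selector by blast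
  have A0: "A \<noteq> {}" using state_space_nonempty available_nonempty available_subset by blast
  have ne: "space \<mu> \<noteq> {}" using state_space_nonempty A0 sets_eq_imp_space_eq[OF s] by (simp add: space_pair_measure)
  obtain \<kappa> where \<kappa>: "\<kappa> \<in> X \<rightarrow>\<^sub>M prob_algebra AS" and h: "has_cond_law \<mu> X AS fst snd \<kappa>"
    using polish_disintegration[OF fin s actions_borel A0] by blast
  have [measurable]: "fst \<in> \<mu> \<rightarrow>\<^sub>M X" "snd \<in> \<mu> \<rightarrow>\<^sub>M AS" unfolding measurable_cong_sets[OF s refl] by simp_all
  have [measurable]: "\<kappa> \<in> X \<rightarrow>\<^sub>M subprob_algebra AS" using \<kappa> by (rule measurable_prob_algebraD)
  have KS: "feasible_pairs X Ad = Sigma (space X) Ad" by (auto simp: feasible_pairs_def)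
  define G where "G = {x \<in> space X. measure (\<kappa> x) (Ad x) = 1}"
  have "(\<lambda>x. measure (\<kappa> x) (Ad x)) \<in> borel_measurable X"
    using measure_measurable_prob_algebra2[OF _ \<kappa>, of Ad] feasible_measurable unfolding KS by simp
  then have G[measurable]: "G \<in> sets X" unfolding G_def by measurable
  define \<sigma> where "\<sigma> x = (if x \<in> G then \<kappa> x else return AS (f x))" for x
  have \<sigma>m: "\<sigma> \<in> X \<rightarrow>\<^sub>M prob_algebra AS"
    unfolding \<sigma>_def[abs_def] using \<kappa> measurable_compose[OF f measurable_return_prob_space] G
    by (intro measurable_If_set) auto
  have "measure (\<sigma> x) (Ad x) = 1" if x: "x \<in> space X" for x
    using available_measurable[OF x] fAd[OF x] x by (auto simp: \<sigma>_def G_def measure_return)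
  then have \<sigma>: "\<sigma> \<in> markov_kernels X A Ad" using \<sigma>m by (simp add: markov_kernels_def)
  let ?N = "space SA - feasible_pairs X Ad"
  have N[measurable]: "?N \<in> sets SA" using feasible_measurable by simp
  have m: "(\<lambda>x. \<integral>\<^sup>+a. indicator ?N (x, a) \<partial>\<kappa> x) \<in> borel_measurable X"
    by (rule nn_integral_measurable_subprob_algebra2[where N=AS]) measurable
  have "(\<integral>\<^sup>+z. \<integral>\<^sup>+a. indicator ?N (fst z, a) \<partial>\<kappa> (fst z) \<partial>\<mu>) = (\<integral>\<^sup>+z. indicator ?N (fst z, snd z) \<partial>\<mu>)"
    by (rule nn_integral_cond_law[OF fin ne _ _ \<kappa> h, symmetric]) measurable
  also have "\<dots> = 0" using K N s by simp
  finally have "AE z in \<mu>. (\<integral>\<^sup>+a. indicator ?N (fst z, a) \<partial>\<kappa> (fst z)) = 0"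
    by (subst (asm) nn_integral_0_iff_AE) (auto intro: measurable_compose[OF _ m])
  then have AE_G: "AE z in \<mu>. fst z \<in> G"
  proof (rule AE_mp, intro AE_I2 impI)
    fix z assume "z \<in> space \<mu>" and z: "(\<integral>\<^sup>+a. indicator ?N (fst z, a) \<partial>\<kappa> (fst z)) = 0"
    then have x: "fst z \<in> space X" by (metis measurable_space \<open>fst \<in> \<mu> \<rightarrow>\<^sub>M X\<close>)
    note k = sets_kernel_prob[OF \<kappa> x]
    interpret k: prob_space "\<kappa> (fst z)" by (rule k)
    have "(\<lambda>a. indicator ?N (fst z, a) :: ennreal) \<in> borel_measurable (\<kappa> (fst z))"
      using measurable_compose[OF measurable_Pair1'[OF x], of "indicator ?N :: _ \<Rightarrow> ennreal" AS borel] N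
      by (simp add: measurable_cong_sets[OF k(1) refl])
    then have "AE a in \<kappa> (fst z). indicator ?N (fst z, a) = (0::ennreal)"
      using z by (subst (asm) nn_integral_0_iff_AE) auto
    then have "AE a in \<kappa> (fst z). a \<in> Ad (fst z)"
      by (rule AE_mp, intro AE_I2 impI)
         (auto simp: k(2) space_pair_measure x feasible_pairs_def split: split_indicator_asm)
    then have "measure (\<kappa> (fst z)) (Ad (fst z)) = 1"
      using available_measurable[OF x] k(1) by (subst k.prob_eq_1) auto
    then show "fst z \<in> G" using x by (simp add: G_def)
  qed
  have "has_cond_law \<mu> X AS fst snd \<sigma>"
    unfolding has_cond_law_def
  proof (intro ballI)
    fix D C assume DC: "D \<in> sets X" "C \<in> sets AS"
    have "emeasure \<mu> {\<omega> \<in> space \<mu>. fst \<omega> \<in> D \<and> snd \<omega> \<in> C} = (\<integral>\<^sup>+\<omega>. indicator D (fst \<omega>) * emeasure (\<kappa> (fst \<omega>)) C \<partial>\<mu>)"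
      using h DC unfolding has_cond_law_def by blast
    also have "\<dots> = (\<integral>\<^sup>+\<omega>. indicator D (fst \<omega>) * emeasure (\<sigma> (fst \<omega>)) C \<partial>\<mu>)"
      by (rule nn_integral_cong_AE) (use AE_G in \<open>eventually_elim, simp add: \<sigma>_def\<close>)
    finally show "emeasure \<mu> {\<omega> \<in> space \<mu>. fst \<omega> \<in> D \<and> snd \<omega> \<in> C} = (\<integral>\<^sup>+\<omega>. indicator D (fst \<omega>) * emeasure (\<sigma> (fst \<omega>)) C \<partial>\<mu>)" .
  qed
  with \<sigma> show ?thesis by blast
qed

text \<open>
  The operator \<open>R g(x) = \<integral> g 1\<^bsub>\<Delta>\<^sup>c\<^esub> dQ\<^sub>\<sigma>(\<cdot>|x)\<close> of the chain killed on \<open>\<Delta>\<close>. Its iterate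
  \<open>R\<^sup>n 1(x)\<close> with \<open>n \<ge> 1\<close> is the probability of being outside \<open>\<Delta>\<close> at all times from \<open>1\<close> to \<open>n\<close> when starting from \<open>x\<close>.
\<close>

definition killed :: "('x \<Rightarrow> 'a measure) \<Rightarrow> ('x \<Rightarrow> ennreal) \<Rightarrow> 'x \<Rightarrow> ennreal" where
  "killed \<sigma> g x = (\<integral>\<^sup>+y. g y * indicator (space X - \<Delta>) y \<partial>controlled_kernel Q \<sigma> x)"

lemma killed_measurable:
  assumes \<sigma>: "\<sigma> \<in> markov_kernels X A Ad" and g[measurable]: "g \<in> borel_measurable X"
  shows "killed \<sigma> g \<in> borel_measurable X"
  unfolding killed_def[abs_def]
  by (rule measurable_compose[OF measurable_prob_algebraD[OF controlled_kernel_measurable[OF \<sigma>]] nn_integral_measurable_subprob_algebra]) measurable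

lemma killed_funpow_measurable:
  assumes \<sigma>: "\<sigma> \<in> markov_kernels X A Ad" and g: "g \<in> borel_measurable X"
  shows "(killed \<sigma> ^^ n) g \<in> borel_measurable X"
  by (induction n) (simp_all add: g killed_measurable[OF \<sigma>])

lemma killed_mono:
  assumes "\<And>x. x \<in> space X \<Longrightarrow> g x \<le> g' x" and \<sigma>: "\<sigma> \<in> markov_kernels X A Ad" and x: "x \<in> space X"
  shows "killed \<sigma> g x \<le> killed \<sigma> g' x"
  unfolding killed_def
  by (rule nn_integral_mono)
     (use assms sets_kernel_prob(2)[OF controlled_kernel_measurable[OF \<sigma>] x] in \<open>auto intro!: mult_right_mono\<close>)

lemma killed_funpow_mono:
  assumes "\<And>x. x \<in> space X \<Longrightarrow> g x \<le> g' x" and \<sigma>: "\<sigma> \<in> markov_kernels X A Ad" and x: "x \<in> space X"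
  shows "(killed \<sigma> ^^ n) g x \<le> (killed \<sigma> ^^ n) g' x"
  using x by (induction n arbitrary: x) (auto intro!: killed_mono[OF _ \<sigma>] assms)

lemma killed_one_le:
  assumes \<sigma>: "\<sigma> \<in> markov_kernels X A Ad" and x: "x \<in> space X"
  shows "killed \<sigma> (\<lambda>_. 1) x \<le> 1"
proof -
  note k = sets_kernel_prob[OF controlled_kernel_measurable[OF \<sigma>] x]
  have "killed \<sigma> (\<lambda>_. 1) x \<le> (\<integral>\<^sup>+y. 1 \<partial>controlled_kernel Q \<sigma> x)"
    unfolding killed_def by (rule nn_integral_mono) (auto simp: indicator_def)
  also have "\<dots> = 1" using prob_space.emeasure_space_1[OF k(3)] by simp
  finally show ?thesis .
qed

lemma killed_one_antimono:
  assumes \<sigma>: "\<sigma> \<in> markov_kernels X A Ad" and x: "x \<in> space X"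
  shows "(killed \<sigma> ^^ Suc n) (\<lambda>_. 1) x \<le> (killed \<sigma> ^^ n) (\<lambda>_. 1) x"
  unfolding funpow_Suc_right comp_def
  by (rule killed_funpow_mono[OF killed_one_le[OF \<sigma>] \<sigma> x])

context
  assumes absorbing: "absorbing X A Ad Q \<eta> \<Delta>"
begin

lemma killed_on_target:
  assumes \<sigma>: "\<sigma> \<in> markov_kernels X A Ad" and x: "x \<in> space X" "x \<in> \<Delta>" and g[measurable]: "g \<in> borel_measurable X"
  shows "killed \<sigma> g x = 0"
proof -
  have "killed \<sigma> g x = (\<integral>\<^sup>+a. \<integral>\<^sup>+y. g y * indicator (space X - \<Delta>) y \<partial>Q (x, a) \<partial>\<sigma> x)"
    unfolding killed_def by (rule nn_integral_controlled_kernel[OF \<sigma> x(1)]) measurable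
  also have "\<dots> = (\<integral>\<^sup>+a. 0 \<partial>\<sigma> x)"
  proof (rule nn_integral_cong)
    fix a assume "a \<in> space (\<sigma> x)"
    then have "(x, a) \<in> space SA"
      using sets_kernel_prob(2)[OF markov_kernelD(1)[OF \<sigma>] x(1)] x(1) by (simp add: space_pair_measure)
    then show "(\<integral>\<^sup>+y. g y * indicator (space X - \<Delta>) y \<partial>Q (x, a)) = 0"
      by (rule nn_integral_Q_absorbed[OF absorbing]) (use x in simp)
  qed
  finally show ?thesis by simp
qed

lemma alive_state_law_Suc:
  assumes \<pi>: "\<pi> \<in> policies X A Ad" and \<sigma>: "\<sigma> \<in> markov_kernels X A Ad"
    and eq: "\<And>h x. x \<in> space X \<Longrightarrow> \<pi> t (h, x) = \<sigma> x" and g[measurable]: "g \<in> borel_measurable X"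
  shows "(\<integral>\<^sup>+x. g x * indicator (space X - \<Delta>) x \<partial>state_law \<pi> (Suc t)) =
     (\<integral>\<^sup>+x. killed \<sigma> g x * indicator (space X - \<Delta>) x \<partial>state_law \<pi> t)"
proof -
  have "(\<integral>\<^sup>+x. g x * indicator (space X - \<Delta>) x \<partial>state_law \<pi> (Suc t)) = (\<integral>\<^sup>+x. killed \<sigma> g x \<partial>state_law \<pi> t)"
    unfolding killed_def by (rule nn_integral_state_law_Suc_markov[OF \<pi> \<sigma> eq]) measurable
  also have "\<dots> = (\<integral>\<^sup>+x. killed \<sigma> g x * indicator (space X - \<Delta>) x \<partial>state_law \<pi> t)"
    by (rule nn_integral_cong) (auto simp: indicator_def killed_on_target[OF \<sigma> _ _ g])
  finally show ?thesis .
qed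

lemma alive_switch_policy:
  assumes \<xi>: "\<xi> \<in> markov_kernels X A Ad" and \<sigma>: "\<sigma> \<in> markov_kernels X A Ad" and g: "g \<in> borel_measurable X"
  shows "(\<integral>\<^sup>+x. g x * indicator (space X - \<Delta>) x \<partial>state_law (switch_policy \<xi> k \<sigma>) (k + n)) =
    (\<integral>\<^sup>+x. (killed \<sigma> ^^ n) g x * indicator (space X - \<Delta>) x \<partial>state_law (switch_policy \<xi> k \<sigma>) k)"
  using g
proof (induction n arbitrary: g)
  case (Suc n)
  have "(\<integral>\<^sup>+x. g x * indicator (space X - \<Delta>) x \<partial>state_law (switch_policy \<xi> k \<sigma>) (k + Suc n)) =
     (\<integral>\<^sup>+x. killed \<sigma> g x * indicator (space X - \<Delta>) x \<partial>state_law (switch_policy \<xi> k \<sigma>) (k + n))"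
    unfolding add_Suc_right
    by (rule alive_state_law_Suc[OF switch_policy[OF \<xi> \<sigma>] \<sigma> _ Suc.prems]) (simp add: switch_policy_def)
  also have "\<dots> = (\<integral>\<^sup>+x. (killed \<sigma> ^^ n) (killed \<sigma> g) x * indicator (space X - \<Delta>) x \<partial>state_law (switch_policy \<xi> k \<sigma>) k)"
    by (rule Suc.IH[OF killed_measurable[OF \<sigma> Suc.prems]])
  finally show ?case by (simp add: funpow_swap1)
qed simp

text \<open>
  Integrated against \<open>\<eta> Q\<^sub>\<xi>\<^sup>k\<close>, the survival probability up to \<open>n\<close> under \<open>\<sigma>\<close> is the probability that the policy
  switching from \<open>\<xi>\<close> to \<open>\<sigma>\<close> at time \<open>k\<close> has not been absorbed at time \<open>k + n\<close>. This tends to zero, because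
  the expected hitting time of the switching policy is finite.
\<close>

lemma survival_null:
  assumes \<xi>: "\<xi> \<in> markov_kernels X A Ad" and \<sigma>: "\<sigma> \<in> markov_kernels X A Ad"
  shows "(\<integral>\<^sup>+x. (INF n. (killed \<sigma> ^^ n) (\<lambda>_. 1) x) \<partial>ref_law \<xi> k) = 0"
proof -
  let ?\<pi> = "switch_policy \<xi> k \<sigma>" and ?h = "\<lambda>n. (killed \<sigma> ^^ n) (\<lambda>_. 1)"
  note \<pi> = switch_policy[OF \<xi> \<sigma>, of k]
  have hm[measurable]: "?h n \<in> borel_measurable X" for n by (rule killed_funpow_measurable[OF \<sigma>]) simp
  have le: "(\<integral>\<^sup>+x. (INF n. ?h n x) \<partial>ref_law \<xi> k) \<le> emeasure (state_law ?\<pi> (Suc n + k)) (space X - \<Delta>)" for n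
  proof -
    \<comment> \<open>At least one step is taken: \<open>R\<^sup>0 1 = 1\<close> does not vanish on
      \<open>\<Delta>\<close>, but every later iterate does.\<close>
    have "(\<integral>\<^sup>+x. (INF n. ?h n x) \<partial>ref_law \<xi> k) \<le> (\<integral>\<^sup>+x. ?h (Suc n) x \<partial>ref_law \<xi> k)"
      by (intro nn_integral_mono INF_lower) simp
    also have "\<dots> = (\<integral>\<^sup>+x. ?h (Suc n) x \<partial>state_law ?\<pi> k)"
      by (rule state_law_eq_ref_law[OF \<xi> \<sigma> hm order_refl, symmetric])
    also have "\<dots> = (\<integral>\<^sup>+x. ?h (Suc n) x * indicator (space X - \<Delta>) x \<partial>state_law ?\<pi> k)"
      by (rule nn_integral_cong) (auto simp: indicator_def killed_on_target[OF \<sigma> _ _ hm])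
    also have "\<dots> = (\<integral>\<^sup>+x. 1 * indicator (space X - \<Delta>) x \<partial>state_law ?\<pi> (k + Suc n))"
      by (rule alive_switch_policy[OF \<xi> \<sigma>, symmetric]) simp
    also have "\<dots> = emeasure (state_law ?\<pi> (Suc n + k)) (space X - \<Delta>)" by (simp add: add.commute)
    finally show ?thesis .
  qed
  have "(\<lambda>n. emeasure (state_law ?\<pi> (n + Suc k)) (space X - \<Delta>)) \<longlonglongrightarrow> 0"
    by (rule LIMSEQ_ignore_initial_segment[OF alive_tendsto_0[OF absorbing \<pi>]])
  then have "(\<integral>\<^sup>+x. (INF n. ?h n x) \<partial>ref_law \<xi> k) \<le> 0"
    by (rule LIMSEQ_le_const) (use le in auto)
  then show ?thesis by simp
qed

text \<open>
  The characteristic equation \<open>m = \<eta> 1\<^bsub>\<Delta>\<^sup>c\<^esub> + m R\<close> for functions instead of sets, with the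
  integral over the actions carried out by the disintegration.
\<close>

lemma marginal_equation:
  assumes fin: "finite_measure \<mu>" and s: "sets \<mu> = sets SA" 
    and char: "\<And>B. B \<in> sets X \<Longrightarrow> emeasure (state_marginal X \<mu>) B =
       emeasure \<eta> (B \<inter> (space X - \<Delta>)) + (\<integral>\<^sup>+ z. emeasure (Q z) (B \<inter> (space X - \<Delta>)) \<partial>\<mu>)"
    and \<sigma>: "\<sigma> \<in> markov_kernels X A Ad" and h: "has_cond_law \<mu> X AS fst snd \<sigma>" and ne: "space \<mu> \<noteq> {}"
    and g[measurable]: "g \<in> borel_measurable X"
  shows "(\<integral>\<^sup>+x. g x \<partial>state_marginal X \<mu>) =
     (\<integral>\<^sup>+x. g x * indicator (space X - \<Delta>) x \<partial>\<eta>) + (\<integral>\<^sup>+x. killed \<sigma> g x \<partial>state_marginal X \<mu>)"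
proof -
  let ?Dc = "space X - \<Delta>"
  have s\<eta>[measurable_cong]: "sets \<eta> = sets X" using initial_distribution by (simp add: prob_measures_def)
  have Q\<mu>: "Q \<in> \<mu> \<rightarrow>\<^sub>M subprob_algebra X" unfolding measurable_cong_sets[OF s refl] by (rule Q_sub)
  have sQ[measurable_cong]: "sets (\<mu> \<bind> Q) = sets X" by (rule sets_bind[OF sets_kernel[OF Q\<mu>] ne])
  \<comment> \<open>The two measures on the right-hand side are viewed as a sequence padded with zeros, so that the
    passage from sets to functions is that for countable sums.\<close>
  define M :: "nat \<Rightarrow> 'x measure" where
    "M k = (if k = 0 then density \<eta> (indicator ?Dc) else if k = 1 then density (\<mu> \<bind> Q) (indicator ?Dc) else null_measure X)" for k
  have two: "(\<Sum>k. F k) = F 0 + F 1" if "\<And>k. k \<ge> 2 \<Longrightarrow> F k = 0" for F :: "nat \<Rightarrow> ennreal"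
  proof -
    have "F k = 0" if "k \<notin> {0, 1}" for k using that by (intro \<open>\<And>k. k \<ge> 2 \<Longrightarrow> F k = 0\<close>) auto
    then show ?thesis by (subst suminf_finite[of "{0,1}"]) auto
  qed
  have eM: "(\<integral>\<^sup>+x. u x \<partial>M 0) = (\<integral>\<^sup>+x. u x * indicator ?Dc x \<partial>\<eta>)"
      "(\<integral>\<^sup>+x. u x \<partial>M 1) = (\<integral>\<^sup>+z. \<integral>\<^sup>+y. u y * indicator ?Dc y \<partial>Q z \<partial>\<mu>)"
      "\<And>k. k \<ge> 2 \<Longrightarrow> (\<integral>\<^sup>+x. u x \<partial>M k) = 0" if [measurable]: "u \<in> borel_measurable X" for u
  proof -
    show "(\<integral>\<^sup>+x. u x \<partial>M 0) = (\<integral>\<^sup>+x. u x * indicator ?Dc x \<partial>\<eta>)"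
      unfolding M_def by (simp add: nn_integral_density mult.commute)
    have "(\<integral>\<^sup>+x. u x \<partial>M 1) = (\<integral>\<^sup>+x. u x * indicator ?Dc x \<partial>(\<mu> \<bind> Q))"
      unfolding M_def by (simp add: nn_integral_density mult.commute)
    also have "\<dots> = (\<integral>\<^sup>+z. \<integral>\<^sup>+y. u y * indicator ?Dc y \<partial>Q z \<partial>\<mu>)"
      by (rule nn_integral_bind[OF _ Q\<mu>]) measurable
    finally show "(\<integral>\<^sup>+x. u x \<partial>M 1) = (\<integral>\<^sup>+z. \<integral>\<^sup>+y. u y * indicator ?Dc y \<partial>Q z \<partial>\<mu>)" .
    show "(\<integral>\<^sup>+x. u x \<partial>M k) = 0" if "k \<ge> 2" for k
      using that unfolding M_def by (simp)
  qed
  have sM: "sets (M k) = sets X" for k unfolding M_def by (simp add: s\<eta> sQ)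
  have "(\<integral>\<^sup>+x. g x \<partial>state_marginal X \<mu>) = (\<Sum>k. \<integral>\<^sup>+x. g x \<partial>M k)"
  proof (rule nn_integral_suminf_measure)
    show "sets (M k) = sets (state_marginal X \<mu>)" for k by (simp add: sM state_marginal_def)
    show "g \<in> borel_measurable (state_marginal X \<mu>)" by (simp add: state_marginal_def)
    fix B assume "B \<in> sets (state_marginal X \<mu>)"
    then have B[measurable]: "B \<in> sets X" by (simp add: state_marginal_def)
    have e: "emeasure (M k) B = (\<integral>\<^sup>+x. indicator B x \<partial>M k)" for k using sM B by simp
    have "(\<integral>\<^sup>+x. indicator B x * indicator ?Dc x \<partial>\<eta>) = (\<integral>\<^sup>+x. indicator (B \<inter> ?Dc) x \<partial>\<eta>)"
      by (rule nn_integral_cong) (auto simp: indicator_def)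
    also have "\<dots> = emeasure \<eta> (B \<inter> ?Dc)" by (rule nn_integral_indicator) (simp add: s\<eta>)
    finally have 1: "(\<integral>\<^sup>+x. indicator B x * indicator ?Dc x \<partial>\<eta>) = emeasure \<eta> (B \<inter> ?Dc)" .
    have 2: "(\<integral>\<^sup>+z. \<integral>\<^sup>+y. indicator B y * indicator ?Dc y \<partial>Q z \<partial>\<mu>) = (\<integral>\<^sup>+z. emeasure (Q z) (B \<inter> ?Dc) \<partial>\<mu>)"
    proof (rule nn_integral_cong)
      fix z assume "z \<in> space \<mu>"
      then have z: "sets (Q z) = sets X" by (rule sets_kernel[OF Q\<mu>])
      have "(\<integral>\<^sup>+y. indicator B y * indicator ?Dc y \<partial>Q z) = (\<integral>\<^sup>+y. indicator (B \<inter> ?Dc) y \<partial>Q z)"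
        by (rule nn_integral_cong) (auto simp: indicator_def)
      also have "\<dots> = emeasure (Q z) (B \<inter> ?Dc)" by (rule nn_integral_indicator) (simp add: z)
      finally show "(\<integral>\<^sup>+y. indicator B y * indicator ?Dc y \<partial>Q z) = emeasure (Q z) (B \<inter> ?Dc)" .
    qed
    show "emeasure (state_marginal X \<mu>) B = (\<Sum>k. emeasure (M k) B)"
      unfolding e by (subst two) (simp_all add: eM[of "indicator B"] 1 2 char[OF B] del: nn_integral_indicator One_nat_def)
  qed
  also have "\<dots> = (\<integral>\<^sup>+x. g x * indicator ?Dc x \<partial>\<eta>) + (\<integral>\<^sup>+z. \<integral>\<^sup>+y. g y * indicator ?Dc y \<partial>Q z \<partial>\<mu>)"
    by (subst two) (simp_all add: eM[OF g] del: One_nat_def)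
  also have "(\<integral>\<^sup>+z. \<integral>\<^sup>+y. g y * indicator ?Dc y \<partial>Q z \<partial>\<mu>) = (\<integral>\<^sup>+x. killed \<sigma> g x \<partial>state_marginal X \<mu>)"
  proof -
    have f[measurable]: "fst \<in> \<mu> \<rightarrow>\<^sub>M X" "snd \<in> \<mu> \<rightarrow>\<^sub>M AS" unfolding measurable_cong_sets[OF s refl] by simp_all
    have gm: "(\<lambda>z. \<integral>\<^sup>+y. g y * indicator ?Dc y \<partial>Q z) \<in> borel_measurable SA"
      by (rule nn_integral_Q_measurable) measurable
    have "(\<integral>\<^sup>+z. \<integral>\<^sup>+y. g y * indicator ?Dc y \<partial>Q z \<partial>\<mu>) = (\<integral>\<^sup>+z. \<integral>\<^sup>+y. g y * indicator ?Dc y \<partial>Q (fst z, snd z) \<partial>\<mu>)" by simp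
    also have "\<dots> = (\<integral>\<^sup>+z. \<integral>\<^sup>+a. \<integral>\<^sup>+y. g y * indicator ?Dc y \<partial>Q (fst z, a) \<partial>\<sigma> (fst z) \<partial>\<mu>)"
      by (rule nn_integral_cond_law[OF fin ne f markov_kernelD(1)[OF \<sigma>] h gm])
    also have "\<dots> = (\<integral>\<^sup>+z. killed \<sigma> g (fst z) \<partial>\<mu>)"
      unfolding killed_def
      by (rule nn_integral_cong, rule nn_integral_controlled_kernel[OF \<sigma>, symmetric]) (auto dest: measurable_space[OF f(1)])
    also have "\<dots> = (\<integral>\<^sup>+x. killed \<sigma> g x \<partial>state_marginal X \<mu>)"
      unfolding state_marginal_def using killed_measurable[OF \<sigma> g] by (subst nn_integral_distr) auto
    finally show ?thesis .
  qed
  finally show ?thesis .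
qed

text \<open>
  Iterating the marginal equation leaves a remainder bounded by \<open>\<integral> R\<^sup>n 1 dm\<close>, and domination of \<open>m\<close> by the
  reference measure forces this to vanish in the limit. The resulting formula for \<open>\<integral> g dm\<close> is applied
  to \<open>g(x) = \<sigma>({a. (x,a) \<in> \<Gamma>}|x)\<close>, which gives \<open>\<mu>(\<Gamma>)\<close> on one side and the occupation measure of \<open>\<Gamma>\<close> on the other.
\<close>

lemma characteristic_is_occupation:
  assumes \<mu>: "\<mu> \<in> characteristic_measures X A Ad Q \<eta> \<Delta>"
    and \<xi>: "\<xi> \<in> markov_kernels X A Ad" and \<beta>: "0 < \<beta>" "\<beta> < 1"
    and ac: "absolutely_continuous (reference_measure X Q \<eta> \<xi> \<beta>) (state_marginal X \<mu>)"
  shows "\<mu> \<in> occupation_measures X A Ad Q \<eta> \<Delta>"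
proof -
  let ?Dc = "space X - \<Delta>" and ?m = "state_marginal X \<mu>"
  have s: "sets \<mu> = sets SA" and fin: "finite_measure \<mu>" and K: "emeasure \<mu> (space SA - feasible_pairs X Ad) = 0"
    and char: "\<And>B. B \<in> sets X \<Longrightarrow> emeasure ?m B = emeasure \<eta> (B \<inter> ?Dc) + (\<integral>\<^sup>+ z. emeasure (Q z) (B \<inter> ?Dc) \<partial>\<mu>)"
    using \<mu> by (auto simp: characteristic_measures_def finite_measures_def)
  obtain \<sigma> where \<sigma>: "\<sigma> \<in> markov_kernels X A Ad" and h: "has_cond_law \<mu> X AS fst snd \<sigma>"
    using feasible_disintegration[OF fin s K] by blast
  have ne: "space \<mu> \<noteq> {}"
    using state_space_nonempty available_nonempty available_subset sets_eq_imp_space_eq[OF s] by (fastforce simp: space_pair_measure)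
  have f[measurable]: "fst \<in> \<mu> \<rightarrow>\<^sub>M X" "snd \<in> \<mu> \<rightarrow>\<^sub>M AS" unfolding measurable_cong_sets[OF s refl] by simp_all
  have sm[measurable_cong]: "sets ?m = sets X" by (simp add: state_marginal_def)
  have spm: "space ?m = space X" using sm by (rule sets_eq_imp_space_eq)
  interpret m: finite_measure ?m
    unfolding state_marginal_def by (rule finite_measure.finite_measure_distr[OF fin f(1)])
  let ?\<pi> = "switch_policy \<sigma> 0 \<sigma>"
  note \<pi> = switch_policy[OF \<sigma> \<sigma>, of 0]
  let ?h = "\<lambda>n. (killed \<sigma> ^^ n) (\<lambda>_. 1)"
  have hm[measurable]: "?h n \<in> borel_measurable X" for n by (rule killed_funpow_measurable[OF \<sigma>]) simp
  have iter: "(\<integral>\<^sup>+x. g x \<partial>?m) = (\<Sum>t<n. \<integral>\<^sup>+x. g x * indicator ?Dc x \<partial>state_law ?\<pi> t) + (\<integral>\<^sup>+x. (killed \<sigma> ^^ n) g x \<partial>?m)"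
    if "g \<in> borel_measurable X" for g n
    using that
  proof (induction n arbitrary: g)
    case (Suc n)
    note g = Suc.prems
    have "(\<integral>\<^sup>+x. g x \<partial>?m) = (\<integral>\<^sup>+x. g x * indicator ?Dc x \<partial>\<eta>) + (\<integral>\<^sup>+x. killed \<sigma> g x \<partial>?m)"
      by (rule marginal_equation[OF fin s char \<sigma> h ne g])
    also have "(\<integral>\<^sup>+x. killed \<sigma> g x \<partial>?m) =
        (\<Sum>t<n. \<integral>\<^sup>+x. killed \<sigma> g x * indicator ?Dc x \<partial>state_law ?\<pi> t) + (\<integral>\<^sup>+x. (killed \<sigma> ^^ n) (killed \<sigma> g) x \<partial>?m)"
      by (rule Suc.IH[OF killed_measurable[OF \<sigma> g]])
    also have "(\<Sum>t<n. \<integral>\<^sup>+x. killed \<sigma> g x * indicator ?Dc x \<partial>state_law ?\<pi> t) =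
        (\<Sum>t<n. \<integral>\<^sup>+x. g x * indicator ?Dc x \<partial>state_law ?\<pi> (Suc t))"
      by (intro sum.cong refl alive_state_law_Suc[OF \<pi> \<sigma> _ g, symmetric]) (simp add: switch_policy_def)
    also have "(\<integral>\<^sup>+x. g x * indicator ?Dc x \<partial>\<eta>) = (\<integral>\<^sup>+x. g x * indicator ?Dc x \<partial>state_law ?\<pi> 0)"
      by (simp only: state_law_0[OF \<pi>])
    finally show ?case unfolding sum.lessThan_Suc_shift by (simp add: funpow_swap1 add.assoc)
  qed simp
  have INF0: "(INF n. \<integral>\<^sup>+x. ?h n x \<partial>?m) = 0"
  proof -
    define N where "N = {x \<in> space X. (INF n. ?h n x) \<noteq> 0}"
    have N: "N \<in> sets X" unfolding N_def by measurable
    have "emeasure (ref_law \<xi> k) N = 0" for k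
    proof -
      note rs = ref_law_prob(2)[OF \<xi>, of k]
      have "(\<lambda>x. INF n. ?h n x) \<in> borel_measurable (ref_law \<xi> k)"
        unfolding measurable_cong_sets[OF rs refl] by measurable
      then have "AE x in ref_law \<xi> k. (INF n. ?h n x) = 0"
        using survival_null[OF \<xi> \<sigma>, of k] by (subst (asm) nn_integral_0_iff_AE) auto
      then show ?thesis
        using N rs sets_eq_imp_space_eq[OF rs] by (subst (asm) AE_iff_measurable[where N=N]) (auto simp: N_def)
    qed
    then have "N \<in> null_sets ?m"
      using ac N by (auto simp: absolutely_continuous_def reference_null_iff[OF \<xi> \<beta>])
    then have "AE x in ?m. (INF n. ?h n x) = 0"
      by (rule AE_I') (auto simp: N_def spm)
    then have "(\<integral>\<^sup>+x. (INF n. ?h n x) \<partial>?m) = (\<integral>\<^sup>+x. 0 \<partial>?m)" by (rule nn_integral_cong_AE)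
    moreover have "(\<integral>\<^sup>+x. (INF n. ?h n x) \<partial>?m) = (INF n. \<integral>\<^sup>+x. ?h n x \<partial>?m)"
    proof (rule nn_integral_monotone_convergence_INF_AE)
      show "AE x in ?m. ?h (Suc n) x \<le> ?h n x" for n
        by (rule AE_I2) (rule killed_one_antimono[OF \<sigma>], simp add: spm)
      show "?h n \<in> borel_measurable ?m" for n by measurable
      show "(\<integral>\<^sup>+x. ?h 0 x \<partial>?m) < \<infinity>" by (simp add: m.emeasure_finite less_top[symmetric])
    qed
    ultimately show ?thesis by simp
  qed
  have dec: "decseq (\<lambda>n. \<integral>\<^sup>+x. ?h n x \<partial>?m)"
    by (intro decseq_SucI nn_integral_mono killed_one_antimono[OF \<sigma>]) (simp add: spm)
  have h0: "(\<lambda>n. \<integral>\<^sup>+x. ?h n x \<partial>?m) \<longlonglongrightarrow> 0"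
    using LIMSEQ_INF[OF dec] unfolding INF0 .
  have marg: "(\<integral>\<^sup>+x. g x \<partial>?m) = (\<Sum>t. \<integral>\<^sup>+x. g x * indicator ?Dc x \<partial>state_law ?\<pi> t)"
    if g: "g \<in> borel_measurable X" and le: "\<And>x. x \<in> space X \<Longrightarrow> g x \<le> 1" for g
  proof -
    have "(\<lambda>n. \<integral>\<^sup>+x. (killed \<sigma> ^^ n) g x \<partial>?m) \<longlonglongrightarrow> 0"
    proof (rule tendsto_sandwich[OF _ _ tendsto_const h0])
      show "\<forall>\<^sub>F n in sequentially. (\<integral>\<^sup>+x. (killed \<sigma> ^^ n) g x \<partial>?m) \<le> (\<integral>\<^sup>+x. ?h n x \<partial>?m)"
        by (intro always_eventually allI nn_integral_mono killed_funpow_mono[OF _ \<sigma>]) (simp_all add: spm le)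
    qed simp
    moreover have "(\<lambda>n. \<Sum>t<n. \<integral>\<^sup>+x. g x * indicator ?Dc x \<partial>state_law ?\<pi> t) \<longlonglongrightarrow>
        (\<Sum>t. \<integral>\<^sup>+x. g x * indicator ?Dc x \<partial>state_law ?\<pi> t)"
      by (rule summable_LIMSEQ[OF summableI])
    ultimately have "(\<lambda>n. (\<Sum>t<n. \<integral>\<^sup>+x. g x * indicator ?Dc x \<partial>state_law ?\<pi> t) + (\<integral>\<^sup>+x. (killed \<sigma> ^^ n) g x \<partial>?m))
      \<longlonglongrightarrow> (\<Sum>t. \<integral>\<^sup>+x. g x * indicator ?Dc x \<partial>state_law ?\<pi> t) + 0"
      by (intro tendsto_add)
    then show ?thesis unfolding iter[OF g, symmetric] by (simp add: LIMSEQ_const_iff)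
  qed
  have "\<mu> = occupation_measure X A Q \<eta> \<Delta> ?\<pi>"
  proof (rule measure_eqI)
    note absorb' = absorb[OF absorbing]
    show "sets \<mu> = sets (occupation_measure X A Q \<eta> \<Delta> ?\<pi>)"
      using s sets_occupation_measure[OF \<pi> absorb'] by simp
    fix \<Gamma> assume "\<Gamma> \<in> sets \<mu>"
    then have G[measurable]: "\<Gamma> \<in> sets SA" by (simp add: s)
    let ?g = "\<lambda>x. \<integral>\<^sup>+a. indicator \<Gamma> (x, a) \<partial>\<sigma> x"
    have gm[measurable]: "?g \<in> borel_measurable X"
      by (rule nn_integral_kernel_measurable[OF \<sigma>]) measurable
    have g1: "?g x \<le> 1" if x: "x \<in> space X" for x
    proof -
      have "?g x \<le> (\<integral>\<^sup>+a. 1 \<partial>\<sigma> x)" by (rule nn_integral_mono) (auto simp: indicator_def)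
      also have "\<dots> = 1" using prob_space.emeasure_space_1[OF sets_kernel_prob(3)[OF markov_kernelD(1)[OF \<sigma>] x]] by simp
      finally show ?thesis .
    qed
    have "emeasure \<mu> \<Gamma> = (\<integral>\<^sup>+z. indicator \<Gamma> (fst z, snd z) \<partial>\<mu>)" using s G by simp
    also have "\<dots> = (\<integral>\<^sup>+z. ?g (fst z) \<partial>\<mu>)"
      by (rule nn_integral_cond_law[OF fin ne f markov_kernelD(1)[OF \<sigma>] h]) measurable
    also have "\<dots> = (\<integral>\<^sup>+x. ?g x \<partial>?m)"
      unfolding state_marginal_def by (rule nn_integral_distr[OF f(1), symmetric]) simp
    also have "\<dots> = (\<Sum>t. \<integral>\<^sup>+x. ?g x * indicator ?Dc x \<partial>state_law ?\<pi> t)"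
      by (rule marg[OF gm g1])
    also have "(\<lambda>t. \<integral>\<^sup>+x. ?g x * indicator ?Dc x \<partial>state_law ?\<pi> t) =
      (\<lambda>t. \<integral>\<^sup>+z. indicator ?Dc (fst z) * indicator \<Gamma> z \<partial>pair_law ?\<pi> t)"
    proof
      fix t
      have "(\<integral>\<^sup>+z. indicator ?Dc (fst z) * indicator \<Gamma> z \<partial>pair_law ?\<pi> t) =
          (\<integral>\<^sup>+x. \<integral>\<^sup>+a. indicator ?Dc (fst (x, a)) * indicator \<Gamma> (x, a) \<partial>\<sigma> x \<partial>state_law ?\<pi> t)"
      proof (rule nn_integral_pair_law_markov[OF \<pi> \<sigma>])
        show "(\<lambda>z. indicator ?Dc (fst z) * indicator \<Gamma> z :: ennreal) \<in> borel_measurable SA" by measurable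
      qed (simp add: switch_policy_def)
      also have "\<dots> = (\<integral>\<^sup>+x. ?g x * indicator ?Dc x \<partial>state_law ?\<pi> t)"
        by (rule nn_integral_cong) (auto simp: indicator_def)
      finally show "(\<integral>\<^sup>+x. ?g x * indicator ?Dc x \<partial>state_law ?\<pi> t) =
         (\<integral>\<^sup>+z. indicator ?Dc (fst z) * indicator \<Gamma> z \<partial>pair_law ?\<pi> t)" by simp
    qed
    also have "(\<Sum>t. \<integral>\<^sup>+z. indicator ?Dc (fst z) * indicator \<Gamma> z \<partial>pair_law ?\<pi> t) =
        (\<integral>\<^sup>+z. indicator \<Gamma> z \<partial>occupation_measure X A Q \<eta> \<Delta> ?\<pi>)"
      by (rule nn_integral_occupation_measure[OF \<pi> absorb', symmetric]) measurable
    also have "\<dots> = emeasure (occupation_measure X A Q \<eta> \<Delta> ?\<pi>) \<Gamma>"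
      using G sets_occupation_measure[OF \<pi> absorb'] by simp
    finally show "emeasure \<mu> \<Gamma> = emeasure (occupation_measure X A Q \<eta> \<Delta> ?\<pi>) \<Gamma>" .
  qed
  then show ?thesis using \<pi> by (auto simp: occupation_measures_def)
qed

end

end

theorem theorem4p6:
  fixes X :: "'x measure"
    and A :: "'a::polish_space set"
    and Ad :: "'x \<Rightarrow> 'a set"
    and Q :: "'x \<times> 'a \<Rightarrow> 'x measure"
    and \<eta> :: "'x measure"
    and \<Delta> :: "'x set"
    and \<xi> :: "'x \<Rightarrow> 'a measure"
    and \<beta> :: real
  assumes "control_model X A Ad Q \<eta> \<Delta>"
    and "absorbing X A Ad Q \<eta> \<Delta>"
    and "condition_S X A Ad Q"
    and "\<xi> \<in> markov_kernels X A Ad"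
    and "dominating_kernel X Ad Q \<xi>"
    and "0 < \<beta>" and "\<beta> < 1"
  shows "(\<forall>\<mu>\<in>characteristic_measures X A Ad Q \<eta> \<Delta>.
            \<mu> \<in> occupation_measures X A Ad Q \<eta> \<Delta> \<longleftrightarrow>
            absolutely_continuous (reference_measure X Q \<eta> \<xi> \<beta>) (state_marginal X \<mu>))
       \<and> occupation_measures X A Ad Q \<eta> \<Delta> =
          {\<mu> \<in> finite_measures (state_action X A).
             emeasure \<mu> (space (state_action X A) - feasible_pairs X Ad) = 0 \<and>
             (\<forall>B\<in>sets X. emeasure (state_marginal X \<mu>) B =
                emeasure \<eta> (B \<inter> (space X - \<Delta>)) +
                (\<integral>\<^sup>+ z. emeasure (Q z) (B \<inter> (space X - \<Delta>)) \<partial>\<mu>)) \<and>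
             absolutely_continuous (reference_measure X Q \<eta> \<xi> \<beta>) (state_marginal X \<mu>)}"
proof -
  interpret control_model X A Ad Q \<eta> \<Delta> by fact
  let ?ac = "\<lambda>\<mu>. absolutely_continuous (reference_measure X Q \<eta> \<xi> \<beta>) (state_marginal X \<mu>)"
  have "\<mu> \<in> occupation_measures X A Ad Q \<eta> \<Delta> \<longleftrightarrow> \<mu> \<in> characteristic_measures X A Ad Q \<eta> \<Delta> \<and> ?ac \<mu>" for \<mu>
  proof
    assume "\<mu> \<in> occupation_measures X A Ad Q \<eta> \<Delta>"
    then obtain \<pi> where \<pi>: "\<pi> \<in> policies X A Ad" and \<mu>: "\<mu> = occupation_measure X A Q \<eta> \<Delta> \<pi>"
      by (auto simp: occupation_measures_def)
    show "\<mu> \<in> characteristic_measures X A Ad Q \<eta> \<Delta> \<and> ?ac \<mu>"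
      unfolding \<mu> using occupation_measure_characteristic[OF assms(2) \<pi>]
        occupation_marginal_dominated[OF assms(2,4,5,6,7) \<pi>] by blast
  next
    assume "\<mu> \<in> characteristic_measures X A Ad Q \<eta> \<Delta> \<and> ?ac \<mu>"
    then show "\<mu> \<in> occupation_measures X A Ad Q \<eta> \<Delta>"
      using characteristic_is_occupation[OF assms(2) _ assms(4,6,7)] by blast
  qed
  then show ?thesis unfolding characteristic_measures_def by blast
qed

end
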